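(* There are unique global vector fields $\mathsf{R}_k$, $1\le k\le3$, on $\mathsf{T}$ such that $$\nabla_{\mathsf{R}_k}\begin{pmatrix}\alpha_1\\\alpha_2\\\alpha_3\\\alpha_4\end{pmatrix}=\begin{pmatrix}0&C_k\\0&0\end{pmatrix}\begin{pmatrix}\alpha_1\\\alpha_2\\\alpha_3\\\alpha_4\end{pmatrix},$$ where $C_1=\begin{pmatrix}1&0\\0&0\end{pmatrix}$, $C_2=\begin{pmatrix}0&0\\0&1\end{pmatrix}$, $C_3=\begin{pmatrix}0&1\\1&0\end{pmatrix}$. Here $\nabla$ is the Gauss–Manin connection of the family of genus two curves over $\mathsf{T}$.
   Context: Everything is over $\mathbb{C}$. $\mathsf{T}$ is the moduli space of tuples $(Y,P,\alpha_1,\alpha_2,\alpha_3,\alpha_4)$, where $Y$ is a genus two curve with marked Weierstrass point $P$, written as the smooth completion $Y_t$ of $y^2=x^5+t_2x^3+t_3x^2+t_4x+t_5$ with $P=[0:1:0]$ the point at infinity, and $(\alpha_i)$ is a basis of $H^1_{\mathrm{dR}}(Y)$ with $\alpha_1,\alpha_2\in F^1H^1_{\mathrm{dR}}(Y)$ (holomorphic forms) and $$[\langle\alpha_i,\alpha_j\rangle]=\Phi:=\begin{pmatrix}0&0&1&0\\0&0&0&1\\-1&0&0&0\\0&-1&0&0\end{pmatrix},\qquad \langle\alpha,\beta\rangle:=\frac{1}{2\pi i}\int_Y\alpha\cup\beta.$$ Writing $\alpha=S\omega$ with $\omega=(\omega_1,\ldots,\omega_4)^{\mathrm{tr}}$,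 $\omega_i=[x^{i-1}dx/y]$, the space $\mathsf{T}$ is realised as the quotient $$\{(t_2,t_3,t_4,t_5,S)\ :\ \Phi=S\Omega S^{\mathrm{tr}},\ t_5\Delta\neq0,\ \det S\neq0\}/\mathbb{G}_m,$$ where $S=(s_{ij})$ is a $4\times4$ matrix whose upper right $2\times2$ block is zero, $\Delta$ is the discriminant (up to a nonzero constant) of $x^5+t_2x^3+t_3x^2+t_4x+t_5$, $$\Omega=[\langle\omega_i,\omega_j\rangle]=\begin{pmatrix}0&0&0&\frac43\\0&0&4&0\\0&-4&0&\frac43t_2\\-\frac43&0&-\frac43t_2&0\end{pmatrix},$$ and $a\in\mathbb{G}_m=\mathbb{C}^*$ acts by $t_i\mapsto a^{-2i}t_i$, $S\mapsto S\cdot\mathrm{diag}(a^{-3},a^{-1},a,a^{3})$. It has dimension $10$. Over $\mathsf{T}$ there is the tautological family of genus two curves with the tautological sections $\alpha_1,\ldots,\alpha_4$ of its relative first de Rham cohomology bundle; $\nabla_{\mathsf{R}}$ is the Gauss–Manin connection composed with the vector field $\mathsf{R}$. *)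

theory Defs
  imports
    Complex_Main
    "HOL-Library.Function_Algebras"
    "HOL-Library.FuncSet"
    "HOL-Library.Poly_Mapping"
    "HOL-Computational_Algebra.Field_as_Ring"
    "Subresultants.Subresultant_Gcd"
begin

section \<open>Algebras of regular functions, vector fields, de Rham cohomology\<close>

text \<open>Coordinate rings are represented as rings of complex valued functions on a type of points,
  with the pointwise operations.\<close>

inductive_set generated_algebra :: "('p \<Rightarrow> complex) set \<Rightarrow> ('p \<Rightarrow> complex) set"
  for G :: "('p \<Rightarrow> complex) set" where
  const: "(\<lambda>_. c) \<in> generated_algebra G"
| gen: "g \<in> G \<Longrightarrow> g \<in> generated_algebra G"
| add: "f \<in> generated_algebra G \<Longrightarrow> g \<in> generated_algebra G \<Longrightarrow> f + g \<in> generated_algebra G"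
| mult: "f \<in> generated_algebra G \<Longrightarrow> g \<in> generated_algebra G \<Longrightarrow> f * g \<in> generated_algebra G"

text \<open>Complex-linear derivations of \<open>A\<close>, i.e. global vector fields on the affine variety with
  coordinate ring \<open>A\<close>. They are made extensional, so that equality of derivations is equality
  on \<open>A\<close>.\<close>

definition derivations :: "('p \<Rightarrow> complex) set \<Rightarrow> (('p \<Rightarrow> complex) \<Rightarrow> ('p \<Rightarrow> complex)) set" where
  "derivations A = {D \<in> A \<rightarrow>\<^sub>E A.
     (\<forall>c. D (\<lambda>_. c) = 0) \<and>
     (\<forall>f\<in>A. \<forall>g\<in>A. D (f + g) = D f + D g) \<and>
     (\<forall>f\<in>A. \<forall>g\<in>A. D (f * g) = f * D g + g * D f)}"

text \<open>Kaehler differentials of \<open>B\<close> relative to a subring \<open>R\<close>: an element \<open>\<phi>\<close> of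
  \<open>formal_forms B\<close> stands for \<open>\<Sum>c. \<phi>(c) dc\<close>, so that \<open>Poly_Mapping.single c b\<close> is \<open>b dc\<close>,
  and the module of differentials is the quotient by \<open>kaehler_relations R B\<close>.\<close>

definition formal_forms :: "'b::comm_ring_1 set \<Rightarrow> ('b \<Rightarrow>\<^sub>0 'b) set" where
  "formal_forms B = {\<phi>. Poly_Mapping.keys \<phi> \<subseteq> B \<and> (\<forall>c. Poly_Mapping.lookup \<phi> c \<in> B)}"

inductive_set kaehler_relations :: "'b::comm_ring_1 set \<Rightarrow> 'b set \<Rightarrow> ('b \<Rightarrow>\<^sub>0 'b) set"
  for R B :: "'b set" where
  zero: "0 \<in> kaehler_relations R B"
| sum: "\<phi> \<in> kaehler_relations R B \<Longrightarrow> \<psi> \<in> kaehler_relations R B \<Longrightarrow>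
    \<phi> + \<psi> \<in> kaehler_relations R B"
| additive: "b \<in> B \<Longrightarrow> c \<in> B \<Longrightarrow> c' \<in> B \<Longrightarrow>
    Poly_Mapping.single (c + c') b - Poly_Mapping.single c b - Poly_Mapping.single c' b
      \<in> kaehler_relations R B"
| leibniz: "b \<in> B \<Longrightarrow> c \<in> B \<Longrightarrow> c' \<in> B \<Longrightarrow>
    Poly_Mapping.single (c * c') b - Poly_Mapping.single c (b * c') - Poly_Mapping.single c' (b * c)
      \<in> kaehler_relations R B"
| base: "b \<in> B \<Longrightarrow> r \<in> R \<Longrightarrow> Poly_Mapping.single r b \<in> kaehler_relations R B"

definition scale_form :: "'b::comm_ring_1 \<Rightarrow> ('b \<Rightarrow>\<^sub>0 'b) \<Rightarrow> ('b \<Rightarrow>\<^sub>0 'b)" where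
  "scale_form b \<phi> = Poly_Mapping.map ((*) b) \<phi>"

text \<open>Equality of classes in the first relative de Rham cohomology
  \<open>\<Omega>\<^sub>B\<^sub>/\<^sub>R / dB\<close> of an affine family of curves (where all relative 1-forms are closed).\<close>

definition H1_dR_eq :: "'b::comm_ring_1 set \<Rightarrow> 'b set \<Rightarrow> ('b \<Rightarrow>\<^sub>0 'b) \<Rightarrow> ('b \<Rightarrow>\<^sub>0 'b) \<Rightarrow> bool" where
  "H1_dR_eq R B \<phi> \<psi> \<longleftrightarrow> \<phi> \<in> formal_forms B \<and> \<psi> \<in> formal_forms B \<and>
     (\<exists>c\<in>B. \<phi> - \<psi> - Poly_Mapping.single c 1 \<in> kaehler_relations R B)"

text \<open>\<open>L\<^sub>V (b dc) = V(b) dc + b d(V(c))\<close>\<close>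

definition lie_derivative :: "('b \<Rightarrow> 'b) \<Rightarrow> ('b::comm_ring_1 \<Rightarrow>\<^sub>0 'b) \<Rightarrow> ('b \<Rightarrow>\<^sub>0 'b)" where
  "lie_derivative V \<phi> = (\<Sum>c\<in>Poly_Mapping.keys \<phi>.
     Poly_Mapping.single c (V (Poly_Mapping.lookup \<phi> c)) +
     Poly_Mapping.single (V c) (Poly_Mapping.lookup \<phi> c))"

text \<open>The Gauss--Manin connection of a smooth affine family \<open>\<pi>\<close> of curves over an affine base, where
  \<open>A\<close> and \<open>B\<close> are the coordinate rings of the base and of the total space:
  \<open>gauss_manin \<pi> A B v \<phi> \<psi>\<close> states \<open>\<nabla>\<^sub>v [\<phi>] = [\<psi>]\<close>. Following Katz and Oda, \<open>\<nabla>\<^sub>v\<close> is induced by the Lie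
  derivative along any lift \<open>V\<close> of \<open>v\<close> to the total space.
  Lifts exist, and the class obtained does not depend on the lift.\<close>

definition gauss_manin ::
  "('q \<Rightarrow> 'p) \<Rightarrow> ('p \<Rightarrow> complex) set \<Rightarrow> ('q \<Rightarrow> complex) set \<Rightarrow>
   (('p \<Rightarrow> complex) \<Rightarrow> ('p \<Rightarrow> complex)) \<Rightarrow>
   (('q \<Rightarrow> complex) \<Rightarrow>\<^sub>0 ('q \<Rightarrow> complex)) \<Rightarrow> (('q \<Rightarrow> complex) \<Rightarrow>\<^sub>0 ('q \<Rightarrow> complex)) \<Rightarrow> bool" where
  "gauss_manin \<pi> A B v \<phi> \<psi> \<longleftrightarrow> \<phi> \<in> formal_forms B \<and>
     (\<exists>V\<in>derivations B. (\<forall>r\<in>A. V (r \<circ> \<pi>) = v r \<circ> \<pi>) \<and>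
        H1_dR_eq ((\<lambda>r. r \<circ> \<pi>) ` A) B (lie_derivative V \<phi>) \<psi>)"


section \<open>The moduli space \<open>T\<close>\<close>

text \<open>Indices of matrices and of the sections \<open>\<omega>\<close>, \<open>\<alpha>\<close> start at 0: the entry \<open>S $$ (i, j)\<close> is the
  usual \<open>s\<^sub>i\<^sub>+\<^sub>1\<^sub>,\<^sub>j\<^sub>+\<^sub>1\<close>, and \<open>alpha i\<close> is the usual \<open>\<alpha>\<^sub>i\<^sub>+\<^sub>1\<close>.\<close>

record frame_data =
  t2 :: complex
  t3 :: complex
  t4 :: complex
  t5 :: complex
  S :: "complex mat"

definition quintic :: "frame_data \<Rightarrow> complex poly" where
  "quintic p = [: t5 p, t4 p, t3 p, t2 p, 0, 1 :]"

text \<open>For a monic quintic the resultant with the derivative is the discriminant (the sign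
  \<open>(-1)\<^sup>n\<^sup>(\<^sup>n\<^sup>-\<^sup>1\<^sup>)\<^sup>/\<^sup>2\<close> is 1 for \<open>n = 5\<close>).\<close>

definition disc :: "frame_data \<Rightarrow> complex" where
  "disc p = resultant (quintic p) (pderiv (quintic p))"

definition Phi :: "complex mat" where
  "Phi = mat_of_rows_list 4
    [[ 0,  0, 1, 0],
     [ 0,  0, 0, 1],
     [-1,  0, 0, 0],
     [ 0, -1, 0, 0]]"

definition Omega :: "frame_data \<Rightarrow> complex mat" where
  "Omega p = mat_of_rows_list 4
    [[0,    0,  0,              4/3],
     [0,    0,  4,              0],
     [0,    -4, 0,              4/3 * t2 p],
     [-4/3, 0,  - (4/3 * t2 p), 0]]"

definition frame_conditions :: "frame_data \<Rightarrow> bool" where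
  "frame_conditions p \<longleftrightarrow>
     S p \<in> carrier_mat 4 4 \<and>
     (\<forall>i\<in>{0,1}. \<forall>j\<in>{2,3}. S p $$ (i, j) = 0) \<and>
     Phi = S p * Omega p * transpose_mat (S p) \<and>
     t5 p * disc p \<noteq> 0 \<and> det (S p) \<noteq> 0"

lemma discriminant_witness:
  "resultant [:1,0,0,0,0,1:] (pderiv [:1,0,0,0,0,1::complex:]) \<noteq> 0"
proof -
  let ?f = "[:1,0,0,0,0,1:] :: complex poly" and ?g = "[:0,0,0,0,5:] :: complex poly"
  have pd: "pderiv ?f = ?g"
    by (rule poly_eqI) (simp add: coeff_pderiv coeff_pCons split: nat.splits)
  have bezout: "?f - [:0,1/5:] * ?g = 1"
    by (rule poly_ext) (simp add: power2_eq_square)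
  have "coprime ?f ?g"
  proof (rule coprimeI)
    fix c assume "c dvd ?f" "c dvd ?g"
    then have "c dvd ?f - [:0,1/5:] * ?g" using dvd_diff dvd_mult by blast
    then show "is_unit c" unfolding bezout .
  qed
  then show ?thesis
    unfolding pd resultant_0_gcd by (metis coprime_imp_gcd_eq_1 degree_1)
qed

definition S_witness :: "complex mat" where
  "S_witness = mat_of_rows_list 4 [[1,0,0,0],[0,1,0,0],[0,0,0,3/4],[0,0,1/4,0]]"

lemma S_witness_det: "det S_witness \<noteq> 0"
proof -
  define s' :: "complex mat" where
    "s' = mat_of_rows_list 4 [[1,0,0,0],[0,1,0,0],[0,0,0,4],[0,0,4/3,0]]"
  have c: "S_witness \<in> carrier_mat 4 4" "s' \<in> carrier_mat 4 4"
    by (auto simp: S_witness_def s'_def mat_of_rows_list_def)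
  have "S_witness * s' = 1\<^sub>m 4"
    unfolding S_witness_def s'_def mat_of_rows_list_def list.size add_0
    by (rule eq_matI) (auto simp: scalar_prod_def numeral_eq_Suc less_Suc_eq)
  then have "det S_witness * det s' = 1" using det_mult[OF c] by simp
  then show ?thesis by auto
qed

lemma S_witness_Phi:
  "t2 p = 0 \<Longrightarrow> Phi = S_witness * Omega p * transpose_mat S_witness"
  unfolding S_witness_def Phi_def Omega_def mat_of_rows_list_def list.size add_0
  by (rule eq_matI) (auto simp: scalar_prod_def numeral_eq_Suc less_Suc_eq)

lemma S_witness_block: "i \<in> {0,1} \<Longrightarrow> j \<in> {2,3} \<Longrightarrow> S_witness $$ (i, j) = 0"
  unfolding S_witness_def mat_of_rows_list_def by auto

lemma frame_conditions_witness:
  "frame_conditions \<lparr>t2 = 0, t3 = 0, t4 = 0, t5 = 1, S = S_witness\<rparr>" (is "frame_conditions ?p")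
proof -
  have q: "quintic ?p = [:1,0,0,0,0,1:]" by (simp add: quintic_def)
  have "disc ?p \<noteq> 0" unfolding disc_def q by (rule discriminant_witness)
  moreover have "S_witness \<in> carrier_mat 4 4" by (auto simp: S_witness_def mat_of_rows_list_def)
  ultimately show ?thesis
    unfolding frame_conditions_def
    using S_witness_det S_witness_Phi[of ?p] S_witness_block by auto
qed

text \<open>Points of the affine variety of which \<open>T\<close> is the quotient.\<close>

typedef frame_space = "{p. frame_conditions p}"
  using frame_conditions_witness by blast

text \<open>The diagonal matrix is \<open>diag(a\<^sup>-\<^sup>3, a\<^sup>-\<^sup>1, a, a\<^sup>3)\<close>.\<close>

definition Gm_action :: "complex \<Rightarrow> frame_data \<Rightarrow> frame_data" where
  "Gm_action a p = \<lparr>t2 = a powi (-4) * t2 p, t3 = a powi (-6) * t3 p,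
     t4 = a powi (-8) * t4 p, t5 = a powi (-10) * t5 p,
     S = S p * mat_diag 4 (\<lambda>j. a powi (2 * int j - 3))\<rparr>"

definition same_orbit :: "frame_space \<Rightarrow> frame_space \<Rightarrow> bool" where
  "same_orbit p q \<longleftrightarrow> (\<exists>a. a \<noteq> 0 \<and> Rep_frame_space q = Gm_action a (Rep_frame_space p))"

lemma Gm_action_1: "frame_conditions p \<Longrightarrow> Gm_action 1 p = p"
  unfolding Gm_action_def frame_conditions_def by (auto simp: mat_diag_one)

lemma Gm_action_mult:
  assumes "frame_conditions p" "a \<noteq> 0" "b \<noteq> 0"
  shows "Gm_action b (Gm_action a p) = Gm_action (b * a) p"
proof -
  have "S p * mat_diag 4 f * mat_diag 4 g = S p * mat_diag 4 (\<lambda>j. f j * g j)" for f g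
    using assms(1) unfolding frame_conditions_def
    by (subst assoc_mult_mat[of _ 4 4 _ 4 _ 4]) (auto simp: mat_diag_diag)
  then show ?thesis
    by (simp add: Gm_action_def power_int_mult_distrib mult_ac)
qed

text \<open>The moduli space \<open>T\<close>.\<close>

quotient_type moduli_T = frame_space / same_orbit
proof (rule equivpI)
  note fc = Rep_frame_space[simplified]
  show "reflp same_orbit"
    unfolding same_orbit_def reflp_def using Gm_action_1[OF fc] by (metis zero_neq_one)
  show "symp same_orbit"
  proof (rule sympI)
    fix p q assume "same_orbit p q"
    then obtain a where a: "a \<noteq> 0" "Rep_frame_space q = Gm_action a (Rep_frame_space p)"
      unfolding same_orbit_def by blast
    then have "Rep_frame_space p = Gm_action (1/a) (Rep_frame_space q)"
      using Gm_action_mult[OF fc, of a "1/a" p] Gm_action_1[OF fc, of p] by simp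
    then show "same_orbit q p" using a(1) unfolding same_orbit_def by (metis divide_eq_0_iff zero_neq_one)
  qed
  show "transp same_orbit"
    unfolding same_orbit_def transp_def using Gm_action_mult[OF fc] by (metis mult_eq_0_iff)
qed

text \<open>The coordinate ring of the variety of which \<open>T\<close> is the quotient: polynomials in the coordinates
  and in \<open>1/(t\<^sub>5 \<Delta>)\<close>, \<open>1/det S\<close>.\<close>

definition O_frame :: "(frame_space \<Rightarrow> complex) set" where
  "O_frame = generated_algebra ((\<lambda>g. g \<circ> Rep_frame_space) `
     ({t2, t3, t4, t5, \<lambda>p. 1 / (t5 p * disc p), \<lambda>p. 1 / det (S p)} \<union>
      {\<lambda>p. S p $$ (i, j) | i j. i < 4 \<and> j < 4}))"

text \<open>Regular functions on \<open>T\<close> are those which are regular upstairs, i.e. the coordinate ring of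
  \<open>T\<close> is the ring of \<open>G\<^sub>m\<close>-invariants. As the quotient of an affine variety by a free action of
  \<open>G\<^sub>m\<close>, \<open>T\<close> is affine, so its global vector fields are the derivations of this ring.\<close>

definition O_T :: "(moduli_T \<Rightarrow> complex) set" where
  "O_T = {f. f \<circ> abs_moduli_T \<in> O_frame}"

definition vector_fields_T :: "((moduli_T \<Rightarrow> complex) \<Rightarrow> (moduli_T \<Rightarrow> complex)) set" where
  "vector_fields_T = derivations O_T"


section \<open>The family of genus two curves\<close>

text \<open>The total space, over \<open>frame_space\<close>, of the tautological family without the section \<open>P\<close> at
  infinity. Removing one point from each curve does not change the first de Rham cohomology; it is
  through this identification that \<open>x\<^sup>2dx/y\<close> and \<open>x\<^sup>3dx/y\<close>, which have poles at \<open>P\<close>, define classes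
  in the cohomology of the complete curve.\<close>

typedef curve_space =
  "{(p :: frame_space, x :: complex, y :: complex). y\<^sup>2 = poly (quintic (Rep_frame_space p)) x}"
proof -
  fix p :: frame_space
  show ?thesis
    by (rule exI[of _ "(p, 0, csqrt (poly (quintic (Rep_frame_space p)) 0))"]) simp
qed

definition proj :: "curve_space \<Rightarrow> frame_space" where
  "proj z = (case Rep_curve_space z of (p, x, y) \<Rightarrow> p)"

definition x_coord :: "curve_space \<Rightarrow> complex" where
  "x_coord z = (case Rep_curve_space z of (p, x, y) \<Rightarrow> x)"

definition y_coord :: "curve_space \<Rightarrow> complex" where
  "y_coord z = (case Rep_curve_space z of (p, x, y) \<Rightarrow> y)"

definition O_curve :: "(curve_space \<Rightarrow> complex) set" where
  "O_curve = generated_algebra ({x_coord, y_coord} \<union> (\<lambda>r. r \<circ> proj) ` O_frame)"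

abbreviation base_ring :: "(curve_space \<Rightarrow> complex) set" where
  "base_ring \<equiv> (\<lambda>r. r \<circ> proj) ` O_frame"

text \<open>The form \<open>dx/y\<close> is the unique relative differential \<open>\<theta>\<close> with \<open>y \<theta> = dx\<close>. (Since \<open>f\<close> and \<open>f'\<close>
  generate the unit ideal, say \<open>a f + b f' = 1\<close>, it is represented by \<open>a y dx + 2 b dy\<close>.)\<close>

definition dx_over_y :: "(curve_space \<Rightarrow> complex) \<Rightarrow>\<^sub>0 (curve_space \<Rightarrow> complex)" where
  "dx_over_y = (SOME \<theta>. \<theta> \<in> formal_forms O_curve \<and>
     scale_form y_coord \<theta> - Poly_Mapping.single x_coord 1 \<in> kaehler_relations base_ring O_curve)"

definition omega :: "nat \<Rightarrow> (curve_space \<Rightarrow> complex) \<Rightarrow>\<^sub>0 (curve_space \<Rightarrow> complex)" where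
  "omega j = scale_form (x_coord ^ j) dx_over_y"

definition S_entry :: "nat \<Rightarrow> nat \<Rightarrow> frame_space \<Rightarrow> complex" where
  "S_entry i j p = S (Rep_frame_space p) $$ (i, j)"

text \<open>The tautological sections \<open>\<alpha> = S\<omega>\<close>. The action of \<open>a \<in> G\<^sub>m\<close> lifts to the family by
  \<open>(x, y) \<mapsto> (a\<^sup>-\<^sup>2 x, a\<^sup>-\<^sup>5 y)\<close>, and these sections are invariant, hence are (the pullbacks of) sections
  over \<open>T\<close>.\<close>

definition alpha :: "nat \<Rightarrow> (curve_space \<Rightarrow> complex) \<Rightarrow>\<^sub>0 (curve_space \<Rightarrow> complex)" where
  "alpha i = (\<Sum>j<4. scale_form (S_entry i j \<circ> proj) (omega j))"

text \<open>The Gauss--Manin connection \<open>\<nabla>\<^sub>R s\<^sub>i = u\<^sub>i\<close> (\<open>i = 0, \<dots>, 3\<close>) of the family over \<open>T\<close>, for invariant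
  sections \<open>s\<^sub>i\<close>, \<open>u\<^sub>i\<close>. The family over \<open>T\<close> is the descent of \<open>proj\<close> along the \<open>G\<^sub>m\<close>-torsor
  \<open>abs_moduli_T\<close>, and the connection commutes with pullback: the pullback of \<open>\<nabla>\<^sub>R s\<close> is \<open>\<nabla>\<^sub>w\<close> of the
  pullback of \<open>s\<close>, for any vector field \<open>w\<close> upstairs which is mapped to \<open>R\<close>. Such \<open>w\<close> always exist;
  two of them differ by a multiple of the Euler field of the action, along which \<open>\<nabla>\<close> kills invariant
  sections.\<close>

definition nabla_T ::
  "((moduli_T \<Rightarrow> complex) \<Rightarrow> (moduli_T \<Rightarrow> complex)) \<Rightarrow>
   (nat \<Rightarrow> (curve_space \<Rightarrow> complex) \<Rightarrow>\<^sub>0 (curve_space \<Rightarrow> complex)) \<Rightarrow>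
   (nat \<Rightarrow> (curve_space \<Rightarrow> complex) \<Rightarrow>\<^sub>0 (curve_space \<Rightarrow> complex)) \<Rightarrow> bool" where
  "nabla_T R s u \<longleftrightarrow>
     (\<exists>w\<in>derivations O_frame. (\<forall>f\<in>O_T. w (f \<circ> abs_moduli_T) = R f \<circ> abs_moduli_T) \<and>
        (\<forall>i<4. gauss_manin proj O_frame O_curve w (s i) (u i)))"

definition mat_apply :: "complex mat \<Rightarrow> (nat \<Rightarrow> (curve_space \<Rightarrow> complex) \<Rightarrow>\<^sub>0 (curve_space \<Rightarrow> complex)) \<Rightarrow>
   nat \<Rightarrow> (curve_space \<Rightarrow> complex) \<Rightarrow>\<^sub>0 (curve_space \<Rightarrow> complex)" where
  "mat_apply M s i = (\<Sum>j<4. scale_form (\<lambda>_. M $$ (i, j)) (s j))"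

definition C_mat :: "nat \<Rightarrow> complex mat" where
  "C_mat k = mat_of_rows_list 2
     (if k = 1 then [[1, 0], [0, 0]] else if k = 2 then [[0, 0], [0, 1]] else [[0, 1], [1, 0]])"

end

theory Submission
  imports Defs
begin

text \<open>The argument is an explicit computation of the Gauss--Manin connection of the family
  \<open>y\<^sup>2 = f(x)\<close>, in which the wanted vector fields can be read off.

  Cohomology. Let \<open>R\<close> and \<open>B\<close> be the coordinate rings of the space of frames and of the family of
  affine curves. Then \<open>B = R[x] \<oplus> R[x]y\<close>, and the relative differentials are the free \<open>B\<close>-module on
  \<open>\<theta> = dx/y\<close>: one has \<open>dc = D(c)\<theta>\<close>, where \<open>D\<close> is the \<open>R\<close>-linear derivation with \<open>D x = y\<close>,
  \<open>D y = f'/2\<close> (lemma \<open>relations_iff\<close>; this needs the identity \<open>a f + b f' = 1\<close> of lemma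
  \<open>bezout_quintic\<close>). So a 1-form is the same as its coefficient in \<open>B\<close>, the first cohomology is
  \<open>B/D(B)\<close>, and the class of \<open>\<omega>\<^sub>j\<close> is that of \<open>x\<^sup>j\<close>. From \<open>D(q y) = q'f + q f'/2\<close> one sees that a
  polynomial in \<open>x\<close> of degree at most 3 is exact only if it vanishes (\<open>exact_even_degree\<close>).

  Connection. A vector field \<open>w\<close> on the base moves \<open>f\<close> with a velocity \<open>f\<^sub>w\<close> of degree at most 3. If
  \<open>f\<^sub>w = \<alpha> f - g f'\<close> with polynomials \<open>\<alpha>\<close> and \<open>g\<close> in \<open>x\<close>, then \<open>w\<close> lifts to the curves by \<open>x \<mapsto> g\<close>,
  \<open>y \<mapsto> \<alpha> y / 2\<close>, and \<open>\<nabla>\<^sub>w\<close> sends the class of \<open>x\<^sup>j\<close> to that of \<open>(x\<^sup>j g)' - \<alpha> x\<^sup>j / 2\<close>. For \<open>j = 0, 1\<close> the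
  part of this class transversal to the holomorphic forms depends only on \<open>g\<^sub>2, g\<^sub>3, g\<^sub>4\<close>, where
  \<open>deg g \<le> 4\<close>, and these three coefficients are determined by it.

  Uniqueness. If two vector fields induce the same \<open>\<nabla> \<alpha>\<^sub>i\<close>, then for their difference, at every point
  of the space of frames, \<open>g\<^sub>2 = g\<^sub>3 = g\<^sub>4 = 0\<close>, because the upper right block of \<open>S\<close> is identically
  zero and so does not move. Then \<open>g\<close> is a multiple of \<open>x\<close>, and the difference is a multiple of the Euler
  field of the action of \<open>G\<^sub>m\<close>, which annihilates all functions on \<open>T\<close>
  (\<open>horizontal_direction_is_euler\<close>, \<open>euler_kills_invariants\<close>).

  Existence. Take \<open>g = g\<^sub>0 + g\<^sub>2x\<^sup>2 + g\<^sub>3x\<^sup>3 + g\<^sub>4x\<^sup>4\<close>, with \<open>g\<^sub>2, g\<^sub>3, g\<^sub>4\<close> the quadratic polynomials in the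
  lower right block of \<open>S\<close> (plus \<open>t\<^sub>2 g\<^sub>4\<close>) forced by \<open>C\<close>, with \<open>g\<^sub>1 = 0\<close> as a normalisation of the
  multiple of the Euler field, and with \<open>g\<^sub>0\<close> chosen so that \<open>\<alpha> f - g f'\<close> has degree at most 3. If \<open>A\<close> denotes
  the resulting connection matrix, the required velocity of \<open>S\<close> is \<open>M S - S A\<close>. This is tangent to the
  space of frames (\<open>frame_velocity_block\<close>, \<open>velocity_tangent\<close>), and a tangent field with regular
  components gives a derivation of \<open>R\<close> because it can be integrated to first order by curves
  (\<open>derivation_with_velocity\<close>). All formulas are homogeneous for the action of \<open>G\<^sub>m\<close>, so the derivation
  preserves invariant functions and descends to \<open>T\<close> (\<open>derivation_descends\<close>).\<close>

section \<open>Regular functions on the space of frames\<close>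

definition function_algebra :: "('p \<Rightarrow> complex) set \<Rightarrow> bool" where
  "function_algebra A \<longleftrightarrow> (\<forall>c. (\<lambda>_. c) \<in> A) \<and> (\<forall>f\<in>A. \<forall>g\<in>A. (\<lambda>p. f p + g p) \<in> A) \<and>
     (\<forall>f\<in>A. \<forall>g\<in>A. (\<lambda>p. f p * g p) \<in> A)"

context
  fixes A :: "('p \<Rightarrow> complex) set"
  assumes A: "function_algebra A"
begin

lemma function_algebra_const: "(\<lambda>_. c) \<in> A"
  and function_algebra_add: "f \<in> A \<Longrightarrow> g \<in> A \<Longrightarrow> (\<lambda>p. f p + g p) \<in> A"
  and function_algebra_mult: "f \<in> A \<Longrightarrow> g \<in> A \<Longrightarrow> (\<lambda>p. f p * g p) \<in> A"
  using A by (auto simp: function_algebra_def)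

lemma function_algebra_uminus: "f \<in> A \<Longrightarrow> (\<lambda>p. - f p) \<in> A"
  using function_algebra_mult[OF function_algebra_const[of "-1"], of f] by simp

lemma function_algebra_diff: "f \<in> A \<Longrightarrow> g \<in> A \<Longrightarrow> (\<lambda>p. f p - g p) \<in> A"
  using function_algebra_add[OF _ function_algebra_uminus, of f g] by simp

lemma function_algebra_divide: "f \<in> A \<Longrightarrow> (\<lambda>p. f p / c) \<in> A"
  using function_algebra_mult[OF function_algebra_const[of "1/c"], of f] by simp

lemma function_algebra_power: "f \<in> A \<Longrightarrow> (\<lambda>p. f p ^ n) \<in> A"
  by (induction n) (auto intro: function_algebra_const function_algebra_mult)

lemma function_algebra_sum: "(\<And>i. i \<in> I \<Longrightarrow> f i \<in> A) \<Longrightarrow> (\<lambda>p. \<Sum>i\<in>I. f i p) \<in> A"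
  by (induction I rule: infinite_finite_induct)
     (auto intro: function_algebra_const function_algebra_add)

lemma function_algebra_prod: "(\<And>i. i \<in> I \<Longrightarrow> f i \<in> A) \<Longrightarrow> (\<lambda>p. \<Prod>i\<in>I. f i p) \<in> A"
  by (induction I rule: infinite_finite_induct)
     (auto intro: function_algebra_const function_algebra_mult)

lemma function_algebra_if: "f \<in> A \<Longrightarrow> g \<in> A \<Longrightarrow> (\<lambda>p. if b then f p else g p) \<in> A"
  by (cases b) auto

lemma function_algebra_det:
  assumes M: "\<And>p. M p \<in> carrier_mat n n"
    and entries: "\<And>i j. i < n \<Longrightarrow> j < n \<Longrightarrow> (\<lambda>p. M p $$ (i, j)) \<in> A"
  shows "(\<lambda>p. det (M p)) \<in> A"
proof -
  have "(\<lambda>p. det (M p)) =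
      (\<lambda>p. \<Sum>\<sigma>\<in>{\<sigma>. \<sigma> permutes {0..<n}}. signof \<sigma> * (\<Prod>i=0..<n. M p $$ (i, \<sigma> i)))"
    by (rule ext) (rule det_def'[OF M])
  also have "\<dots> \<in> A"
    by (intro function_algebra_sum function_algebra_mult function_algebra_const
        function_algebra_prod entries) (auto simp: permutes_in_image[of _ "{0..<n}"])
  finally show ?thesis .
qed

end

lemma function_algebra_generated: "function_algebra (generated_algebra G)"
  unfolding function_algebra_def
  using generated_algebra.const generated_algebra.add generated_algebra.mult
  by (auto simp: plus_fun_def times_fun_def) fastforce+

lemma function_algebra_O_frame: "function_algebra O_frame"
  unfolding O_frame_def by (rule function_algebra_generated)

lemma function_algebra_O_curve: "function_algebra O_curve"
  unfolding O_curve_def by (rule function_algebra_generated)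

lemmas regular_intros =
  function_algebra_const[OF function_algebra_O_frame] function_algebra_add[OF function_algebra_O_frame]
  function_algebra_mult[OF function_algebra_O_frame] function_algebra_uminus[OF function_algebra_O_frame]
  function_algebra_diff[OF function_algebra_O_frame] function_algebra_divide[OF function_algebra_O_frame]
  function_algebra_power[OF function_algebra_O_frame] function_algebra_sum[OF function_algebra_O_frame]

lemma generated_algebra_subset:
  assumes "function_algebra A" "G \<subseteq> A" shows "generated_algebra G \<subseteq> A"
proof
  fix f assume "f \<in> generated_algebra G"
  then show "f \<in> A"
    by induction (use assms in \<open>auto simp: function_algebra_def plus_fun_def times_fun_def\<close>)
qed

definition T2 :: "frame_space \<Rightarrow> complex" where "T2 p = t2 (Rep_frame_space p)"
definition T3 :: "frame_space \<Rightarrow> complex" where "T3 p = t3 (Rep_frame_space p)"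
definition T4 :: "frame_space \<Rightarrow> complex" where "T4 p = t4 (Rep_frame_space p)"
definition T5 :: "frame_space \<Rightarrow> complex" where "T5 p = t5 (Rep_frame_space p)"

abbreviation fq :: "frame_space \<Rightarrow> complex poly" where
  "fq p \<equiv> quintic (Rep_frame_space p)"

lemma quintic_T: "quintic (Rep_frame_space p) = [:T5 p, T4 p, T3 p, T2 p, 0, 1:]"
  by (simp add: quintic_def T2_def T3_def T4_def T5_def)

lemma frame_conditions_Rep: "frame_conditions (Rep_frame_space p)"
  using Rep_frame_space by simp

definition coordinates :: "(frame_space \<Rightarrow> complex) set" where
  "coordinates = {T2, T3, T4, T5} \<union> {S_entry i j | i j. i < 4 \<and> j < 4}"

definition discriminant :: "frame_space \<Rightarrow> complex" where
  "discriminant p = disc (Rep_frame_space p)"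

definition det_frame :: "frame_space \<Rightarrow> complex" where
  "det_frame p = det (S (Rep_frame_space p))"

lemma O_frame_alt: "O_frame = generated_algebra
    (coordinates \<union> {\<lambda>p. 1 / (T5 p * discriminant p), \<lambda>p. 1 / det_frame p})"
proof -
  have "(\<lambda>g. g \<circ> Rep_frame_space) ` {\<lambda>p. S p $$ (i, j) | i j. i < 4 \<and> j < 4}
      = {S_entry i j | i j. i < 4 \<and> j < 4}"
    by (auto simp: S_entry_def[abs_def] o_def image_def)
  then have "(\<lambda>g. g \<circ> Rep_frame_space) `
     ({t2, t3, t4, t5, \<lambda>p. 1 / (t5 p * disc p), \<lambda>p. 1 / det (S p)} \<union>
      {\<lambda>p. S p $$ (i, j) | i j. i < 4 \<and> j < 4})
    = coordinates \<union> {\<lambda>p. 1 / (T5 p * discriminant p), \<lambda>p. 1 / det_frame p}"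
    unfolding image_Un coordinates_def
    by (auto simp: T2_def[abs_def] T3_def[abs_def] T4_def[abs_def] T5_def[abs_def]
        discriminant_def[abs_def] det_frame_def[abs_def] o_def)
  then show ?thesis unfolding O_frame_def by simp
qed

lemma degree_quintic: "degree (quintic p) = 5"
  by (simp add: quintic_def)

lemma pderiv_quintic: "pderiv (quintic p) = [:t4 p, 2 * t3 p, 3 * t2 p, 0, 5:]"
  by (rule poly_eqI) (simp add: quintic_def coeff_pderiv coeff_pCons split: nat.splits)

lemma degree_pderiv_quintic: "degree (pderiv (quintic p)) = 4"
  by (simp add: pderiv_quintic)

definition sylv :: "frame_space \<Rightarrow> complex mat" where
  "sylv p = sylvester_mat (fq p) (pderiv (fq p))"

lemma sylv_carrier: "sylv p \<in> carrier_mat 9 9"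
  using sylvester_carrier_mat[of "fq p" "pderiv (fq p)"]
  by (simp add: sylv_def degree_quintic degree_pderiv_quintic)

lemma discriminant_det_sylv: "discriminant p = det (sylv p)"
  by (simp add: discriminant_def disc_def resultant_def sylv_def)

context
  fixes A :: "('q \<Rightarrow> complex) set" and d :: "'q \<Rightarrow> frame_data"
  assumes A: "function_algebra A"
    and t: "(\<lambda>q. t2 (d q)) \<in> A" "(\<lambda>q. t3 (d q)) \<in> A" "(\<lambda>q. t4 (d q)) \<in> A" "(\<lambda>q. t5 (d q)) \<in> A"
begin

lemma coeff_quintic_alg:
  "(\<lambda>q. coeff (quintic (d q)) n) \<in> A" "(\<lambda>q. coeff (pderiv (quintic (d q))) n) \<in> A"
proof -
  have *: "(\<lambda>q. coeff (quintic (d q)) n) \<in> A" for n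
  proof (cases "n < 6")
    case True
    then have "n \<in> {0, 1, 2, 3, 4, 5}" by auto
    then show ?thesis using t
      by (auto simp: quintic_def function_algebra_const[OF A] coeff_pCons numeral_eq_Suc)
  next
    case False
    then show ?thesis by (simp add: coeff_eq_0 degree_quintic function_algebra_const[OF A])
  qed
  then show "(\<lambda>q. coeff (quintic (d q)) n) \<in> A" .
  show "(\<lambda>q. coeff (pderiv (quintic (d q))) n) \<in> A"
    unfolding coeff_pderiv by (intro function_algebra_mult[OF A] function_algebra_const[OF A] *)
qed

lemma sylvester_entries_alg:
  assumes "i < 9" "j < 9"
  shows "(\<lambda>q. sylvester_mat (quintic (d q)) (pderiv (quintic (d q))) $$ (i, j)) \<in> A"
  using assms
  by (subst sylvester_index_mat; (unfold degree_quintic degree_pderiv_quintic)?)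
     (auto intro!: function_algebra_if[OF A] function_algebra_const[OF A] coeff_quintic_alg)

text \<open>The discriminant is the determinant of a matrix with entries in the coefficients of the quintic. The
  statement is for an arbitrary family \<open>d\<close>, so as to cover regular functions, continuous functions
  and functions satisfying an induction hypothesis alike.\<close>

lemma disc_alg: "(\<lambda>q. disc (d q)) \<in> A"
  unfolding disc_def resultant_def
proof (rule function_algebra_det[OF A])
  show "sylvester_mat (quintic (d q)) (pderiv (quintic (d q))) \<in> carrier_mat 9 9" for q
    using sylvester_carrier_mat[of "quintic (d q)" "pderiv (quintic (d q))"]
    by (simp add: degree_quintic degree_pderiv_quintic)
qed (rule sylvester_entries_alg)

end

lemma T_functions:
  "(\<lambda>p. t2 (Rep_frame_space p)) = T2" "(\<lambda>p. t3 (Rep_frame_space p)) = T3"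
  "(\<lambda>p. t4 (Rep_frame_space p)) = T4" "(\<lambda>p. t5 (Rep_frame_space p)) = T5"
  by (auto simp: T2_def T3_def T4_def T5_def)

lemma sylv_entries:
  "function_algebra A \<Longrightarrow> {T2, T3, T4, T5} \<subseteq> A \<Longrightarrow> i < 9 \<Longrightarrow> j < 9 \<Longrightarrow> (\<lambda>p. sylv p $$ (i, j)) \<in> A"
  unfolding sylv_def by (rule sylvester_entries_alg) (simp_all add: T_functions)

lemma discriminant_alg:
  "function_algebra A \<Longrightarrow> {T2, T3, T4, T5} \<subseteq> A \<Longrightarrow> discriminant \<in> A"
  unfolding discriminant_def[abs_def] by (rule disc_alg) (simp_all add: T_functions)

lemma det_frame_alg:
  assumes "function_algebra A" "coordinates \<subseteq> A" shows "det_frame \<in> A"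
proof -
  have "(\<lambda>p. det (S (Rep_frame_space p))) \<in> A"
  proof (rule function_algebra_det[OF assms(1)])
    show "S (Rep_frame_space p) \<in> carrier_mat 4 4" for p
      using frame_conditions_Rep[of p] by (simp add: frame_conditions_def)
    show "(\<lambda>p. S (Rep_frame_space p) $$ (i, j)) \<in> A" if "i < 4" "j < 4" for i j
      using assms(2) that by (auto simp: coordinates_def S_entry_def[abs_def])
  qed
  then show ?thesis by (simp add: det_frame_def[abs_def])
qed

lemma T5_nonzero: "T5 p \<noteq> 0" and discriminant_nonzero: "discriminant p \<noteq> 0"
  and det_frame_nonzero: "det_frame p \<noteq> 0"
  using frame_conditions_Rep[of p]
  by (auto simp: frame_conditions_def T5_def discriminant_def det_frame_def)

lemma coordinates_regular: "coordinates \<subseteq> O_frame"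
  unfolding O_frame_alt by (auto intro: generated_algebra.gen)

lemma T_regular: "T2 \<in> O_frame" "T3 \<in> O_frame" "T4 \<in> O_frame" "T5 \<in> O_frame"
  and S_entry_regular: "i < 4 \<Longrightarrow> j < 4 \<Longrightarrow> S_entry i j \<in> O_frame"
  using coordinates_regular by (auto simp: coordinates_def)

lemma inverse_discriminant_regular: "(\<lambda>p. 1 / discriminant p) \<in> O_frame"
proof -
  have "(\<lambda>p. 1 / (T5 p * discriminant p)) \<in> O_frame"
    unfolding O_frame_alt by (auto intro: generated_algebra.gen)
  from function_algebra_mult[OF function_algebra_O_frame T_regular(4) this]
  show ?thesis using T5_nonzero by simp
qed

text \<open>Regular functions are obtained from the coordinates by algebra operations and by inverting
  nowhere vanishing functions. Stating the last rule for all such functions makes the inductions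
  below independent of the shape of the discriminant and of the determinant.\<close>

lemma O_frame_induct [consumes 1, case_names const coordinate add mult inverse]:
  assumes "f \<in> O_frame"
    and const: "\<And>c. P (\<lambda>_. c)"
    and coordinate: "\<And>h. h \<in> coordinates \<Longrightarrow> P h"
    and add: "\<And>f g. f \<in> O_frame \<Longrightarrow> g \<in> O_frame \<Longrightarrow> P f \<Longrightarrow> P g \<Longrightarrow> P (\<lambda>p. f p + g p)"
    and mult: "\<And>f g. f \<in> O_frame \<Longrightarrow> g \<in> O_frame \<Longrightarrow> P f \<Longrightarrow> P g \<Longrightarrow> P (\<lambda>p. f p * g p)"
    and inverse: "\<And>f. f \<in> O_frame \<Longrightarrow> (\<lambda>p. 1 / f p) \<in> O_frame \<Longrightarrow> (\<And>p. f p \<noteq> 0) \<Longrightarrow> P f \<Longrightarrow>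
        P (\<lambda>p. 1 / f p)"
  shows "P f"
proof -
  let ?A = "{f \<in> O_frame. P f}"
  have A: "function_algebra ?A"
    using const add mult by (auto simp: function_algebra_def intro: regular_intros)
  have coords: "coordinates \<subseteq> ?A" using coordinates_regular coordinate by auto
  have T: "{T2, T3, T4, T5} \<subseteq> ?A" using coords by (auto simp: coordinates_def)
  have "(\<lambda>p. T5 p * discriminant p) \<in> ?A"
    by (rule function_algebra_mult[OF A]) (use T discriminant_alg[OF A T] in auto)
  moreover have "det_frame \<in> ?A" by (rule det_frame_alg[OF A coords])
  moreover have "(\<lambda>p. 1 / (T5 p * discriminant p)) \<in> O_frame" "(\<lambda>p. 1 / det_frame p) \<in> O_frame"
    unfolding O_frame_alt by (auto intro: generated_algebra.gen)
  ultimately have "(\<lambda>p. 1 / (T5 p * discriminant p)) \<in> ?A" "(\<lambda>p. 1 / det_frame p) \<in> ?A"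
    using T5_nonzero discriminant_nonzero det_frame_nonzero by (auto intro!: inverse)
  with coords have "generated_algebra
    (coordinates \<union> {\<lambda>p. 1 / (T5 p * discriminant p), \<lambda>p. 1 / det_frame p}) \<subseteq> ?A"
    by (intro generated_algebra_subset[OF A]) auto
  then show ?thesis using assms(1) unfolding O_frame_alt[symmetric] by auto
qed

text \<open>Differentiation of functions along curves \<open>\<epsilon> \<mapsto> c q \<epsilon>\<close> is well defined on functions, whereas for
  a derivation given by its values on generators one would have to check compatibility with all
  relations between them. This is how derivations of the coordinate ring are constructed below.\<close>

lemma derivative_along_curves:
  assumes A: "function_algebra A"
    and start: "\<And>f. f \<in> O_frame \<Longrightarrow> (\<lambda>q. f (c q 0)) \<in> A"
    and coords: "\<And>h. h \<in> coordinates \<Longrightarrow>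
      \<exists>d\<in>A. \<forall>q. ((\<lambda>e. h (c q e)) has_field_derivative d q) (at 0)"
    and "f \<in> O_frame"
  shows "\<exists>d\<in>A. \<forall>q. ((\<lambda>e. f (c q e)) has_field_derivative d q) (at 0)"
  using assms(4)
proof (induction rule: O_frame_induct)
  case (const k)
  then show ?case using function_algebra_const[OF A, of 0] by (auto intro!: derivative_eq_intros)
next
  case (coordinate h)
  then show ?case by (rule coords)
next
  case (add f g)
  then obtain d d' where d: "d \<in> A" "d' \<in> A"
    "\<And>q. ((\<lambda>e. f (c q e)) has_field_derivative d q) (at 0)"
    "\<And>q. ((\<lambda>e. g (c q e)) has_field_derivative d' q) (at 0)" by auto
  show ?case
    by (rule bexI[OF _ function_algebra_add[OF A d(1,2)]]) (auto intro!: DERIV_add d)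
next
  case (mult f g)
  then obtain d d' where d: "d \<in> A" "d' \<in> A"
    "\<And>q. ((\<lambda>e. f (c q e)) has_field_derivative d q) (at 0)"
    "\<And>q. ((\<lambda>e. g (c q e)) has_field_derivative d' q) (at 0)" by auto
  show ?case
    by (rule bexI[OF _ function_algebra_add[OF A
          function_algebra_mult[OF A d(1) start[OF mult(2)]]
          function_algebra_mult[OF A d(2) start[OF mult(1)]]]]) (auto intro!: DERIV_mult d)
next
  case (inverse f)
  then obtain d where d: "d \<in> A"
    "\<And>q. ((\<lambda>e. f (c q e)) has_field_derivative d q) (at 0)" by auto
  note i = start[OF inverse(2)]
  show ?case
  proof (rule bexI[OF _ function_algebra_uminus[OF A function_algebra_mult[OF A
          function_algebra_mult[OF A i d(1)] i]]], intro allI)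
    fix q
    show "((\<lambda>e. 1 / f (c q e)) has_field_derivative
        - (1 / f (c q 0) * d q * (1 / f (c q 0)))) (at 0)"
      using inverse(3) by (auto intro!: derivative_eq_intros d simp: field_simps power2_eq_square)
  qed
qed

section \<open>The coordinate ring of the family of curves\<close>

text \<open>Elements of \<open>R[x]\<close>, for the coordinate ring \<open>R\<close> of the space of frames, as families of complex
  polynomials. Fiberwise, polynomials have coefficients in a field and all the usual operations are
  available.\<close>

definition regular_family :: "(frame_space \<Rightarrow> complex poly) \<Rightarrow> bool" where
  "regular_family P \<longleftrightarrow> (\<exists>n. \<forall>p. degree (P p) \<le> n) \<and> (\<forall>i. (\<lambda>p. coeff (P p) i) \<in> O_frame)"

lemma regular_familyD:
  assumes "regular_family P"
  shows "\<exists>n. \<forall>p. degree (P p) \<le> n" "(\<lambda>p. coeff (P p) i) \<in> O_frame"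
  using assms by (auto simp: regular_family_def)

lemma regular_family_const: "r \<in> O_frame \<Longrightarrow> regular_family (\<lambda>p. [:r p:])"
  unfolding regular_family_def
proof (intro conjI allI)
  fix i assume "r \<in> O_frame"
  then show "(\<lambda>p. coeff [:r p:] i) \<in> O_frame" by (cases i) (auto intro: regular_intros(1))
qed (auto intro!: exI[of _ 0])

lemma regular_family_fixed: "regular_family (\<lambda>_. q)"
  unfolding regular_family_def by (auto intro: regular_intros)

lemma regular_family_add:
  assumes P: "regular_family P" and Q: "regular_family Q"
  shows "regular_family (\<lambda>p. P p + Q p)"
proof -
  obtain n m where "\<forall>p. degree (P p) \<le> n" "\<forall>p. degree (Q p) \<le> m"
    using regular_familyD(1)[OF P] regular_familyD(1)[OF Q] by blast
  then have "\<forall>p. degree (P p + Q p) \<le> max n m" 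
    by (auto intro!: degree_add_le max.coboundedI1[of "degree (P _)"] max.coboundedI2[of "degree (Q _)"])
  then show ?thesis unfolding regular_family_def coeff_add
    using regular_familyD(2)[OF P] regular_familyD(2)[OF Q] by (auto intro: regular_intros)
qed

lemma regular_family_mult:
  assumes P: "regular_family P" and Q: "regular_family Q"
  shows "regular_family (\<lambda>p. P p * Q p)"
proof -
  obtain n m where "\<forall>p. degree (P p) \<le> n" "\<forall>p. degree (Q p) \<le> m"
    using regular_familyD(1)[OF P] regular_familyD(1)[OF Q] by blast
  then have "\<forall>p. degree (P p * Q p) \<le> n + m" 
    by (auto intro!: order_trans[OF degree_mult_le] add_mono)
  then show ?thesis unfolding regular_family_def coeff_mult
    using regular_familyD(2)[OF P] regular_familyD(2)[OF Q] by (auto intro!: regular_intros)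
qed

lemma regular_family_smult:
  "r \<in> O_frame \<Longrightarrow> regular_family P \<Longrightarrow> regular_family (\<lambda>p. smult (r p) (P p))"
  using regular_family_mult[OF regular_family_const, of r P] by simp

lemma regular_family_smult_const: "regular_family P \<Longrightarrow> regular_family (\<lambda>p. smult k (P p))"
  by (rule regular_family_smult[OF regular_intros(1)])

lemma regular_family_uminus: "regular_family P \<Longrightarrow> regular_family (\<lambda>p. - P p)"
  using regular_family_smult_const[of P "-1"] by simp

lemma regular_family_diff:
  "regular_family P \<Longrightarrow> regular_family Q \<Longrightarrow> regular_family (\<lambda>p. P p - Q p)"
  using regular_family_add[OF _ regular_family_uminus, of P Q] by simp

lemma regular_family_sum:
  "(\<And>i. i \<in> I \<Longrightarrow> regular_family (P i)) \<Longrightarrow> regular_family (\<lambda>p. \<Sum>i\<in>I. P i p)"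
  by (induction I rule: infinite_finite_induct) (auto intro: regular_family_fixed regular_family_add)

lemma regular_family_pCons:
  assumes "r \<in> O_frame" "regular_family P" shows "regular_family (\<lambda>p. pCons (r p) (P p))"
proof -
  have "regular_family (\<lambda>p. [:r p:] + [:0, 1:] * P p)"
    by (intro regular_family_add regular_family_mult regular_family_const regular_family_fixed assms)
  then show ?thesis by simp
qed

lemma regular_family_pderiv:
  assumes P: "regular_family P" shows "regular_family (\<lambda>p. pderiv (P p))"
proof -
  obtain n where "\<forall>p. degree (P p) \<le> n" using regular_familyD(1)[OF P] by blast
  then have "\<forall>p. degree (pderiv (P p)) \<le> n" unfolding degree_pderiv using diff_le_self order_trans by blast
  then show ?thesis unfolding regular_family_def coeff_pderiv
    using regular_familyD(2)[OF P] by (auto intro!: regular_intros)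
qed

lemma regular_family_quintic: "regular_family fq"
  unfolding quintic_T by (intro regular_family_pCons T_regular regular_family_fixed regular_intros(1))

lemmas regular_family_intros = regular_family_fixed regular_family_add
  regular_family_mult regular_family_smult_const regular_family_smult regular_family_uminus regular_family_diff
  regular_family_sum regular_family_pderiv regular_family_quintic

lemma curve_equation: "y_coord z ^ 2 = poly (fq (proj z)) (x_coord z)"
  using Rep_curve_space[of z] by (auto simp: y_coord_def x_coord_def proj_def)

lemma point_on_curve:
  assumes "y ^ 2 = poly (fq p) x"
  obtains z where "proj z = p" "x_coord z = x" "y_coord z = y"
proof -
  have "Rep_curve_space (Abs_curve_space (p, x, y)) = (p, x, y)"
    using assms by (intro Abs_curve_space_inverse) auto
  then show ?thesis
    using that[of "Abs_curve_space (p, x, y)"] by (simp add: proj_def x_coord_def y_coord_def)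
qed

text \<open>The element \<open>P(x) + Q(x)y\<close> of \<open>R[x] \<oplus> R[x]y\<close>.\<close>

definition fiber_fun ::
  "(frame_space \<Rightarrow> complex poly) \<Rightarrow> (frame_space \<Rightarrow> complex poly) \<Rightarrow> curve_space \<Rightarrow> complex" where
  "fiber_fun P Q z = poly (P (proj z)) (x_coord z) + poly (Q (proj z)) (x_coord z) * y_coord z"

lemma fiber_fun_add:
  "fiber_fun P Q z + fiber_fun P' Q' z = fiber_fun (\<lambda>p. P p + P' p) (\<lambda>p. Q p + Q' p) z"
  by (simp add: fiber_fun_def algebra_simps)

lemma fiber_fun_mult:
  "fiber_fun P Q z * fiber_fun P' Q' z =
   fiber_fun (\<lambda>p. P p * P' p + Q p * Q' p * fq p) (\<lambda>p. P p * Q' p + Q p * P' p) z"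
proof -
  have "u * y_coord z * (v * y_coord z) = u * v * poly (fq (proj z)) (x_coord z)" for u v
    by (simp add: curve_equation[symmetric] power2_eq_square)
  then show ?thesis by (simp add: fiber_fun_def algebra_simps)
qed

text \<open>The points \<open>(x, y)\<close> and \<open>(x, -y)\<close> separate the even and the odd part; the odd part is then known
  up to the factor \<open>f\<close>, which is not zero.\<close>

lemma fiber_fun_inject:
  assumes "fiber_fun P Q = fiber_fun P' Q'" shows "P = P'" "Q = Q'"
proof -
  have *: "P p = P' p \<and> Q p = Q' p" for p
  proof -
    have "poly (P p - P' p) x = 0 \<and> poly ((Q p - Q' p) * fq p) x = 0" for x
    proof -
      have split: "a - b = c - d \<Longrightarrow> a = c \<and> b = d" if "a + b = c + d" for a b c d :: complex
      proof -
        assume "a - b = c - d"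
        with that have "(a + b) + (a - b) = (c + d) + (c - d)" by simp
        then have "a = c" by simp
        with that show ?thesis by simp
      qed
      define y where "y = csqrt (poly (fq p) x)"
      have y: "y ^ 2 = poly (fq p) x" "(- y) ^ 2 = poly (fq p) x" by (simp_all add: y_def)
      have eq: "poly (P p) x + poly (Q p) x * y' = poly (P' p) x + poly (Q' p) x * y'"
        if y': "y' ^ 2 = poly (fq p) x" for y'
        using assms by (rule_tac point_on_curve[OF y']) (auto simp: fiber_fun_def fun_eq_iff)
      have "poly (P p) x = poly (P' p) x" "poly (Q p) x * y = poly (Q' p) x * y"
        using split[OF eq[OF y(1)]] eq[OF y(2)] by auto
      moreover from this have "poly (Q p) x * y ^ 2 = poly (Q' p) x * y ^ 2"
        by (simp add: power2_eq_square)
      ultimately show ?thesis using y(1) by (simp add: algebra_simps)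
    qed
    then have "P p - P' p = 0" "(Q p - Q' p) * fq p = 0" by (metis poly_all_0_iff_0)+
    moreover have "fq p \<noteq> 0" using degree_quintic[of "Rep_frame_space p"] by auto
    ultimately show ?thesis by simp
  qed
  then show "P = P'" "Q = Q'" by auto
qed

lemma poly_sum_le: "degree p \<le> n \<Longrightarrow> poly p (x :: complex) = (\<Sum>i\<le>n. coeff p i * x ^ i)"
  unfolding poly_altdef by (rule sum.mono_neutral_cong_left) (auto simp: coeff_eq_0)

lemma x_coord_in: "x_coord \<in> O_curve" and y_coord_in: "y_coord \<in> O_curve"
  and base_in: "r \<in> O_frame \<Longrightarrow> (\<lambda>z. r (proj z)) \<in> O_curve"
  unfolding O_curve_def by (auto intro!: generated_algebra.gen image_eqI[of _ _ r])

lemma poly_family_in: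
  assumes P: "regular_family P" shows "(\<lambda>z. poly (P (proj z)) (x_coord z)) \<in> O_curve"
proof -
  obtain n where n: "\<forall>p. degree (P p) \<le> n" using regular_familyD(1)[OF P] by blast
  note A = function_algebra_O_curve
  have "(\<lambda>z. \<Sum>i\<le>n. coeff (P (proj z)) i * x_coord z ^ i) \<in> O_curve"
    by (intro function_algebra_sum[OF A] function_algebra_mult[OF A] function_algebra_power[OF A]
        x_coord_in) (rule base_in[OF regular_familyD(2)[OF P]])
  then show ?thesis by (simp add: poly_sum_le[OF n[rule_format]])
qed

lemma fiber_fun_in: "regular_family P \<Longrightarrow> regular_family Q \<Longrightarrow> fiber_fun P Q \<in> O_curve"
  unfolding fiber_fun_def[abs_def]
  by (intro function_algebra_add[OF function_algebra_O_curve] poly_family_in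
      function_algebra_mult[OF function_algebra_O_curve] y_coord_in)

lemma x_coord_fiber: "x_coord = fiber_fun (\<lambda>_. [:0, 1:]) (\<lambda>_. 0)"
  and y_coord_fiber: "y_coord = fiber_fun (\<lambda>_. 0) (\<lambda>_. 1)"
  and base_fiber: "(\<lambda>z. r (proj z)) = fiber_fun (\<lambda>p. [:r p:]) (\<lambda>_. 0)"
  by (auto simp: fiber_fun_def fun_eq_iff)

text \<open>The functions \<open>P(x) + Q(x)y\<close> form an algebra, as \<open>y\<^sup>2\<close> is a polynomial in \<open>x\<close>.\<close>

lemma O_curve_cases:
  assumes "c \<in> O_curve"
  obtains P Q where "regular_family P" "regular_family Q" "c = fiber_fun P Q"
proof -
  let ?A = "{fiber_fun P Q | P Q. regular_family P \<and> regular_family Q}"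
  have "O_curve \<subseteq> ?A"
    unfolding O_curve_def
  proof (rule generated_algebra_subset)
    have const: "(\<lambda>_. k) \<in> ?A" for k
      by (rule CollectI, intro exI conjI, rule base_fiber[of "\<lambda>_. k"]) (rule regular_family_fixed)+
    show "function_algebra ?A"
      unfolding function_algebra_def
    proof (intro conjI ballI allI const)
      fix f g assume "f \<in> ?A" "g \<in> ?A"
      then obtain P Q P' Q' where f: "f = fiber_fun P Q" "regular_family P" "regular_family Q"
        and g: "g = fiber_fun P' Q'" "regular_family P'" "regular_family Q'" by blast
      show "(\<lambda>p. f p + g p) \<in> ?A" unfolding f(1) g(1) fiber_fun_add
        using regular_family_add[OF f(2) g(2)] regular_family_add[OF f(3) g(3)] by blast
      show "(\<lambda>p. f p * g p) \<in> ?A" unfolding f(1) g(1) fiber_fun_mult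
        by (rule CollectI, intro exI conjI, rule refl)
          (intro regular_family_add regular_family_mult regular_family_quintic f g)+
    qed
    show "{x_coord, y_coord} \<union> (\<lambda>r. r \<circ> proj) ` O_frame \<subseteq> ?A"
      unfolding x_coord_fiber y_coord_fiber o_def base_fiber
      by (auto intro!: exI regular_family_fixed regular_family_const)
  qed
  then show ?thesis using assms that by blast
qed

section \<open>Derivations acting on coefficients\<close>

lemma derivationsD:
  assumes "w \<in> derivations A"
  shows "f \<in> A \<Longrightarrow> w f \<in> A" "w (\<lambda>_. c) = (\<lambda>_. 0)"
    "f \<in> A \<Longrightarrow> g \<in> A \<Longrightarrow> w (\<lambda>p. f p + g p) = (\<lambda>p. w f p + w g p)"
    "f \<in> A \<Longrightarrow> g \<in> A \<Longrightarrow> w (\<lambda>p. f p * g p) = (\<lambda>p. f p * w g p + g p * w f p)"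
  using assms unfolding derivations_def
  by (auto simp: plus_fun_def times_fun_def zero_fun_def PiE_iff)

lemma derivation_sum:
  assumes w: "w \<in> derivations A" and A: "function_algebra A" and f: "\<And>i. i \<in> I \<Longrightarrow> f i \<in> A"
  shows "w (\<lambda>p. \<Sum>i\<in>I. f i p) = (\<lambda>p. \<Sum>i\<in>I. w (f i) p)"
  using f
proof (induction I rule: infinite_finite_induct)
  case (insert i I)
  have "w (\<lambda>p. f i p + (\<Sum>i\<in>I. f i p)) = (\<lambda>p. w (f i) p + w (\<lambda>p. \<Sum>i\<in>I. f i p) p)"
    by (rule derivationsD(3)[OF w]) (auto intro: insert function_algebra_sum[OF A])
  also have "w (\<lambda>p. \<Sum>i\<in>I. f i p) = (\<lambda>p. \<Sum>i\<in>I. w (f i) p)"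
    by (rule insert) (auto intro: insert)
  finally show ?case using insert(1,2) by simp
qed (simp_all add: derivationsD(2)[OF w, of 0])

text \<open>The action \<open>P \<mapsto> P\<^sub>w\<close> of a vector field \<open>w\<close> on the coefficients of a polynomial in \<open>x\<close>.\<close>

definition apply_coeffs ::
  "((frame_space \<Rightarrow> complex) \<Rightarrow> (frame_space \<Rightarrow> complex)) \<Rightarrow>
   (frame_space \<Rightarrow> complex poly) \<Rightarrow> frame_space \<Rightarrow> complex poly" where
  "apply_coeffs w P p = Abs_poly (\<lambda>i. w (\<lambda>p. coeff (P p) i) p)"

context
  fixes w assumes w: "w \<in> derivations O_frame"
begin

lemma coeff_apply_coeffs:
  assumes "regular_family P"
  shows "coeff (apply_coeffs w P p) i = w (\<lambda>p. coeff (P p) i) p"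
proof -
  obtain n where n: "\<forall>p. degree (P p) \<le> n" using regular_familyD(1)[OF assms] by blast
  have "w (\<lambda>p. coeff (P p) i) p = 0" if "i > n" for i
  proof -
    have "(\<lambda>p. coeff (P p) i) = (\<lambda>_. 0)" 
      by (rule ext, rule coeff_eq_0, rule le_less_trans[OF n[rule_format] that])
    then show ?thesis using derivationsD(2)[OF w] by simp
  qed
  then show ?thesis unfolding apply_coeffs_def
    by (subst coeff_Abs_poly[of n]) auto
qed

lemma regular_family_apply_coeffs:
  assumes "regular_family P" shows "regular_family (apply_coeffs w P)"
proof -
  obtain n where n: "\<forall>p. degree (P p) \<le> n" using regular_familyD(1)[OF assms] by blast
  have "degree (apply_coeffs w P p) \<le> n" for p
  proof (rule degree_le, intro allI impI)
    fix i assume "n < i"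
    then have "(\<lambda>p. coeff (P p) i) = (\<lambda>_. 0)" 
      by (intro ext coeff_eq_0 le_less_trans[OF n[rule_format]])
    then show "coeff (apply_coeffs w P p) i = 0"
      using derivationsD(2)[OF w] by (simp add: coeff_apply_coeffs[OF assms])
  qed
  then show ?thesis
    using derivationsD(1)[OF w regular_familyD(2)[OF assms]]
    by (auto simp: regular_family_def coeff_apply_coeffs[OF assms])
qed

lemma apply_coeffs_add:
  assumes "regular_family P" "regular_family Q"
  shows "apply_coeffs w (\<lambda>p. P p + Q p) p = apply_coeffs w P p + apply_coeffs w Q p"
  using assms
  by (intro poly_eqI) (simp add: coeff_apply_coeffs regular_family_add regular_familyD derivationsD[OF w])

lemma apply_coeffs_mult:
  assumes P: "regular_family P" and Q: "regular_family Q"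
  shows "apply_coeffs w (\<lambda>p. P p * Q p) p = P p * apply_coeffs w Q p + Q p * apply_coeffs w P p"
proof (rule poly_eqI)
  fix n
  have "coeff (apply_coeffs w (\<lambda>p. P p * Q p) p) n = w (\<lambda>p. \<Sum>i\<le>n. coeff (P p) i * coeff (Q p) (n - i)) p"
    using assms by (simp add: coeff_apply_coeffs regular_family_mult coeff_mult)
  also have "\<dots> = (\<Sum>i\<le>n. w (\<lambda>p. coeff (P p) i * coeff (Q p) (n - i)) p)"
    using assms by (subst derivation_sum[OF w function_algebra_O_frame])
      (auto intro!: regular_intros regular_familyD)
  also have "\<dots> = (\<Sum>i\<le>n. coeff (P p) i * coeff (apply_coeffs w Q p) (n - i)) +
      (\<Sum>i\<le>n. coeff (apply_coeffs w P p) i * coeff (Q p) (n - i))"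
    using assms by (simp add: derivationsD(4)[OF w] regular_familyD coeff_apply_coeffs sum.distrib mult.commute)
  also have "\<dots> = coeff (P p * apply_coeffs w Q p + apply_coeffs w P p * Q p) n"
    by (simp add: coeff_mult)
  finally show "coeff (apply_coeffs w (\<lambda>p. P p * Q p) p) n =
      coeff (P p * apply_coeffs w Q p + Q p * apply_coeffs w P p) n" by (simp add: mult.commute)
qed

lemma apply_coeffs_const:
  "r \<in> O_frame \<Longrightarrow> apply_coeffs w (\<lambda>p. [:r p:]) p = [:w r p:]"
  using derivationsD(2)[OF w]
  by (intro poly_eqI) (auto simp: coeff_apply_coeffs regular_family_const coeff_pCons split: nat.splits)

lemma apply_coeffs_fixed: "apply_coeffs w (\<lambda>_. q) p = 0"
  using derivationsD(2)[OF w]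
  by (intro poly_eqI) (auto simp: coeff_apply_coeffs regular_family_fixed)

lemma apply_coeffs_pCons:
  assumes "r \<in> O_frame" "regular_family P"
  shows "apply_coeffs w (\<lambda>p. pCons (r p) (P p)) p = pCons (w r p) (apply_coeffs w P p)"
  using assms
  by (intro poly_eqI) (auto simp: coeff_apply_coeffs regular_family_pCons coeff_pCons split: nat.splits)

lemma apply_coeffs_quintic: "apply_coeffs w fq p = [:w T5 p, w T4 p, w T3 p, w T2 p:]"
proof -
  note rf = regular_family_pCons regular_family_fixed T_regular regular_intros(1)
  have "apply_coeffs w fq p = apply_coeffs w (\<lambda>p. [:T5 p, T4 p, T3 p, T2 p, 0, 1:]) p"
    by (simp add: quintic_T[abs_def])
  also have "\<dots> = [:w T5 p, w T4 p, w T3 p, w T2 p:]"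
    using apply_coeffs_fixed[of "[:0, 1:]"] by (simp add: apply_coeffs_pCons rf)
  finally show ?thesis .
qed

end

section \<open>The vertical derivation\<close>

lemma O_curve_add: "f \<in> O_curve \<Longrightarrow> g \<in> O_curve \<Longrightarrow> f + g \<in> O_curve"
  and O_curve_mult: "f \<in> O_curve \<Longrightarrow> g \<in> O_curve \<Longrightarrow> f * g \<in> O_curve"
  unfolding O_curve_def by (auto intro: generated_algebra.intros)

lemma O_curve_const: "(\<lambda>_. k) \<in> O_curve"
  unfolding O_curve_def by (rule generated_algebra.const)

lemma O_curve_0: "0 \<in> O_curve" and O_curve_1: "1 \<in> O_curve"
  using O_curve_const[of 0] O_curve_const[of 1] by (simp_all add: zero_fun_def one_fun_def)

lemma O_curve_uminus: "f \<in> O_curve \<Longrightarrow> - f \<in> O_curve"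
  using O_curve_mult[OF O_curve_const[of "-1"], of f] by (simp add: times_fun_def fun_Compl_def)

lemma O_curve_diff: "f \<in> O_curve \<Longrightarrow> g \<in> O_curve \<Longrightarrow> f - g \<in> O_curve"
  using O_curve_add[OF _ O_curve_uminus, of f g] by simp

lemma O_curve_power: "f \<in> O_curve \<Longrightarrow> f ^ n \<in> O_curve"
  by (induction n) (auto intro: O_curve_1 O_curve_mult)

lemma O_curve_sum: "(\<And>i. i \<in> I \<Longrightarrow> f i \<in> O_curve) \<Longrightarrow> (\<Sum>i\<in>I. f i) \<in> O_curve"
  by (induction I rule: infinite_finite_induct) (auto intro: O_curve_0 O_curve_add)

lemmas O_curve_intros = O_curve_add O_curve_mult O_curve_0 O_curve_1 O_curve_uminus O_curve_diff
  O_curve_power O_curve_sum x_coord_in y_coord_in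

lemma base_comp_in: "r \<in> O_frame \<Longrightarrow> r \<circ> proj \<in> O_curve"
  using base_in by (simp add: o_def)

text \<open>The even and the odd part for the hyperelliptic involution \<open>y \<mapsto> -y\<close>; both are specified
  only for functions of the form \<open>fiber_fun P Q\<close>, in particular for all regular functions.\<close>

definition even_part :: "(curve_space \<Rightarrow> complex) \<Rightarrow> frame_space \<Rightarrow> complex poly" where
  "even_part c = (THE P. \<exists>Q. c = fiber_fun P Q)"

definition odd_part :: "(curve_space \<Rightarrow> complex) \<Rightarrow> frame_space \<Rightarrow> complex poly" where
  "odd_part c = (THE Q. \<exists>P. c = fiber_fun P Q)"

lemma parts_fiber_fun [simp]: "even_part (fiber_fun P Q) = P" "odd_part (fiber_fun P Q) = Q"
  unfolding even_part_def odd_part_def using fiber_fun_inject by blast+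

lemma fiber_fun_plus: "fiber_fun P Q + fiber_fun P' Q' = fiber_fun (\<lambda>p. P p + P' p) (\<lambda>p. Q p + Q' p)"
  by (rule ext) (simp add: fiber_fun_add)

lemma fiber_fun_times: "fiber_fun P Q * fiber_fun P' Q' =
   fiber_fun (\<lambda>p. P p * P' p + Q p * Q' p * fq p) (\<lambda>p. P p * Q' p + Q p * P' p)"
  by (rule ext) (simp add: fiber_fun_mult)

lemma fiber_fun_cong:
  "(\<And>p. P p = P' p) \<Longrightarrow> (\<And>p. Q p = Q' p) \<Longrightarrow> fiber_fun P Q = fiber_fun P' Q'"
  by presburger

text \<open>The vector field \<open>y \<partial>/\<partial>x + (f'/2) \<partial>/\<partial>y\<close> on the curves, dual to the form \<open>dx/y\<close>.\<close>

definition vertical_derivation :: "(curve_space \<Rightarrow> complex) \<Rightarrow> curve_space \<Rightarrow> complex" where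
  "vertical_derivation c = fiber_fun
     (\<lambda>p. pderiv (odd_part c p) * fq p + smult (1/2) (odd_part c p * pderiv (fq p)))
     (\<lambda>p. pderiv (even_part c p))"

abbreviation "\<D> \<equiv> vertical_derivation"

lemma vertical_fiber_fun: "\<D> (fiber_fun P Q) =
    fiber_fun (\<lambda>p. pderiv (Q p) * fq p + smult (1/2) (Q p * pderiv (fq p))) (\<lambda>p. pderiv (P p))"
  by (simp add: vertical_derivation_def)

lemma vertical_in: "c \<in> O_curve \<Longrightarrow> \<D> c \<in> O_curve"
  by (erule O_curve_cases) (simp only: vertical_fiber_fun, intro fiber_fun_in regular_family_intros)

lemma vertical_add: "f \<in> O_curve \<Longrightarrow> g \<in> O_curve \<Longrightarrow> \<D> (f + g) = \<D> f + \<D> g"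
  by (elim O_curve_cases)
    (simp only: vertical_fiber_fun fiber_fun_plus, rule fiber_fun_cong;
     simp add: pderiv_add algebra_simps smult_add_right)

lemma vertical_mult: "f \<in> O_curve \<Longrightarrow> g \<in> O_curve \<Longrightarrow> \<D> (f * g) = f * \<D> g + g * \<D> f"
  by (elim O_curve_cases)
    (simp only: vertical_fiber_fun fiber_fun_plus fiber_fun_times, rule fiber_fun_cong;
     simp add: pderiv_add pderiv_mult algebra_simps smult_add_right flip: smult_add_left)

lemma vertical_base: "\<D> (\<lambda>z. r (proj z)) = 0"
  by (simp add: base_fiber vertical_fiber_fun pderiv_pCons) (simp add: fun_eq_iff fiber_fun_def)

lemma vertical_const: "\<D> (\<lambda>_. k) = 0"
  by (rule vertical_base)

lemma vertical_x: "\<D> x_coord = y_coord"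
  by (simp add: x_coord_fiber y_coord_fiber vertical_fiber_fun pderiv_pCons)

lemma vertical_y: "\<D> y_coord = fiber_fun (\<lambda>p. smult (1/2) (pderiv (fq p))) (\<lambda>_. 0)"
  by (simp add: y_coord_fiber vertical_fiber_fun)

lemma vertical_uminus: "f \<in> O_curve \<Longrightarrow> \<D> (- f) = - \<D> f"
  using vertical_mult[OF O_curve_const[of "-1"], of f] vertical_const[of "-1"]
  by (simp add: times_fun_def fun_Compl_def zero_fun_def plus_fun_def)

lemma vertical_diff: "f \<in> O_curve \<Longrightarrow> g \<in> O_curve \<Longrightarrow> \<D> (f - g) = \<D> f - \<D> g"
  using vertical_add[OF _ O_curve_uminus, of f g] by (simp add: vertical_uminus)

section \<open>Relative differentials\<close>

text \<open>The contraction of \<open>\<Sum>c. \<phi>(c) dc\<close> with a vector field \<open>W\<close>. For the vertical derivation this is the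
  coefficient of the form with respect to \<open>dx/y\<close>.\<close>

definition contract :: "((curve_space \<Rightarrow> complex) \<Rightarrow> (curve_space \<Rightarrow> complex)) \<Rightarrow>
   ((curve_space \<Rightarrow> complex) \<Rightarrow>\<^sub>0 (curve_space \<Rightarrow> complex)) \<Rightarrow> curve_space \<Rightarrow> complex" where
  "contract W \<phi> = (\<Sum>c\<in>Poly_Mapping.keys \<phi>. Poly_Mapping.lookup \<phi> c * W c)"

text \<open>The form \<open>b dc\<close> is written \<open>fm c b\<close>, and \<open>\<kappa> \<phi>\<close> is the coefficient of \<open>\<phi>\<close> with respect to \<open>dx/y\<close>.\<close>

abbreviation "\<kappa> \<equiv> contract \<D>"
abbreviation "fm \<equiv> Poly_Mapping.single"
abbreviation "rels \<equiv> kaehler_relations base_ring O_curve"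
abbreviation "forms \<equiv> formal_forms O_curve"

lemma contract_superset:
  "finite K \<Longrightarrow> Poly_Mapping.keys \<phi> \<subseteq> K \<Longrightarrow> contract W \<phi> = (\<Sum>c\<in>K. Poly_Mapping.lookup \<phi> c * W c)"
  unfolding contract_def by (rule sum.mono_neutral_left) (auto simp: in_keys_iff)

lemma contract_add: "contract W (\<phi> + \<psi>) = contract W \<phi> + contract W \<psi>"
proof -
  let ?K = "Poly_Mapping.keys \<phi> \<union> Poly_Mapping.keys \<psi>"
  have "Poly_Mapping.keys (\<phi> + \<psi>) \<subseteq> ?K" by (rule keys_add)
  then show ?thesis
    using contract_superset[of ?K \<phi>] contract_superset[of ?K \<psi>]
      contract_superset[of ?K "\<phi> + \<psi>"]
    by (simp add: lookup_add algebra_simps sum.distrib)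
qed

lemma contract_0 [simp]: "contract W 0 = 0" by (simp add: contract_def)

lemma contract_single: "contract W (fm c b) = b * W c"
  using contract_superset[of "{c}" "fm c b"] by simp

lemma contract_uminus: "contract W (- \<phi>) = - contract W \<phi>"
  using contract_add[of W \<phi> "- \<phi>"] by (simp add: eq_neg_iff_add_eq_0 add.commute)

lemma contract_diff: "contract W (\<phi> - \<psi>) = contract W \<phi> - contract W \<psi>"
  using contract_add[of W \<phi> "- \<psi>"] by (simp add: contract_uminus)

lemma contract_sum: "contract W (\<Sum>i\<in>I. \<phi> i) = (\<Sum>i\<in>I. contract W (\<phi> i))"
  by (induction I rule: infinite_finite_induct) (auto simp: contract_add)

lemma lookup_scale_form: "Poly_Mapping.lookup (scale_form b \<phi>) c = b * Poly_Mapping.lookup \<phi> c"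
  unfolding scale_form_def by (simp add: Poly_Mapping.map.rep_eq when_def)

lemma scale_form_single: "scale_form b (fm c d) = fm c (b * d)"
  by (rule poly_mapping_eqI) (simp add: lookup_scale_form lookup_single when_def)

lemma scale_form_add: "scale_form b (\<phi> + \<psi>) = scale_form b \<phi> + scale_form b \<psi>"
  and scale_form_diff: "scale_form b (\<phi> - \<psi>) = scale_form b \<phi> - scale_form b \<psi>"
  and scale_form_scalar_add: "scale_form (b + b') \<phi> = scale_form b \<phi> + scale_form b' \<phi>"
  and scale_form_scale_form: "scale_form b (scale_form b' \<phi>) = scale_form (b * b') \<phi>"
  and scale_form_0: "scale_form 0 \<phi> = 0" "scale_form b 0 = 0"
  and scale_form_1: "scale_form 1 \<phi> = \<phi>"
  and scale_form_uminus: "scale_form (-1) \<phi> = - \<phi>"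
  by (rule poly_mapping_eqI; simp add: lookup_scale_form lookup_add lookup_minus algebra_simps)+

lemma scale_form_scalar_sum: "scale_form (\<Sum>i\<in>I. b i) \<phi> = (\<Sum>i\<in>I. scale_form (b i) \<phi>)"
  by (induction I rule: infinite_finite_induct) (auto simp: scale_form_0 scale_form_scalar_add)

lemma contract_scale: "contract W (scale_form b \<phi>) = b * contract W \<phi>"
proof -
  have "Poly_Mapping.keys (scale_form b \<phi>) \<subseteq> Poly_Mapping.keys \<phi>"
    by (auto simp: in_keys_iff lookup_scale_form)
  then show ?thesis
    using contract_superset[of "Poly_Mapping.keys \<phi>" "scale_form b \<phi>"]
    by (simp add: contract_def lookup_scale_form sum_distrib_left mult.assoc)
qed

lemma forms_0: "0 \<in> forms"
  by (simp add: formal_forms_def O_curve_0)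

lemma forms_add: "\<phi> \<in> forms \<Longrightarrow> \<psi> \<in> forms \<Longrightarrow> \<phi> + \<psi> \<in> forms"
  using keys_add[of \<phi> \<psi>] by (auto simp: formal_forms_def lookup_add intro: O_curve_add)

lemma forms_scale: "b \<in> O_curve \<Longrightarrow> \<phi> \<in> forms \<Longrightarrow> scale_form b \<phi> \<in> forms"
  by (auto simp: formal_forms_def lookup_scale_form in_keys_iff intro: O_curve_mult)
     (metis in_keys_iff mult_zero_right subsetD)

lemma forms_single: "b \<in> O_curve \<Longrightarrow> c \<in> O_curve \<Longrightarrow> fm c b \<in> forms"
  by (auto simp: formal_forms_def lookup_single when_def O_curve_0)

lemma forms_sum: "(\<And>i. i \<in> I \<Longrightarrow> \<phi> i \<in> forms) \<Longrightarrow> (\<Sum>i\<in>I. \<phi> i) \<in> forms"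
  by (induction I rule: infinite_finite_induct) (auto intro: forms_0 forms_add)

lemma contract_in:
  "\<phi> \<in> forms \<Longrightarrow> (\<And>c. c \<in> O_curve \<Longrightarrow> W c \<in> O_curve) \<Longrightarrow> contract W \<phi> \<in> O_curve"
  unfolding contract_def formal_forms_def by (auto intro!: O_curve_intros)

text \<open>Contraction with a vertical vector field is defined on Kaehler differentials.\<close>

lemma contract_relations:
  assumes add: "\<And>f g. f \<in> O_curve \<Longrightarrow> g \<in> O_curve \<Longrightarrow> W (f + g) = W f + W g"
    and mult: "\<And>f g. f \<in> O_curve \<Longrightarrow> g \<in> O_curve \<Longrightarrow> W (f * g) = f * W g + g * W f"
    and base: "\<And>r. r \<in> O_frame \<Longrightarrow> W (r \<circ> proj) = 0"
  shows "\<phi> \<in> rels \<Longrightarrow> contract W \<phi> = 0"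
proof (induction rule: kaehler_relations.induct)
  case (base b r)
  then show ?case by (auto simp: contract_single assms)
qed (simp_all add: contract_add contract_diff contract_single add mult algebra_simps)

lemma form_coefficient_relations: "\<phi> \<in> rels \<Longrightarrow> \<kappa> \<phi> = 0"
  by (rule contract_relations) (auto simp: vertical_add vertical_mult o_def vertical_base)

lemma relations_scale: "\<phi> \<in> rels \<Longrightarrow> b \<in> O_curve \<Longrightarrow> scale_form b \<phi> \<in> rels"
proof (induction rule: kaehler_relations.induct)
  case (leibniz a c c')
  then show ?case
    using kaehler_relations.leibniz[of "b * a" O_curve c c' base_ring] O_curve_mult[of b a]
    unfolding scale_form_diff scale_form_single by (simp only: mult.assoc)
qed (auto simp: scale_form_0 scale_form_add scale_form_diff scale_form_single
    intro: kaehler_relations.intros O_curve_mult)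

lemma relations_uminus: "\<phi> \<in> rels \<Longrightarrow> - \<phi> \<in> rels"
  using relations_scale[of \<phi> "-1"] O_curve_uminus[OF O_curve_1] by (simp add: scale_form_uminus)

lemma relations_diff: "\<phi> \<in> rels \<Longrightarrow> \<psi> \<in> rels \<Longrightarrow> \<phi> - \<psi> \<in> rels"
  using kaehler_relations.sum[OF _ relations_uminus] by fastforce

lemma relations_sum: "(\<And>i. i \<in> I \<Longrightarrow> \<phi> i \<in> rels) \<Longrightarrow> (\<Sum>i\<in>I. \<phi> i) \<in> rels"
  by (induction I rule: infinite_finite_induct) (auto intro: kaehler_relations.intros)

text \<open>The two coefficient vectors are the last row of the inverse of the Sylvester matrix. By Cramer's
  rule its entries are cofactors divided by the discriminant, hence regular.\<close>

lemma bezout_quintic: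
  obtains a b where "regular_family a" "regular_family b"
    "\<And>p. a p * fq p + b p * pderiv (fq p) = 1"
proof -
  \<comment> \<open>The last row of the adjugate produces the last unit vector, that is, the constant polynomial 1.\<close>
  define c where "c i p = adj_mat (sylv p) $$ (8, i) / discriminant p" for i p
  have c_reg: "c i \<in> O_frame" if "i < 9" for i
  proof -
    have "(\<lambda>p. det (mat_delete (sylv p) i 8)) \<in> O_frame"
    proof (rule function_algebra_det[OF function_algebra_O_frame, of _ 8])
      show "mat_delete (sylv p) i 8 \<in> carrier_mat 8 8" for p
        using mat_delete_carrier[OF sylv_carrier] by simp
      show "(\<lambda>p. mat_delete (sylv p) i 8 $$ (k, l)) \<in> O_frame" if "k < 8" "l < 8" for k l
        unfolding mat_delete_def using that sylv_carrier \<open>i < 9\<close>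
        by (auto simp: carrier_matD[OF sylv_carrier] T_regular
            intro!: sylv_entries[OF function_algebra_O_frame])
    qed
    then have "(\<lambda>p. adj_mat (sylv p) $$ (8, i)) \<in> O_frame"
      unfolding adj_mat_def using that sylv_carrier
      by (auto simp: carrier_matD[OF sylv_carrier] cofactor_def intro!: regular_intros)
    from regular_intros(3)[OF this inverse_discriminant_regular] show ?thesis
      by (simp add: c_def[abs_def])
  qed
  have sum_c: "(\<Sum>i<9. c i p * sylv p $$ (i, j)) = (if j = 8 then 1 else 0)" if "j < 9" for p j
  proof -
    have "(adj_mat (sylv p) * sylv p) $$ (8, j) = (discriminant p \<cdot>\<^sub>m 1\<^sub>m 9) $$ (8, j)"
      using adj_mat(3)[OF sylv_carrier] discriminant_det_sylv by simp
    then have "(\<Sum>i<9. adj_mat (sylv p) $$ (8, i) * sylv p $$ (i, j)) =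
        (if j = 8 then discriminant p else 0)"
      using that sylv_carrier[of p] adj_mat(1)[OF sylv_carrier[of p]]
      by (auto simp: scalar_prod_def atLeast0LessThan)
    then show ?thesis using discriminant_nonzero[of p]
      by (simp add: c_def sum_divide_distrib[symmetric])
  qed
  define a where "a p = (\<Sum>i<4. smult (c i p) (monom 1 (3 - i)))" for p
  define b where "b p = (\<Sum>i<5. smult (c (4 + i) p) (monom 1 (4 - i)))" for p
  have "regular_family a" "regular_family b"
    unfolding a_def[abs_def] b_def[abs_def]
    by (intro regular_family_sum regular_family_smult c_reg regular_family_fixed; simp)+
  moreover have "a p * fq p + b p * pderiv (fq p) = 1" for p
  proof (rule poly_eqI)
    fix n
    show "coeff (a p * fq p + b p * pderiv (fq p)) n = coeff 1 n"
    proof (cases "n < 9")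
      case True
      define j where "j = 8 - n"
      have j: "j < 9" "n = 8 - j" using True by (auto simp: j_def)
      \<comment> \<open>Column \<open>j\<close> of the Sylvester matrix lists the coefficients of \<open>x\<^sup>8\<^sup>-\<^sup>j\<close>.\<close>
      have s1: "sylv p $$ (i, j) = coeff (monom 1 (3 - i) * fq p) n" if "i < 4" for i
        unfolding sylv_def using that j
        by (subst sylvester_index_mat2) (auto simp: degree_quintic degree_pderiv_quintic coeff_monom_mult)
      have s2: "sylv p $$ (4 + i, j) = coeff (monom 1 (4 - i) * pderiv (fq p)) n" if "i < 5" for i
        unfolding sylv_def using that j
        by (subst sylvester_index_mat2) (auto simp: degree_quintic degree_pderiv_quintic coeff_monom_mult)
      have "coeff (a p * fq p + b p * pderiv (fq p)) n =
          (\<Sum>i<4. c i p * sylv p $$ (i, j)) + (\<Sum>i<5. c (4 + i) p * sylv p $$ (4 + i, j))"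
        unfolding a_def b_def
        by (simp add: sum_distrib_right coeff_sum s1 s2)
      also have "\<dots> = (\<Sum>i<9. c i p * sylv p $$ (i, j))"
        using sum.nat_group[of "\<lambda>i. c i p * sylv p $$ (i, j)"]
        by (simp add: numeral_eq_Suc sum.lessThan_Suc)
      also have "\<dots> = coeff 1 n" using sum_c[OF j(1)] j by auto
      finally show ?thesis .
    next
      case False
      have "degree (a p) \<le> 3" "degree (b p) \<le> 4"
        unfolding a_def b_def
        by (intro degree_sum_le order_trans[OF degree_smult_le] order_trans[OF degree_monom_le]; simp)+
      then have "degree (a p * fq p) \<le> 8" "degree (b p * pderiv (fq p)) \<le> 8"
        using degree_mult_le[of "a p" "fq p"] degree_mult_le[of "b p" "pderiv (fq p)"]
        by (auto simp: degree_quintic degree_pderiv_quintic)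
      then show ?thesis using False by (simp add: coeff_eq_0)
    qed
  qed
  ultimately show ?thesis using that by blast
qed

text \<open>Horner evaluation of a polynomial in \<open>x\<close>, given by its list of coefficients, and of its derivative.
  The recursion follows the Leibniz rule, so identities for derivations and differentials of
  polynomials are proved by induction on the list.\<close>

fun horner horner' :: "(frame_space \<Rightarrow> complex) list \<Rightarrow> curve_space \<Rightarrow> complex" where
  "horner [] = 0"
| "horner (r # rs) = (r \<circ> proj) + x_coord * horner rs"
| "horner' [] = 0"
| "horner' (r # rs) = horner rs + x_coord * horner' rs"

lemma horner_in: "set rs \<subseteq> O_frame \<Longrightarrow> horner rs \<in> O_curve \<and> horner' rs \<in> O_curve"
  by (induction rs) (auto intro!: O_curve_intros base_comp_in)

lemma O_curve_induct [consumes 1, case_names base x y add mult]: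
  assumes "c \<in> O_curve"
    and base: "\<And>r. r \<in> O_frame \<Longrightarrow> P (r \<circ> proj)"
    and "P x_coord" "P y_coord"
    and "\<And>f g. f \<in> O_curve \<Longrightarrow> g \<in> O_curve \<Longrightarrow> P f \<Longrightarrow> P g \<Longrightarrow> P (f + g)"
    and "\<And>f g. f \<in> O_curve \<Longrightarrow> g \<in> O_curve \<Longrightarrow> P f \<Longrightarrow> P g \<Longrightarrow> P (f * g)"
  shows "P c"
  using assms(1) unfolding O_curve_def
proof (induction rule: generated_algebra.induct)
  case (const k)
  then show ?case using base[OF regular_intros(1)[of k]] by (simp add: o_def)
next
  case (add f g)
  then show ?case by (intro assms(5)) (simp_all add: O_curve_def)
next
  case (mult f g)
  then show ?case by (intro assms(6)) (simp_all add: O_curve_def)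
qed (use assms(2-4) in auto)

lemma base_constant_relation: "fm (\<lambda>_. k) 1 \<in> rels"
proof (rule kaehler_relations.base[OF O_curve_1])
  have "(\<lambda>_. k) = (\<lambda>_. k) \<circ> proj" by (simp add: o_def)
  then show "(\<lambda>_. k) \<in> base_ring" using regular_intros(1) by (rule image_eqI)
qed

lemma differential_horner:
  "set rs \<subseteq> O_frame \<Longrightarrow> fm (horner rs) 1 - fm x_coord (horner' rs) \<in> rels"
proof (induction rs)
  case Nil
  then show ?case
    using base_constant_relation[of 0] unfolding horner.simps horner'.simps
    by (simp only: zero_fun_def[symmetric] single_zero diff_0_right)
next
  case (Cons r rs)
  let ?h = "horner rs" and ?h' = "horner' rs"
  have h: "?h \<in> O_curve" "?h' \<in> O_curve" and r: "r \<in> O_frame" "r \<circ> proj \<in> O_curve"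
    using horner_in[of rs] Cons.prems base_comp_in by auto
  have 1: "fm ((r \<circ> proj) + x_coord * ?h) 1 - fm (r \<circ> proj) 1 - fm (x_coord * ?h) 1 \<in> rels"
    by (intro kaehler_relations.additive O_curve_intros r h)
  have 2: "fm (r \<circ> proj) 1 \<in> rels"
    using r by (intro kaehler_relations.base O_curve_intros) auto
  have 3: "fm (x_coord * ?h) 1 - fm x_coord (1 * ?h) - fm ?h (1 * x_coord) \<in> rels"
    by (intro kaehler_relations.leibniz O_curve_intros h)
  have 4: "scale_form x_coord (fm ?h 1 - fm x_coord ?h') \<in> rels"
    by (rule relations_scale[OF Cons.IH x_coord_in]) (use Cons.prems in simp)
  have "fm (horner (r # rs)) 1 - fm x_coord (horner' (r # rs)) =
     (fm ((r \<circ> proj) + x_coord * ?h) 1 - fm (r \<circ> proj) 1 - fm (x_coord * ?h) 1) + fm (r \<circ> proj) 1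
     + (fm (x_coord * ?h) 1 - fm x_coord (1 * ?h) - fm ?h (1 * x_coord))
     + scale_form x_coord (fm ?h 1 - fm x_coord ?h')"
    by (simp add: scale_form_diff scale_form_single single_add)
  then show ?case using 1 2 3 4 by (simp only: kaehler_relations.sum)
qed

text \<open>A generator is \<open>\<theta> = a y dx + 2 b dy\<close> with \<open>a f + b f' = 1\<close>. All that is used is the relation
  \<open>2y dy = f' dx\<close>, called \<open>\<rho>\<close> in the proof.\<close>

lemma differentials_generator:
  obtains \<theta> where "\<theta> \<in> forms"
    "\<And>c. c \<in> O_curve \<Longrightarrow> fm c 1 - scale_form (\<D> c) \<theta> \<in> rels"
proof -
  obtain a b where reg: "regular_family a" "regular_family b"
    and ab: "\<And>p. a p * fq p + b p * pderiv (fq p) = 1" by (rule bezout_quintic) blast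
  define A where "A = (\<lambda>z. poly (a (proj z)) (x_coord z))"
  define B where "B = (\<lambda>z. poly (b (proj z)) (x_coord z))"
  define F where "F = y_coord * y_coord"
  define F' where "F' = (\<lambda>z. poly (pderiv (fq (proj z))) (x_coord z))"
  have in_curve: "A \<in> O_curve" "B \<in> O_curve" "F' \<in> O_curve"
    unfolding A_def B_def F'_def
    by (rule poly_family_in, intro reg regular_family_intros)+
  have bezout: "A * F + B * F' = 1"
  proof (rule ext)
    fix z
    have "poly (a (proj z) * fq (proj z) + b (proj z) * pderiv (fq (proj z))) (x_coord z) = 1"
      by (simp add: ab)
    then show "(A * F + B * F') z = 1 z"
      by (simp add: A_def B_def F_def F'_def curve_equation[symmetric] power2_eq_square)
  qed
  let ?rs = "[T5, T4, T3, T2, \<lambda>_. 0, \<lambda>_. 1]"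
  have F_horner: "F = horner ?rs"
    by (rule ext) (simp add: F_def curve_equation[unfolded power2_eq_square] quintic_T algebra_simps)
  have F'_horner: "F' = horner' ?rs"
    by (rule ext) (simp add: F'_def quintic_T pderiv_pCons algebra_simps)
  have dF: "fm F 1 - fm x_coord F' \<in> rels"
    unfolding F_horner F'_horner
    by (rule differential_horner) (auto simp: T_regular regular_intros(1))
  define \<rho> where "\<rho> = fm y_coord (y_coord + y_coord) - fm x_coord F'"
  have \<rho>: "\<rho> \<in> rels"
  proof -
    have r: "fm F 1 - fm y_coord (1 * y_coord) - fm y_coord (1 * y_coord) \<in> rels"
      unfolding F_def by (intro kaehler_relations.leibniz O_curve_intros)
    have "\<rho> = (fm F 1 - fm x_coord F') - (fm F 1 - fm y_coord (1 * y_coord) - fm y_coord (1 * y_coord))"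
      unfolding \<rho>_def single_add mult_1_left by (simp add: algebra_simps)
    then show ?thesis using relations_diff[OF dF r] by (simp only:)
  qed
  define \<theta> where "\<theta> = fm x_coord (A * y_coord) + fm y_coord (B + B)"
  have \<theta>_x: "fm x_coord 1 - scale_form y_coord \<theta> \<in> rels"
  proof -
    have "1 - y_coord * (A * y_coord) = B * F'"
      using bezout by (simp add: F_def algebra_simps)
    then have "fm x_coord 1 - fm x_coord (y_coord * (A * y_coord)) = fm x_coord (B * F')"
      by (simp flip: single_diff)
    then have "fm x_coord 1 - scale_form y_coord \<theta> = - scale_form B \<rho>"
      unfolding \<theta>_def \<rho>_def scale_form_add scale_form_diff scale_form_single
      by (simp add: algebra_simps)
    then show ?thesis using relations_uminus[OF relations_scale[OF \<rho> in_curve(2)]] by simp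
  qed
  have \<theta>_y: "fm y_coord 1 - scale_form (\<D> y_coord) \<theta> \<in> rels"
  proof -
    define h :: "curve_space \<Rightarrow> complex" where "h = (\<lambda>_. 1/2)"
    have hh: "h * f + h * f = f" for f by (simp add: h_def fun_eq_iff)
    have Dy: "\<D> y_coord = h * F'"
      by (rule ext) (simp add: vertical_y fiber_fun_def F'_def h_def)
    have 1: "1 - (h * F' * B + h * F' * B) = A * F"
      using bezout hh[of "F' * B"] by (simp add: algebra_simps)
    have 2: "h * A * y_coord * y_coord + h * A * y_coord * y_coord = A * F"
      using hh[of "A * F"] by (simp add: F_def algebra_simps)
    have "fm y_coord 1 - fm y_coord (h * F' * (B + B)) = fm y_coord (A * F)"
      unfolding 1[symmetric] by (simp add: algebra_simps single_diff)
    moreover have "scale_form (h * A * y_coord) \<rho> = fm y_coord (A * F) - fm x_coord (h * F' * (A * y_coord))"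
      unfolding \<rho>_def scale_form_diff scale_form_single 2[symmetric] by (simp add: algebra_simps)
    ultimately have "fm y_coord 1 - scale_form (\<D> y_coord) \<theta> = scale_form (h * A * y_coord) \<rho>"
      unfolding Dy \<theta>_def scale_form_add scale_form_single by (simp add: algebra_simps)
    then show ?thesis
      using relations_scale[OF \<rho>, of "h * A * y_coord"] in_curve
      by (simp add: h_def O_curve_mult O_curve_const y_coord_in)
  qed
  have "\<theta> \<in> forms"
    unfolding \<theta>_def by (intro forms_add forms_single O_curve_intros in_curve)
  moreover have "fm c 1 - scale_form (\<D> c) \<theta> \<in> rels" if "c \<in> O_curve" for c
    using that
  proof (induction rule: O_curve_induct)
    case (base r)
    have "\<D> (r \<circ> proj) = 0" using vertical_base[of r] by (simp add: o_def)
    moreover have "fm (r \<circ> proj) 1 \<in> rels" using base by (intro kaehler_relations.base O_curve_1) auto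
    ultimately show ?case by (simp only: scale_form_0 diff_0_right)
  next
    case x
    then show ?case using \<theta>_x by (simp only: vertical_x)
  next
    case y
    then show ?case by (rule \<theta>_y)
  next
    case (add f g)
    have "fm (f + g) 1 - scale_form (\<D> (f + g)) \<theta> =
      (fm (f + g) 1 - fm f 1 - fm g 1) + (fm f 1 - scale_form (\<D> f) \<theta>)
      + (fm g 1 - scale_form (\<D> g) \<theta>)"
      by (simp add: vertical_add add scale_form_scalar_add)
    then show ?case
      using kaehler_relations.additive[OF O_curve_1 add(1,2)] add(3,4)
      by (simp only: kaehler_relations.sum)
  next
    case (mult f g)
    have "fm (f * g) 1 - scale_form (\<D> (f * g)) \<theta> =
      (fm (f * g) 1 - fm f (1 * g) - fm g (1 * f)) + scale_form g (fm f 1 - scale_form (\<D> f) \<theta>)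
      + scale_form f (fm g 1 - scale_form (\<D> g) \<theta>)"
      by (simp add: vertical_mult mult scale_form_scalar_add scale_form_diff scale_form_single
          scale_form_scale_form)
    then show ?case
      using kaehler_relations.leibniz[OF O_curve_1 mult(1,2)]
        relations_scale[OF mult(3) mult(2)] relations_scale[OF mult(4) mult(1)]
      by (simp only: kaehler_relations.sum)
  qed
  ultimately show ?thesis using that by blast
qed

section \<open>The first de Rham cohomology\<close>

lemma form_decomposition: "\<phi> = (\<Sum>c\<in>Poly_Mapping.keys \<phi>. fm c (Poly_Mapping.lookup \<phi> c))"
  by (rule poly_mapping_eqI)
     (auto simp: lookup_sum lookup_single when_def in_keys_iff if_distrib sum.delta cong: if_cong)

lemma form_multiple_of_generator:
  assumes gen: "\<And>c. c \<in> O_curve \<Longrightarrow> fm c 1 - scale_form (\<D> c) \<theta> \<in> rels" and \<phi>: "\<phi> \<in> forms"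
  shows "\<phi> - scale_form (\<kappa> \<phi>) \<theta> \<in> rels"
proof -
  let ?K = "Poly_Mapping.keys \<phi>" and ?b = "Poly_Mapping.lookup \<phi>"
  have "(\<Sum>c\<in>?K. scale_form (?b c) (fm c 1 - scale_form (\<D> c) \<theta>)) \<in> rels"
    using \<phi> by (intro relations_sum relations_scale gen) (auto simp: formal_forms_def)
  moreover have "(\<Sum>c\<in>?K. scale_form (?b c) (fm c 1 - scale_form (\<D> c) \<theta>)) =
      (\<Sum>c\<in>?K. fm c (?b c)) - scale_form (\<kappa> \<phi>) \<theta>"
    by (simp add: scale_form_diff scale_form_single scale_form_scale_form sum_subtractf
        contract_def scale_form_scalar_sum)
  ultimately show ?thesis using form_decomposition[of \<phi>] by simp
qed

text \<open>The module of relative differentials is free of rank one: a form is determined by its coefficient.\<close>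

lemma relations_iff: "\<phi> \<in> forms \<Longrightarrow> \<phi> \<in> rels \<longleftrightarrow> \<kappa> \<phi> = 0"
proof
  assume \<phi>: "\<phi> \<in> forms" "\<kappa> \<phi> = 0"
  obtain \<theta> where "\<And>c. c \<in> O_curve \<Longrightarrow> fm c 1 - scale_form (\<D> c) \<theta> \<in> rels"
    by (rule differentials_generator) blast
  from form_multiple_of_generator[OF this \<phi>(1)] show "\<phi> \<in> rels" by (simp add: \<phi> scale_form_0)
qed (rule form_coefficient_relations)

lemma y_coord_cancel:
  assumes "c \<in> O_curve" "y_coord * c = y_coord" shows "c = 1"
  using assms(1)
proof (rule O_curve_cases)
  fix P Q assume c: "c = fiber_fun P Q"
  have "fiber_fun (\<lambda>p. Q p * fq p) P = fiber_fun (\<lambda>_. 0) (\<lambda>_. 1)"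
    using assms(2) by (simp add: c y_coord_fiber fiber_fun_times)
  from fiber_fun_inject[OF this] have "P = (\<lambda>_. 1)" "\<And>p. Q p * fq p = 0" by (auto simp: fun_eq_iff)
  moreover have "fq p \<noteq> 0" for p using degree_quintic[of "Rep_frame_space p"] by auto
  ultimately show "c = 1" by (auto simp: c fiber_fun_def fun_eq_iff)
qed

text \<open>The form \<open>dx/y\<close> is characterised only by \<open>y \<theta> = dx\<close>. This suffices because \<open>y\<close> is not a zero
  divisor.\<close>

lemma generator_coefficient:
  assumes "\<theta> \<in> forms" "scale_form y_coord \<theta> - fm x_coord 1 \<in> rels"
  shows "\<kappa> \<theta> = 1"
proof (rule y_coord_cancel[OF contract_in[OF assms(1) vertical_in]])
  show "y_coord * \<kappa> \<theta> = y_coord"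
    using form_coefficient_relations[OF assms(2)]
    by (simp only: contract_diff contract_scale contract_single vertical_x mult_1_left right_minus_eq)
qed

lemma dx_over_y: "dx_over_y \<in> forms" "\<kappa> dx_over_y = 1"
proof -
  let ?P = "\<lambda>\<theta>. \<theta> \<in> forms \<and> scale_form y_coord \<theta> - fm x_coord 1 \<in> rels"
  obtain \<theta> where \<theta>: "\<theta> \<in> forms" "\<And>c. c \<in> O_curve \<Longrightarrow> fm c 1 - scale_form (\<D> c) \<theta> \<in> rels"
    by (rule differentials_generator) blast
  have "scale_form y_coord \<theta> - fm x_coord 1 \<in> rels"
    using relations_uminus[OF \<theta>(2)[OF x_coord_in]] by (simp only: vertical_x minus_diff_eq)
  then have "?P \<theta>" using \<theta>(1) by (intro conjI)
  then have "?P dx_over_y" unfolding dx_over_y_def by (rule someI[of ?P])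
  then show "dx_over_y \<in> forms" "\<kappa> dx_over_y = 1" using generator_coefficient[of dx_over_y] by blast+
qed

lemma omega_form: "omega j \<in> forms" and omega_coefficient: "\<kappa> (omega j) = x_coord ^ j"
  by (auto simp: omega_def contract_scale dx_over_y intro!: forms_scale O_curve_intros)

lemma alpha_form: "i < 4 \<Longrightarrow> alpha i \<in> forms"
  and alpha_coefficient: "\<kappa> (alpha i) = (\<Sum>j<4. (S_entry i j \<circ> proj) * x_coord ^ j)"
  by (auto simp: alpha_def contract_sum contract_scale omega_coefficient
      intro!: forms_sum forms_scale omega_form base_comp_in S_entry_regular)

lemma mat_apply_form: "mat_apply M alpha i \<in> forms"
  and mat_apply_coefficient: "\<kappa> (mat_apply M alpha i) = (\<Sum>j<4. (\<lambda>_. M $$ (i, j)) * \<kappa> (alpha j))"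
  by (auto simp: mat_apply_def contract_sum contract_scale
      intro!: forms_sum forms_scale alpha_form O_curve_const)

text \<open>The first cohomology is the quotient of the coordinate ring by the image of the vertical
  derivation.\<close>

lemma H1_dR_eq_iff:
  "H1_dR_eq base_ring O_curve \<phi> \<psi> \<longleftrightarrow> \<phi> \<in> forms \<and> \<psi> \<in> forms \<and> (\<exists>c\<in>O_curve. \<kappa> \<phi> - \<kappa> \<psi> = \<D> c)"
proof -
  have "\<phi> - \<psi> - fm c 1 \<in> rels \<longleftrightarrow> \<kappa> \<phi> - \<kappa> \<psi> = \<D> c"
    if "\<phi> \<in> forms" "\<psi> \<in> forms" "c \<in> O_curve" for c
  proof -
    have "- \<psi> \<in> forms" "- fm c 1 \<in> forms"
      using forms_scale[OF O_curve_uminus[OF O_curve_1]] that(2) forms_single[OF O_curve_1 that(3)]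
      by (metis scale_form_uminus)+
    then have "\<phi> - \<psi> - fm c 1 \<in> forms"
      using forms_add[OF forms_add[OF that(1), of "- \<psi>"], of "- fm c 1"] by simp
    from relations_iff[OF this] show ?thesis
      by (simp add: contract_diff contract_single)
  qed
  then show ?thesis unfolding H1_dR_eq_def by blast
qed

section \<open>The Lie derivative\<close>

lemma derivation_plus: "V \<in> derivations A \<Longrightarrow> f \<in> A \<Longrightarrow> g \<in> A \<Longrightarrow> V (f + g) = V f + V g"
  and derivation_times: "V \<in> derivations A \<Longrightarrow> f \<in> A \<Longrightarrow> g \<in> A \<Longrightarrow> V (f * g) = f * V g + g * V f"
  and derivation_constant: "V \<in> derivations A \<Longrightarrow> V (\<lambda>_. k) = 0"
  and derivation_closed: "V \<in> derivations A \<Longrightarrow> f \<in> A \<Longrightarrow> V f \<in> A"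
  unfolding derivations_def by auto

lemma derivation_sum_curve:
  assumes "V \<in> derivations O_curve" "\<And>i. i \<in> I \<Longrightarrow> f i \<in> O_curve"
  shows "V (\<Sum>i\<in>I. f i) = (\<Sum>i\<in>I. V (f i))"
  using assms(2)
proof (induction I rule: infinite_finite_induct)
  case (insert i I)
  then have "V (f i + (\<Sum>i\<in>I. f i)) = V (f i) + V (\<Sum>i\<in>I. f i)"
    by (intro derivation_plus[OF assms(1)] O_curve_sum) auto
  moreover have "V (\<Sum>i\<in>I. f i) = (\<Sum>i\<in>I. V (f i))" by (rule insert.IH) (rule insert.prems, simp)
  ultimately show ?case by (simp only: sum.insert[OF insert.hyps])
qed (use derivation_constant[OF assms(1), of 0] in \<open>simp_all add: zero_fun_def\<close>)

lemma lie_derivative_form: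
  assumes V: "V \<in> derivations O_curve" and "\<phi> \<in> forms"
  shows "lie_derivative V \<phi> \<in> forms"
  using assms(2) unfolding lie_derivative_def
  by (intro forms_sum forms_add forms_single) (auto simp: formal_forms_def derivation_closed[OF V])

text \<open>If \<open>[V, D] = \<mu> D\<close>, then \<open>L\<^sub>V(g \<theta>) = (V(g) - \<mu> g)\<theta>\<close>, since \<open>D\<close> is dual to \<open>\<theta>\<close>.\<close>

lemma lie_derivative_coefficient:
  assumes V: "V \<in> derivations O_curve" and \<phi>: "\<phi> \<in> forms"
    and comm: "\<And>c. c \<in> O_curve \<Longrightarrow> V (\<D> c) - \<D> (V c) = \<mu> * \<D> c"
  shows "\<kappa> (lie_derivative V \<phi>) = V (\<kappa> \<phi>) - \<mu> * \<kappa> \<phi>"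
proof -
  let ?K = "Poly_Mapping.keys \<phi>" and ?b = "Poly_Mapping.lookup \<phi>"
  have in_curve: "c \<in> O_curve" "?b c \<in> O_curve" "\<D> c \<in> O_curve" if "c \<in> ?K" for c
    using \<phi> that vertical_in by (auto simp: formal_forms_def)
  have "V (?b c) * \<D> c + ?b c * \<D> (V c) = V (?b c * \<D> c) - \<mu> * (?b c * \<D> c)" if "c \<in> ?K" for c
  proof -
    have "V (\<D> c) = \<D> (V c) + \<mu> * \<D> c" using comm[OF in_curve(1)[OF that]] by (simp add: algebra_simps)
    then show ?thesis using in_curve[OF that]
      by (simp add: derivation_times[OF V] algebra_simps)
  qed
  then have "\<kappa> (lie_derivative V \<phi>) = (\<Sum>c\<in>?K. V (?b c * \<D> c) - \<mu> * (?b c * \<D> c))"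
    unfolding lie_derivative_def contract_sum contract_add contract_single by simp
  also have "\<dots> = V (\<kappa> \<phi>) - \<mu> * \<kappa> \<phi>"
    unfolding contract_def sum_subtractf sum_distrib_left
    using in_curve by (subst derivation_sum_curve[OF V]) (auto intro: O_curve_mult)
  finally show ?thesis .
qed

text \<open>If \<open>V\<close> lifts a vector field from the base, the commutator \<open>[V, D]\<close> is again vertical. Vertical
  vector fields are linear forms on the differentials, which are generated by one element.\<close>

lemma commutator_multiple:
  assumes V: "V \<in> derivations O_curve"
    and base: "\<And>r. r \<in> O_frame \<Longrightarrow> \<exists>r'. V (r \<circ> proj) = r' \<circ> proj"
  obtains \<mu> where "\<mu> \<in> O_curve" "\<And>c. c \<in> O_curve \<Longrightarrow> V (\<D> c) - \<D> (V c) = \<mu> * \<D> c"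
proof -
  obtain \<theta> where \<theta>: "\<theta> \<in> forms" "\<And>c. c \<in> O_curve \<Longrightarrow> fm c 1 - scale_form (\<D> c) \<theta> \<in> rels"
    by (rule differentials_generator) blast
  define W where "W c = V (\<D> c) - \<D> (V c)" for c
  have W_in: "W c \<in> O_curve" if "c \<in> O_curve" for c
    unfolding W_def using that by (intro O_curve_diff vertical_in derivation_closed[OF V])
  have rel: "contract W \<phi> = 0" if "\<phi> \<in> rels" for \<phi>
  proof (rule contract_relations[OF _ _ _ that])
    fix f g assume fg: "f \<in> O_curve" "g \<in> O_curve"
    note facts = fg vertical_in[OF fg(1)] vertical_in[OF fg(2)]
      derivation_closed[OF V fg(1)] derivation_closed[OF V fg(2)]
    have "V (\<D> (f + g)) = V (\<D> f) + V (\<D> g)"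
      unfolding vertical_add[OF fg] by (rule derivation_plus[OF V facts(3,4)])
    moreover have "\<D> (V (f + g)) = \<D> (V f) + \<D> (V g)"
      unfolding derivation_plus[OF V fg] by (rule vertical_add[OF facts(5,6)])
    ultimately show "W (f + g) = W f + W g" unfolding W_def by simp
    have "V (\<D> (f * g)) = f * V (\<D> g) + \<D> g * V f + (g * V (\<D> f) + \<D> f * V g)"
      unfolding vertical_mult[OF fg]
      by (simp only: derivation_plus[OF V] derivation_times[OF V] O_curve_mult facts)
    moreover have "\<D> (V (f * g)) = f * \<D> (V g) + V g * \<D> f + (g * \<D> (V f) + V f * \<D> g)"
      unfolding derivation_times[OF V fg]
      by (simp only: vertical_add vertical_mult O_curve_mult facts)
    ultimately show "W (f * g) = f * W g + g * W f" unfolding W_def by (simp add: algebra_simps)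
  next
    fix r assume "r \<in> O_frame"
    from base[OF this] obtain r' where "V (r \<circ> proj) = r' \<circ> proj" ..
    moreover have "\<D> (r \<circ> proj) = 0" for r using vertical_base[of r] by (simp add: o_def)
    moreover have "V 0 = 0" using derivation_constant[OF V, of 0] by (simp add: zero_fun_def)
    ultimately show "W (r \<circ> proj) = 0" by (simp only: W_def diff_0_right)
  qed
  have "V (\<D> c) - \<D> (V c) = contract W \<theta> * \<D> c" if "c \<in> O_curve" for c
  proof -
    have "W c = \<D> c * contract W \<theta>"
      using rel[OF \<theta>(2)[OF that]]
      by (simp only: contract_diff contract_single contract_scale mult_1_left right_minus_eq)
    then show ?thesis by (simp only: W_def mult.commute)
  qed
  with contract_in[OF \<theta>(1) W_in] show ?thesis by (rule that)
qed

section \<open>Directions which do not move the frame\<close>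

text \<open>Exactness of the form \<open>r dx/y\<close> on one curve: \<open>r\<close> is the image of \<open>q y\<close> under the vertical
  derivation.\<close>

definition exact_even :: "complex poly \<Rightarrow> complex poly \<Rightarrow> bool" where
  "exact_even f r \<longleftrightarrow> (\<exists>q. r = pderiv q * f + smult (1/2) (q * pderiv f))"

lemma exact_even_add: "exact_even f r \<Longrightarrow> exact_even f r' \<Longrightarrow> exact_even f (r + r')"
proof -
  assume "exact_even f r" "exact_even f r'"
  then obtain q q' where "r = pderiv q * f + smult (1/2) (q * pderiv f)"
    "r' = pderiv q' * f + smult (1/2) (q' * pderiv f)" unfolding exact_even_def by auto
  then have "r + r' = pderiv (q + q') * f + smult (1/2) ((q + q') * pderiv f)"
    by (simp add: pderiv_add algebra_simps smult_add_right)
  then show ?thesis unfolding exact_even_def by blast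
qed

lemma exact_even_smult: "exact_even f r \<Longrightarrow> exact_even f (smult k r)"
proof -
  assume "exact_even f r"
  then obtain q where "r = pderiv q * f + smult (1/2) (q * pderiv f)"
    unfolding exact_even_def by auto
  then have "smult k r = pderiv (smult k q) * f + smult (1/2) (smult k q * pderiv f)"
    by (simp add: pderiv_smult smult_add_right mult.commute)
  then show ?thesis unfolding exact_even_def by blast
qed

lemma pderiv_monic_quintic:
  "pderiv [:c5, c4, c3, c2, 0, 1 :: complex:] = [:c4, 2 * c3, 3 * c2, 0, 5:]"
  by (rule poly_eqI) (simp add: coeff_pderiv coeff_pCons split: nat.splits)

text \<open>If \<open>q\<close> has degree \<open>n\<close> and leading coefficient \<open>c\<close>, then \<open>q'f + q f'/2\<close> has degree \<open>n + 4\<close> and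
  leading coefficient \<open>(n + 5/2)c\<close>. This is the linear independence of the four classes \<open>x\<^sup>j dx/y\<close>.\<close>

lemma exact_even_degree:
  assumes "exact_even [:c5, c4, c3, c2, 0, 1:] r" "degree r \<le> 3" shows "r = 0"
proof -
  let ?f = "[:c5, c4, c3, c2, 0, 1:]"
  obtain q where q: "r = pderiv q * ?f + smult (1/2) (q * pderiv ?f)"
    using assms(1) unfolding exact_even_def by auto
  have "q = 0"
  proof (rule ccontr)
    assume "q \<noteq> 0"
    define n where "n = degree q"
    have top: "coeff (p * p') (degree p + m) = lead_coeff p * coeff p' m"
      if "degree p' \<le> m" for p p' :: "complex poly" and m
    proof (cases "degree p' = m")
      case True
      then show ?thesis using coeff_mult_degree_sum[of p p'] by simp
    next
      case False
      with that have "degree p' < m" by simp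
      then have "degree (p * p') < degree p + m" using degree_mult_le[of p p'] by linarith
      then show ?thesis using \<open>degree p' < m\<close> by (simp add: coeff_eq_0)
    qed
    have pf: "coeff (pderiv ?f) 4 = 5" "degree (pderiv ?f) = 4"
      unfolding pderiv_monic_quintic by (simp_all add: numeral_eq_Suc)
    have 1: "coeff (pderiv q * ?f) (n + 4) = of_nat n * lead_coeff q"
    proof (cases n)
      case 0
      then have "pderiv q = 0" by (simp add: n_def pderiv_eq_0_iff)
      then show ?thesis by (simp add: 0)
    next
      case (Suc m)
      then have "degree (pderiv q) = m" by (simp add: degree_pderiv n_def[symmetric])
      then have "coeff (pderiv q * ?f) (m + 5) = lead_coeff (pderiv q) * coeff ?f 5"
        using top[of ?f 5 "pderiv q"] by simp
      then show ?thesis using \<open>degree (pderiv q) = m\<close> Suc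
        by (simp add: coeff_pderiv n_def numeral_eq_Suc)
    qed
    have 2: "coeff (q * pderiv ?f) (n + 4) = 5 * lead_coeff q"
      using top[of "pderiv ?f" 4 q] pf n_def by simp
    have "coeff r (n + 4) = (of_nat n + 5/2) * lead_coeff q"
      unfolding q coeff_add coeff_smult 1 2 by (simp add: algebra_simps)
    moreover have "of_nat n + 5/2 \<noteq> (0::complex)"
    proof
      assume "of_nat n + 5/2 = (0::complex)"
      then have "Re (of_nat n + 5/2) = 0" by (metis zero_complex.sel(1))
      then show False by simp
    qed
    ultimately have "coeff r (n + 4) \<noteq> 0" using \<open>q \<noteq> 0\<close> by simp
    then show False using assms(2) by (simp add: coeff_eq_0)
  qed
  then show ?thesis using q by simp
qed

lemma poly_degree_le_3:
  assumes "degree p \<le> 3" shows "p = [:coeff p 0, coeff p 1, coeff p 2, coeff p 3:]"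
proof (rule poly_eqI)
  fix n show "coeff p n = coeff [:coeff p 0, coeff p 1, coeff p 2, coeff p 3:] n"
  proof (cases "n < 4")
    case True
    then have "n \<in> {0, 1, 2, 3}" by auto
    then show ?thesis by (auto simp: numeral_eq_Suc)
  qed (use assms in \<open>simp add: coeff_eq_0\<close>)
qed

lemma poly_degree_le_4:
  assumes "degree p \<le> 4" shows "p = [:coeff p 0, coeff p 1, coeff p 2, coeff p 3, coeff p 4:]"
proof (rule poly_eqI)
  fix n show "coeff p n = coeff [:coeff p 0, coeff p 1, coeff p 2, coeff p 3, coeff p 4:] n"
  proof (cases "n < 5")
    case True
    then have "n \<in> {0, 1, 2, 3, 4}" by auto
    then show ?thesis by (auto simp: numeral_eq_Suc)
  qed (use assms in \<open>simp add: coeff_eq_0\<close>)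
qed

text \<open>The heart of the uniqueness. A tangent vector at one point moves the coefficients of \<open>f\<close> by \<open>v\<close> and
  the entries of \<open>S\<close> by \<open>d\<close>, and it is lifted to the curve by \<open>x \<mapsto> X\<close>, \<open>y \<mapsto> Y y\<close>. If the
  derivatives of all four sections vanish in cohomology, the tangent vector is proportional to the
  Euler field of the action of \<open>G\<^sub>m\<close>. Replacing \<open>X\<close> by \<open>g = X mod f\<close> changes the lift by a multiple of
  the vertical field \<open>y D\<close>, hence changes the derivatives by exact forms only. For the first two
  sections all terms then have low degree and exactness means vanishing; this gives, in turn,
  \<open>g\<^sub>4 = g\<^sub>3 = 0\<close> and \<open>g\<^sub>2 = 0\<close>, because the coefficients \<open>4 g\<^sub>4\<close>, \<open>3 g\<^sub>3\<close>, \<open>3 g\<^sub>2\<close> of the derivative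
  differ from the coefficients \<open>5/2 g\<^sub>n\<close> of \<open>\<alpha>/2\<close>. Finally \<open>g\<^sub>0 = 0\<close>, as \<open>f\<^sub>w\<close> has degree at most 3.\<close>

lemma horizontal_direction_is_euler:
  fixes c2 c3 c4 c5 v2 v3 v4 v5 :: complex and s d :: "nat \<Rightarrow> nat \<Rightarrow> complex"
  defines "f \<equiv> [:c5, c4, c3, c2, 0, 1:]"
  defines "rowp \<equiv> \<lambda>m i. [:m i 0, m i 1, m i 2, m i (3::nat):] :: complex poly"
  assumes tangent: "[:v5, v4, v3, v2:] + pderiv f * X = smult 2 (Y * f)"
    and block: "\<And>i j. i \<in> {0, 1} \<Longrightarrow> j \<in> {2, 3} \<Longrightarrow> s i j = 0 \<and> d i j = 0"
    and det: "s 0 0 * s 1 1 - s 0 1 * s 1 0 \<noteq> 0"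
    and exact: "\<And>i. i < 4 \<Longrightarrow> exact_even f (rowp d i + pderiv (rowp s i * X) - Y * rowp s i)"
  obtains k where "v2 = k * 2 * c2" "v3 = k * 3 * c3" "v4 = k * 4 * c4" "v5 = k * 5 * c5"
    "\<forall>i<4. \<forall>j<4. d i j = k * (3/2 - of_nat j) * s i j"
proof -
  \<comment> \<open>The lift is normalised by subtracting \<open>h\<close> times the vertical field \<open>y D\<close>, which sends \<open>x\<close> to \<open>f\<close>.\<close>
  define g where "g = X mod f"
  define h where "h = X div f"
  define \<alpha> where "\<alpha> = smult 2 Y - h * pderiv f"
  have X: "X = g + h * f" by (simp add: g_def h_def)
  have f: "degree f = 5" "f \<noteq> 0" by (simp_all add: f_def)
  have g_deg: "degree g \<le> 4"
    using degree_mod_less[of f X] f unfolding g_def by (cases "X mod f = 0") auto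
  have f': "pderiv f = [:c4, 2 * c3, 3 * c2, 0, 5:]" unfolding f_def by (rule pderiv_monic_quintic)
  have tangent': "\<alpha> * f = [:v5, v4, v3, v2:] + pderiv f * g"
    using tangent unfolding X \<alpha>_def by (simp add: algebra_simps)
  have \<alpha>_deg: "degree \<alpha> \<le> 3"
  proof (cases "\<alpha> = 0")
    case False
    have "degree ([:v5, v4, v3, v2:] + pderiv f * g) \<le> 8"
      using degree_mult_le[of "pderiv f" g] g_deg f' by (intro degree_add_le) auto
    then have "degree \<alpha> + 5 \<le> 8" using degree_mult_eq[OF False f(2)] f tangent' by simp
    then show ?thesis by simp
  qed simp
  obtain g0 g1 g2 g3 g4 where g: "g = [:g0, g1, g2, g3, g4:]"
    using poly_degree_le_4[OF g_deg] by blast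
  obtain a0 a1 a2 a3 where \<alpha>: "\<alpha> = [:a0, a1, a2, a3:]"
    using poly_degree_le_3[OF \<alpha>_deg] by blast
  define E where "E r = pderiv (r * g) - smult (1/2) (\<alpha> * r)" for r
  have exact': "exact_even f (rowp d i + E (rowp s i))" if i: "i < 4" for i
  proof -
    obtain q where q: "rowp d i + pderiv (rowp s i * X) - Y * rowp s i =
        pderiv q * f + smult (1/2) (q * pderiv f)"
      using exact[OF i] unfolding exact_even_def by blast
    have Y: "Y = smult (1/2) (\<alpha> + h * pderiv f)" by (simp add: \<alpha>_def)
    have "rowp d i + E (rowp s i) = (rowp d i + pderiv (rowp s i * X) - Y * rowp s i)
        - (pderiv (rowp s i * h) * f + smult (1/2) ((rowp s i * h) * pderiv f))"
    proof -
      have half: "smult (1/2) r + smult (1/2) r = r" for r :: "complex poly"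
        by (simp flip: smult_add_left)
      show ?thesis
        using half[of "rowp s i * h * pderiv f"]
        unfolding E_def Y X by (simp add: pderiv_mult pderiv_add algebra_simps smult_add_right)
    qed
    also have "\<dots> = pderiv (q - rowp s i * h) * f + smult (1/2) ((q - rowp s i * h) * pderiv f)"
      unfolding q by (simp add: pderiv_diff algebra_simps smult_add_right smult_diff_right)
    finally show ?thesis unfolding exact_even_def by blast
  qed
  have E_add: "E (r + r') = E r + E r'" for r r'
    by (simp add: E_def pderiv_add algebra_simps smult_add_right)
  have E_smult: "E (smult c r) = smult c (E r)" for c r
    by (simp add: E_def pderiv_smult smult_diff_right mult.commute)
  \<comment> \<open>Comparison of the coefficients of \<open>\<alpha> f = f\<^sub>w + g f'\<close>, from degree 0 to degree 8.\<close>
  have coeffs: "a0 * c5 = v5 + c4 * g0 \<and> a0 * c4 + a1 * c5 = v4 + (c4 * g1 + c3 * (g0 * 2)) \<and>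
    a0 * c3 + (a1 * c4 + a2 * c5) = v3 + (c4 * g2 + (c2 * (g0 * 3) + c3 * (g1 * 2))) \<and>
    a0 * c2 + (a1 * c3 + (a2 * c4 + a3 * c5)) = v2 + (c4 * g3 + (c2 * (g1 * 3) + c3 * (g2 * 2))) \<and>
    a1 * c2 + (a2 * c3 + a3 * c4) = c4 * g4 + (g0 * 5 + (c2 * (g2 * 3) + c3 * (g3 * 2))) \<and>
    a0 + (a2 * c2 + a3 * c3) = g1 * 5 + (c2 * (g3 * 3) + c3 * (g4 * 2)) \<and>
    a1 + a3 * c2 = g2 * 5 + c2 * (g4 * 3) \<and> a2 = g3 * 5 \<and> a3 = g4 * 5"
    using tangent'[unfolded f'] unfolding \<alpha> g f_def by (simp (no_asm_use) add: algebra_simps)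
  have low: "rowp m i = [:m i 0, m i 1:]" if "i \<in> {0, 1}" "m = s \<or> m = d" for m i
    using block[of i 2] block[of i 3] that unfolding rowp_def by auto
  \<comment> \<open>The upper left block of \<open>S\<close> is invertible, so 1 and \<open>x\<close> are combinations of the first two rows.\<close>
  have combine: "exact_even f ([:c * d 0 0 + c' * d 1 0, c * d 0 1 + c' * d 1 1:]
      + E [:c * s 0 0 + c' * s 1 0, c * s 0 1 + c' * s 1 1:])" for c c'
  proof -
    have "exact_even f (smult c (rowp d 0 + E (rowp s 0)) + smult c' (rowp d 1 + E (rowp s 1)))"
      by (intro exact_even_add exact_even_smult exact') auto
    also have "smult c (rowp d 0 + E (rowp s 0)) + smult c' (rowp d 1 + E (rowp s 1)) =
      (smult c (rowp d 0) + smult c' (rowp d 1)) + E (smult c (rowp s 0) + smult c' (rowp s 1))"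
      by (simp add: E_add E_smult smult_add_right)
    finally show ?thesis by (simp add: low)
  qed
  let ?D = "s 0 0 * s 1 1 - s 0 1 * s 1 0"
  have quotient: "x / ?D * y + z / ?D * w = (x * y + z * w) / ?D" for x y z w
    by (simp add: add_divide_distrib)
  obtain b0 b1 where 1: "exact_even f ([:b0, b1:] + E [:1:])"
  proof -
    have "(s 1 1 / ?D) * s 0 0 + (- s 0 1 / ?D) * s 1 0 = 1"
      "(s 1 1 / ?D) * s 0 1 + (- s 0 1 / ?D) * s 1 1 = 0"
      unfolding quotient using det by (simp_all add: mult.commute)
    then show ?thesis using combine[of "s 1 1 / ?D" "- s 0 1 / ?D"] that by simp
  qed
  obtain b0' b1' where 2: "exact_even f ([:b0', b1':] + E [:0, 1:])"
  proof -
    have "(- s 1 0 / ?D) * s 0 0 + (s 0 0 / ?D) * s 1 0 = 0"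
      "(- s 1 0 / ?D) * s 0 1 + (s 0 0 / ?D) * s 1 1 = 1"
      unfolding quotient using det by (simp_all add: mult.commute)
    then show ?thesis using combine[of "- s 1 0 / ?D" "s 0 0 / ?D"] that by simp
  qed
  have "E [:1:] = [:g1 - a0 / 2, 2 * g2 - a1 / 2, 3 * g3 - a2 / 2, 4 * g4 - a3 / 2:]"
    by (simp add: E_def g \<alpha> pderiv_pCons)
  with 1 have "exact_even f [:b0 + (g1 - a0 / 2), b1 + (2 * g2 - a1 / 2), 3 * g3 - a2 / 2, 4 * g4 - a3 / 2:]"
    by simp
  then have "[:b0 + (g1 - a0 / 2), b1 + (2 * g2 - a1 / 2), 3 * g3 - a2 / 2, 4 * g4 - a3 / 2:] = 0"
    unfolding f_def by (rule exact_even_degree) simp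
  \<comment> \<open>The coefficients of \<open>x\<^sup>3\<close> and \<open>x\<^sup>2\<close> are \<open>3/2 g\<^sub>4\<close> and \<open>g\<^sub>3/2\<close>.\<close>
  then have z: "g4 = 0" "a3 = 0" "g3 = 0" "a2 = 0" using coeffs by auto
  have "E [:0, 1:] = [:g0, 2 * g1 - a0 / 2, 3 * g2 - a1 / 2:]"
    by (simp add: E_def g \<alpha> pderiv_pCons z)
  with 2 have "exact_even f [:b0' + g0, b1' + (2 * g1 - a0 / 2), 3 * g2 - a1 / 2:]"
    by simp
  then have "[:b0' + g0, b1' + (2 * g1 - a0 / 2), 3 * g2 - a1 / 2:] = 0"
    unfolding f_def by (rule exact_even_degree) simp
  \<comment> \<open>The coefficient of \<open>x\<^sup>2\<close> is \<open>g\<^sub>2/2\<close>.\<close>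
  then have z': "g2 = 0" "a1 = 0" using coeffs z by auto
  have z'': "a0 = 5 * g1" "g0 = 0" using coeffs z z' by auto
  have "d i j = g1 * (3/2 - of_nat j) * s i j" if "i < 4" "j < 4" for i j
  proof -
    have "rowp d i + E (rowp s i) = [:d i 0 - g1 * (3/2) * s i 0, d i 1 - g1 * (1/2) * s i 1,
        d i 2 + g1 * (1/2) * s i 2, d i 3 + g1 * (3/2) * s i 3:]"
      unfolding E_def rowp_def g \<alpha> z z' z'' by (simp add: pderiv_pCons)
    then have "[:d i 0 - g1 * (3/2) * s i 0, d i 1 - g1 * (1/2) * s i 1,
        d i 2 + g1 * (1/2) * s i 2, d i 3 + g1 * (3/2) * s i 3:] = 0"
      using exact'[OF that(1)] unfolding f_def by (intro exact_even_degree) auto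
    moreover have "j \<in> {0, 1, 2, 3}" using that by auto
    ultimately show ?thesis by (auto simp: eq_neg_iff_add_eq_0)
  qed
  then show ?thesis using that[of g1] coeffs unfolding z z' z'' by (auto simp: algebra_simps)
qed

section \<open>Frames as symplectic bases\<close>

text \<open>The bilinear form with Gram matrix \<open>\<Omega>\<close>, where \<open>c\<close> is the value of \<open>t\<^sub>2\<close>. The condition
  \<open>\<Phi> = S \<Omega> S\<^sup>t\<^sup>r\<close> says that the rows of \<open>S\<close> are a symplectic basis.\<close>

definition pairing :: "complex \<Rightarrow> (nat \<Rightarrow> complex) \<Rightarrow> (nat \<Rightarrow> complex) \<Rightarrow> complex" where
  "pairing c r s = 4/3 * (r 0 * s 3 - r 3 * s 0) + 4 * (r 1 * s 2 - r 2 * s 1)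
     + 4/3 * c * (r 2 * s 3 - r 3 * s 2)"

lemma less_4_cases: "(i::nat) < 4 \<longleftrightarrow> i = 0 \<or> i = 1 \<or> i = 2 \<or> i = 3"
  by auto

lemma sum_less_4: "(\<Sum>i<4::nat. f i) = f 0 + f 1 + f 2 + f 3"
  by (simp add: numeral_eq_Suc)

lemma mat_mult_entry:
  "A \<in> carrier_mat 4 4 \<Longrightarrow> B \<in> carrier_mat 4 4 \<Longrightarrow> i < 4 \<Longrightarrow> j < 4 \<Longrightarrow>
    (A * B) $$ (i, j) = (\<Sum>k<4. A $$ (i, k) * B $$ (k, j))"
  by (simp add: scalar_prod_def atLeast0LessThan)

lemma Phi_entries:
  "Phi \<in> carrier_mat 4 4"
  "i < 4 \<Longrightarrow> j < 4 \<Longrightarrow> Phi $$ (i, j) =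
     (if j = i + 2 then 1 else if i = j + 2 then -1 else 0)"
proof -
  show "Phi \<in> carrier_mat 4 4" by (auto simp: Phi_def mat_of_rows_list_def)
  assume "i < 4" "j < 4"
  then show "Phi $$ (i, j) = (if j = i + 2 then 1 else if i = j + 2 then -1 else 0)"
    unfolding less_4_cases by (elim disjE) (simp_all add: Phi_def mat_of_rows_list_def)
qed

lemma Omega_carrier: "Omega p \<in> carrier_mat 4 4"
  by (auto simp: Omega_def mat_of_rows_list_def)

lemma Omega_entries:
  "i < 4 \<Longrightarrow> j < 4 \<Longrightarrow> Omega p $$ (i, j) =
    (if (i, j) = (0, 3) then 4/3 else if (i, j) = (3, 0) then -4/3
     else if (i, j) = (1, 2) then 4 else if (i, j) = (2, 1) then -4
     else if (i, j) = (2, 3) then 4/3 * t2 p else if (i, j) = (3, 2) then -4/3 * t2 p else 0)"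
  unfolding less_4_cases by (elim disjE) (simp_all add: Omega_def mat_of_rows_list_def)

lemma frame_gram_entry:
  assumes M: "M \<in> carrier_mat 4 4" and ij: "i < 4" "j < 4"
  shows "(M * Omega p * transpose_mat M) $$ (i, j) =
    pairing (t2 p) (\<lambda>k. M $$ (i, k)) (\<lambda>k. M $$ (j, k))"
proof -
  have MO: "M * Omega p \<in> carrier_mat 4 4" and MT: "transpose_mat M \<in> carrier_mat 4 4"
    using M Omega_carrier[of p] by auto
  have "(M * Omega p * transpose_mat M) $$ (i, j) = (\<Sum>k<4. (M * Omega p) $$ (i, k) * transpose_mat M $$ (k, j))"
    by (rule mat_mult_entry[OF MO MT ij])
  also have "\<dots> = (\<Sum>k<4. (\<Sum>l<4. M $$ (i, l) * Omega p $$ (l, k)) * M $$ (j, k))"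
  proof (intro sum.cong refl)
    fix k :: nat assume "k \<in> {..<4}"
    then have "k < 4" by simp
    then have "transpose_mat M $$ (k, j) = M $$ (j, k)" using M ij by simp
    then show "(M * Omega p) $$ (i, k) * transpose_mat M $$ (k, j) =
        (\<Sum>l<4. M $$ (i, l) * Omega p $$ (l, k)) * M $$ (j, k)"
      by (simp only: mat_mult_entry[OF M Omega_carrier ij(1) \<open>k < 4\<close>])
  qed
  also have "\<dots> = pairing (t2 p) (\<lambda>k. M $$ (i, k)) (\<lambda>k. M $$ (j, k))"
    unfolding sum_less_4 pairing_def by (simp add: Omega_entries field_simps)
  finally show ?thesis .
qed

text \<open>The relation \<open>\<Phi> = S \<Omega> S\<^sup>t\<^sup>r\<close> implies that \<open>S\<close> is invertible, because \<open>\<Phi>\<close> is. The matrix identity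
  thus becomes a system of scalar equations between rows.\<close>

lemma frame_conditions_iff:
  "frame_conditions p \<longleftrightarrow> S p \<in> carrier_mat 4 4 \<and>
     (\<forall>i\<in>{0,1}. \<forall>j\<in>{2,3}. S p $$ (i, j) = 0) \<and>
     (\<forall>i<4. \<forall>j<4. pairing (t2 p) (\<lambda>k. S p $$ (i, k)) (\<lambda>k. S p $$ (j, k)) = Phi $$ (i, j)) \<and>
     t5 p \<noteq> 0 \<and> disc p \<noteq> 0"
proof -
  have det: "det (S p) \<noteq> 0" if S: "S p \<in> carrier_mat 4 4"
    and eq: "Phi = S p * Omega p * transpose_mat (S p)"
  proof -
    have "Phi * transpose_mat Phi = 1\<^sub>m 4"
    proof (rule eq_matI)
      fix i j :: nat assume "i < dim_row (1\<^sub>m 4 :: complex mat)" "j < dim_col (1\<^sub>m 4 :: complex mat)"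
      then have ij: "i < 4" "j < 4" by auto
      have "(Phi * transpose_mat Phi) $$ (i, j) = (\<Sum>k<4. Phi $$ (i, k) * transpose_mat Phi $$ (k, j))"
        using Phi_entries(1) ij by (intro mat_mult_entry) auto
      also have "\<dots> = (\<Sum>k<4. Phi $$ (i, k) * Phi $$ (j, k))"
        using Phi_entries(1) ij by (intro sum.cong) auto
      also have "\<dots> = 1\<^sub>m 4 $$ (i, j)"
        using ij unfolding less_4_cases sum_less_4 by (elim disjE) (simp_all add: Phi_entries(2))
      finally show "(Phi * transpose_mat Phi) $$ (i, j) = 1\<^sub>m 4 $$ (i, j)" .
    qed (use Phi_entries(1) in auto)
    then have "det Phi * det (transpose_mat Phi) = 1"
      using det_mult[OF Phi_entries(1), of "transpose_mat Phi"] Phi_entries(1) by simp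
    then have "det Phi \<noteq> 0" by auto
    then show ?thesis
      using arg_cong[OF eq, of det] S Omega_carrier[of p]
      by (auto simp: det_mult[of _ 4] det_transpose)
  qed
  have "Phi = S p * Omega p * transpose_mat (S p) \<longleftrightarrow>
     (\<forall>i<4. \<forall>j<4. pairing (t2 p) (\<lambda>k. S p $$ (i, k)) (\<lambda>k. S p $$ (j, k)) = Phi $$ (i, j))"
    if S: "S p \<in> carrier_mat 4 4"
  proof -
    have "Phi = S p * Omega p * transpose_mat (S p) \<longleftrightarrow>
       (\<forall>i<4. \<forall>j<4. Phi $$ (i, j) = (S p * Omega p * transpose_mat (S p)) $$ (i, j))"
      using S Phi_entries(1) Omega_carrier[of p] by (auto simp: mat_eq_iff)
    then show ?thesis by (auto simp: frame_gram_entry[OF S])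
  qed
  then show ?thesis unfolding frame_conditions_def using det by auto
qed

lemma frame_pairing:
  "i < 4 \<Longrightarrow> j < 4 \<Longrightarrow>
    pairing (T2 p) (\<lambda>k. S_entry i k p) (\<lambda>k. S_entry j k p) = Phi $$ (i, j)"
  using frame_conditions_Rep[of p] by (auto simp: frame_conditions_iff T2_def S_entry_def)

lemma S_entry_block: "i \<in> {0, 1} \<Longrightarrow> j \<in> {2, 3} \<Longrightarrow> S_entry i j p = 0"
  using frame_conditions_Rep[of p] by (auto simp: frame_conditions_def S_entry_def)

text \<open>The equations say that the product of the upper left block of \<open>S\<close>, the upper right block of \<open>\<Omega>\<close>
  and the transposed lower right block of \<open>S\<close> is the identity.\<close>

lemma block_equations:
  "4/3 * (S_entry 0 0 p * S_entry 2 3 p) + 4 * (S_entry 0 1 p * S_entry 2 2 p) = 1"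
  "4/3 * (S_entry 0 0 p * S_entry 3 3 p) + 4 * (S_entry 0 1 p * S_entry 3 2 p) = 0"
  "4/3 * (S_entry 1 0 p * S_entry 2 3 p) + 4 * (S_entry 1 1 p * S_entry 2 2 p) = 0"
  "4/3 * (S_entry 1 0 p * S_entry 3 3 p) + 4 * (S_entry 1 1 p * S_entry 3 2 p) = 1"
  using frame_pairing[of 0 2 p] frame_pairing[of 0 3 p] frame_pairing[of 1 2 p] frame_pairing[of 1 3 p]
  by (simp_all add: Phi_entries pairing_def S_entry_block)

lemma holomorphic_block_det: "S_entry 0 0 p * S_entry 1 1 p - S_entry 0 1 p * S_entry 1 0 p \<noteq> 0"
proof
  assume "S_entry 0 0 p * S_entry 1 1 p - S_entry 0 1 p * S_entry 1 0 p = 0"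
  moreover have "(4/3 * (S_entry 0 0 p * S_entry 2 3 p) + 4 * (S_entry 0 1 p * S_entry 2 2 p)) *
      (4/3 * (S_entry 1 0 p * S_entry 3 3 p) + 4 * (S_entry 1 1 p * S_entry 3 2 p)) -
      (4/3 * (S_entry 0 0 p * S_entry 3 3 p) + 4 * (S_entry 0 1 p * S_entry 3 2 p)) *
      (4/3 * (S_entry 1 0 p * S_entry 2 3 p) + 4 * (S_entry 1 1 p * S_entry 2 2 p)) =
      (S_entry 0 0 p * S_entry 1 1 p - S_entry 0 1 p * S_entry 1 0 p) *
      (16/3 * (S_entry 2 3 p * S_entry 3 2 p - S_entry 2 2 p * S_entry 3 3 p))"
    by (simp add: field_simps)
  \<comment> \<open>The block equations turn the left side into 1.\<close>
  ultimately show False unfolding block_equations by simp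
qed

section \<open>The action of the multiplicative group\<close>

lemma Gm_action_simps:
  "t2 (Gm_action a p) = a powi (-4) * t2 p" "t3 (Gm_action a p) = a powi (-6) * t3 p"
  "t4 (Gm_action a p) = a powi (-8) * t4 p" "t5 (Gm_action a p) = a powi (-10) * t5 p"
  "S p \<in> carrier_mat 4 4 \<Longrightarrow> S (Gm_action a p) \<in> carrier_mat 4 4"
  "S p \<in> carrier_mat 4 4 \<Longrightarrow> i < 4 \<Longrightarrow> j < 4 \<Longrightarrow>
     S (Gm_action a p) $$ (i, j) = a powi (2 * int j - 3) * S p $$ (i, j)"
  by (auto simp: Gm_action_def mat_diag_mult_right[of _ 4 4])

lemma disc_nonzero_iff: "disc p \<noteq> 0 \<longleftrightarrow> coprime (quintic p) (pderiv (quintic p))"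
proof -
  have "quintic p \<noteq> 0" using degree_quintic[of p] by auto
  then have "is_unit (gcd (quintic p) (pderiv (quintic p))) \<longleftrightarrow> degree (gcd (quintic p) (pderiv (quintic p))) = 0"
    by (intro is_unit_iff_degree) simp
  then show ?thesis unfolding disc_def by (simp only: resultant_0_gcd is_unit_gcd not_not)
qed

lemma powi_weights:
  fixes a :: complex
  shows "a powi (-4) = 1 / a ^ 4" "a powi (-6) = 1 / a ^ 6" "a powi (-8) = 1 / a ^ 8"
    "a powi (-10) = 1 / a ^ 10" "a powi (2 * int 0 - 3) = 1 / a ^ 3" "a powi (2 * int 1 - 3) = 1 / a"
    "a powi (2 * int 2 - 3) = a" "a powi (2 * int 3 - 3) = a ^ 3"
  by (simp_all add: power_int_minus divide_inverse)

lemma quintic_Gm_action: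
  assumes "a \<noteq> 0"
  shows "quintic (Gm_action a p) = smult (a powi (-10)) (pcompose (quintic p) [:0, a ^ 2:])"
  using assms
  by (simp add: quintic_def Gm_action_simps pcompose_pCons powi_weights divide_simps)

text \<open>The action substitutes \<open>a\<^sup>2x\<close> for \<open>x\<close> in the quintic, and a Bezout identity for \<open>f\<close> and \<open>f'\<close>
  survives the substitution.\<close>

lemma disc_Gm_action:
  assumes "a \<noteq> 0" "disc p \<noteq> 0" shows "disc (Gm_action a p) \<noteq> 0"
proof -
  let ?f = "quintic p" and ?h = "\<lambda>q. pcompose q [:0, a ^ 2:]" and ?F = "quintic (Gm_action a p)"
  have "coprime ?f (pderiv ?f)" using assms(2) disc_nonzero_iff by blast
  then obtain u v where uv: "u * ?f + v * pderiv ?f = 1" using bezout_coefficients_fst_snd[of ?f "pderiv ?f"] by auto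
  have F: "?F = smult (a powi (-10)) (?h ?f)" by (rule quintic_Gm_action[OF assms(1)])
  have F': "pderiv ?F = smult (a powi (-10) * a ^ 2) (?h (pderiv ?f))"
    unfolding F by (simp add: pderiv_smult pderiv_pcompose pderiv_pCons)
  have "?h (u * ?f + v * pderiv ?f) = 1" by (simp only: uv) simp
  then have "?h u * ?h ?f + ?h v * ?h (pderiv ?f) = 1" by (simp add: pcompose_add pcompose_mult)
  then have one: "smult (a ^ 10) (?h u) * ?F + smult (a ^ 8) (?h v) * pderiv ?F = 1"
    using assms(1) unfolding F' unfolding F by (simp add: powi_weights flip: power_add)
  have "coprime ?F (pderiv ?F)"
  proof (rule coprimeI)
    fix c assume "c dvd ?F" "c dvd pderiv ?F"
    then have "c dvd smult (a ^ 10) (?h u) * ?F + smult (a ^ 8) (?h v) * pderiv ?F" by (intro dvd_add dvd_mult)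
    then show "is_unit c" unfolding one .
  qed
  then show ?thesis using disc_nonzero_iff by blast
qed

lemma frame_conditions_Gm_action:
  assumes "frame_conditions p" "a \<noteq> 0" shows "frame_conditions (Gm_action a p)"
proof -
  have S: "S p \<in> carrier_mat 4 4" using assms by (simp add: frame_conditions_iff)
  have entries: "S (Gm_action a p) $$ (i, 0) = 1 / a ^ 3 * S p $$ (i, 0)"
    "S (Gm_action a p) $$ (i, 1) = 1 / a * S p $$ (i, 1)"
    "S (Gm_action a p) $$ (i, 2) = a * S p $$ (i, 2)"
    "S (Gm_action a p) $$ (i, 3) = a ^ 3 * S p $$ (i, 3)" if "i < 4" for i
    using Gm_action_simps(6)[OF S that, of 0 a] Gm_action_simps(6)[OF S that, of 1 a]
      Gm_action_simps(6)[OF S that, of 2 a] Gm_action_simps(6)[OF S that, of 3 a]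
    unfolding powi_weights by simp_all
  have "pairing (t2 (Gm_action a p)) (\<lambda>k. S (Gm_action a p) $$ (i, k)) (\<lambda>k. S (Gm_action a p) $$ (j, k)) =
      pairing (t2 p) (\<lambda>k. S p $$ (i, k)) (\<lambda>k. S p $$ (j, k))" if "i < 4" "j < 4" for i j
    unfolding pairing_def Gm_action_simps(1) entries[OF that(1)] entries[OF that(2)] powi_weights
    using assms(2) by (simp add: field_simps eval_nat_numeral)
  then show ?thesis
    using assms disc_Gm_action[OF assms(2)] S
    by (auto simp: frame_conditions_iff Gm_action_simps)
qed

definition scaled :: "complex \<Rightarrow> frame_space \<Rightarrow> frame_space" where
  "scaled a p = Abs_frame_space (Gm_action a (Rep_frame_space p))"

lemma Rep_scaled: "a \<noteq> 0 \<Longrightarrow> Rep_frame_space (scaled a p) = Gm_action a (Rep_frame_space p)"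
  unfolding scaled_def
  by (rule Abs_frame_space_inverse) (simp add: frame_conditions_Gm_action frame_conditions_Rep)

lemma scaled_coordinates:
  assumes "a \<noteq> 0"
  shows "T2 (scaled a p) = a powi (-4) * T2 p" "T3 (scaled a p) = a powi (-6) * T3 p"
    "T4 (scaled a p) = a powi (-8) * T4 p" "T5 (scaled a p) = a powi (-10) * T5 p"
    "i < 4 \<Longrightarrow> j < 4 \<Longrightarrow> S_entry i j (scaled a p) = a powi (2 * int j - 3) * S_entry i j p"
  using frame_conditions_Rep[of p] unfolding frame_conditions_iff
  by (simp_all add: T2_def T3_def T4_def T5_def S_entry_def Rep_scaled[OF assms] Gm_action_simps)

lemma abs_scaled: "a \<noteq> 0 \<Longrightarrow> abs_moduli_T (scaled a p) = abs_moduli_T p"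
  using Quotient_rel_abs[OF Quotient_moduli_T, of p "scaled a p"] Rep_scaled[of a p]
  unfolding same_orbit_def by metis

lemma scaled_1: "scaled 1 p = p"
  by (simp add: scaled_def Gm_action_1 frame_conditions_Rep Rep_frame_space_inverse)

lemma same_orbit_scaled: "same_orbit p q \<Longrightarrow> \<exists>a. a \<noteq> 0 \<and> q = scaled a p"
  unfolding same_orbit_def scaled_def by (metis Rep_frame_space_inverse)

section \<open>Uniqueness\<close>

lemma horner_fiber:
  "horner rs = fiber_fun (\<lambda>p. Poly (map (\<lambda>r. r p) rs)) (\<lambda>_. 0)"
  "horner' rs = fiber_fun (\<lambda>p. pderiv (Poly (map (\<lambda>r. r p) rs))) (\<lambda>_. 0)"
proof -
  show h: "horner rs = fiber_fun (\<lambda>p. Poly (map (\<lambda>r. r p) rs)) (\<lambda>_. 0)" for rs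
    by (induction rs) (simp_all add: fun_eq_iff fiber_fun_def)
  show "horner' rs = fiber_fun (\<lambda>p. pderiv (Poly (map (\<lambda>r. r p) rs))) (\<lambda>_. 0)"
    by (induction rs) (simp_all add: fun_eq_iff fiber_fun_def h pderiv_pCons)
qed

lemma derivation_horner:
  assumes V: "V \<in> derivations O_curve"
    and lift: "\<And>r. r \<in> O_frame \<Longrightarrow> V (r \<circ> proj) = w r \<circ> proj"
  shows "set rs \<subseteq> O_frame \<Longrightarrow> V (horner rs) = horner (map w rs) + horner' rs * V x_coord"
proof (induction rs)
  case Nil
  show ?case using derivation_constant[OF V, of 0] by (simp add: zero_fun_def)
next
  case (Cons r rs)
  then have r: "r \<in> O_frame" "r \<circ> proj \<in> O_curve" and h: "horner rs \<in> O_curve"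
    using horner_in[of rs] base_comp_in by auto
  have "V (horner (r # rs)) = V (r \<circ> proj) + (x_coord * V (horner rs) + horner rs * V x_coord)"
    unfolding horner.simps derivation_plus[OF V r(2) O_curve_mult[OF x_coord_in h]]
      derivation_times[OF V x_coord_in h] ..
  also have "V (horner rs) = horner (map w rs) + horner' rs * V x_coord"
    by (rule Cons.IH) (use Cons.prems in simp)
  finally show ?case unfolding lift[OF r(1)] by (simp add: algebra_simps)
qed

lemma quintic_horner: "y_coord * y_coord = horner [T5, T4, T3, T2, \<lambda>_. 0, \<lambda>_. 1]"
  by (rule ext) (simp add: curve_equation[unfolded power2_eq_square] quintic_T algebra_simps)

lemma alpha_horner: "\<kappa> (alpha i) = horner (map (S_entry i) [0..<4])"
  by (rule ext) (simp add: alpha_coefficient sum_less_4 eval_nat_numeral algebra_simps)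

lemma restrict_difference_derivation:
  assumes A: "function_algebra A" and V: "V \<in> derivations A" and V': "V' \<in> derivations A"
  shows "restrict (\<lambda>f. V f - V' f) A \<in> derivations A"
proof -
  have c: "(\<lambda>_. k) \<in> A" for k by (rule function_algebra_const[OF A])
  have d: "f - g \<in> A" if "f \<in> A" "g \<in> A" for f g
    using function_algebra_diff[OF A that] by (simp add: fun_diff_def)
  have p: "f + g \<in> A" "f * g \<in> A" if "f \<in> A" "g \<in> A" for f g
    using function_algebra_add[OF A that] function_algebra_mult[OF A that]
    by (simp_all add: plus_fun_def times_fun_def)
  show ?thesis
    unfolding derivations_def
    by (auto intro!: d derivation_closed[OF V] derivation_closed[OF V']
        simp: c p derivation_constant[OF V] derivation_constant[OF V'] derivation_plus[OF V]
          derivation_plus[OF V'] derivation_times[OF V] derivation_times[OF V'] algebra_simps)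
qed

text \<open>Two lifts of the same tangent vector differ by a vertical field. In terms of \<open>X\<close> and \<open>Y\<close>: as \<open>f\<close>
  and \<open>f'\<close> are coprime, \<open>f\<close> divides the difference of the \<open>X\<close>, say with quotient \<open>h\<close>, and the classes
  differ by the exact form belonging to \<open>s h\<close>. The lifts for different sections need
  not be the same, and this lemma allows treating the four sections together.\<close>

lemma exact_even_independent_of_lift:
  assumes "coprime f (pderiv f)"
    and tangent: "v + pderiv f * X = smult 2 (Y * f)" "v + pderiv f * X' = smult 2 (Y' * f)"
    and exact: "exact_even f (d + pderiv (s * X) - Y * s)"
  shows "exact_even f (d + pderiv (s * X') - Y' * s)"
proof -
  have eq: "pderiv f * (X' - X) = smult 2 ((Y' - Y) * f)"
  proof -
    have "pderiv f * (X' - X) = (v + pderiv f * X') - (v + pderiv f * X)" by (simp add: algebra_simps)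
    also have "\<dots> = smult 2 ((Y' - Y) * f)" unfolding tangent by (simp add: algebra_simps smult_diff_right)
    finally show ?thesis .
  qed
  then have "f dvd pderiv f * (X' - X)" by (simp add: dvd_smult)
  then have "f dvd X' - X" using assms(1) coprime_dvd_mult_right_iff by blast
  then obtain h where h: "X' - X = f * h" by (rule dvdE)
  have X': "X' = X + h * f" using h by (simp add: algebra_simps)
  show ?thesis
  proof (cases "f = 0")
    case True
    then show ?thesis using assms(1) by simp
  next
    case False
    have "(Y' - Y) * f = smult (1/2) (h * pderiv f) * f"
      using arg_cong[OF eq, of "smult (1/2)"] unfolding h by (simp add: algebra_simps)
    then have "Y' - Y = smult (1/2) (h * pderiv f)" using False mult_right_cancel by blast
    then have Y': "Y' = Y + smult (1/2) (h * pderiv f)" by (simp add: algebra_simps)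
    have half: "smult (1/2) r + smult (1/2) r = r" for r :: "complex poly"
      by (simp flip: smult_add_left)
    have "d + pderiv (s * X') - Y' * s = (d + pderiv (s * X) - Y * s) +
        (pderiv (s * h) * f + smult (1/2) ((s * h) * pderiv f))"
      using half[of "s * h * pderiv f"] unfolding X' Y'
      by (simp add: pderiv_mult pderiv_add algebra_simps smult_add_right)
    moreover have "exact_even f (pderiv (s * h) * f + smult (1/2) ((s * h) * pderiv f))"
      unfolding exact_even_def by blast
    ultimately show ?thesis using exact_even_add[OF exact] by (simp only:)
  qed
qed

definition frame_row :: "(nat \<Rightarrow> nat \<Rightarrow> complex) \<Rightarrow> nat \<Rightarrow> complex poly" where
  "frame_row m i = [:m i 0, m i 1, m i 2, m i 3:]"

text \<open>Restriction to the curve over \<open>p\<close>. Write \<open>U(x) = X\<^sub>0 + X\<^sub>1y\<close>, \<open>U(y) = Y\<^sub>0 + Y\<^sub>1y\<close> and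
  \<open>\<mu> = M\<^sub>0 + M\<^sub>1y\<close>. Applying \<open>U\<close> to \<open>y\<^sup>2 = f\<close> and to \<open>D x = y\<close> and comparing parts gives the tangency
  condition and \<open>M\<^sub>0 = Y\<^sub>1 - X\<^sub>0'\<close>, so the even part of the derivative of a section depends only on
  \<open>X = X\<^sub>0\<close> and \<open>Y = Y\<^sub>1\<close>.\<close>

lemma lift_restricted_to_fiber:
  assumes u: "u \<in> derivations O_frame" and U: "U \<in> derivations O_curve"
    and lift: "\<And>r. r \<in> O_frame \<Longrightarrow> U (r \<circ> proj) = u r \<circ> proj"
    and \<mu>: "\<mu> \<in> O_curve" "\<And>c. c \<in> O_curve \<Longrightarrow> U (\<D> c) - \<D> (U c) = \<mu> * \<D> c"
    and i: "i < 4"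
    and exact: "c \<in> O_curve" "U (\<kappa> (alpha i)) - \<mu> * \<kappa> (alpha i) = \<D> c"
  obtains X Y where
    "[:u T5 p, u T4 p, u T3 p, u T2 p:] + pderiv (fq p) * X = smult 2 (Y * fq p)"
    "exact_even (fq p) (frame_row (\<lambda>i j. u (S_entry i j) p) i
       + pderiv (frame_row (\<lambda>i j. S_entry i j p) i * X) - Y * frame_row (\<lambda>i j. S_entry i j p) i)"
proof -
  obtain X0 X1 where Ux: "U x_coord = fiber_fun X0 X1"
    by (rule O_curve_cases[OF derivation_closed[OF U x_coord_in]])
  obtain Y0 Y1 where Uy: "U y_coord = fiber_fun Y0 Y1"
    by (rule O_curve_cases[OF derivation_closed[OF U y_coord_in]])
  obtain M0 M1 where M: "\<mu> = fiber_fun M0 M1" by (rule O_curve_cases[OF \<mu>(1)])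
  have const: "u (\<lambda>_. k) = (\<lambda>_. 0)" for k
    using derivation_constant[OF u, of k] by (simp add: zero_fun_def)
  let ?rs = "[T5, T4, T3, T2, \<lambda>_. 0, \<lambda>_. 1]"
  have rs: "set ?rs \<subseteq> O_frame" using T_regular regular_intros(1) by auto
  have "y_coord * U y_coord + y_coord * U y_coord = horner (map u ?rs) + horner' ?rs * U x_coord"
    using derivation_times[OF U y_coord_in y_coord_in] derivation_horner[OF U lift rs]
    unfolding quintic_horner by (simp only:)
  then have "fiber_fun (\<lambda>p. Y1 p * fq p + Y1 p * fq p) (\<lambda>p. Y0 p + Y0 p) =
     fiber_fun (\<lambda>p. [:u T5 p, u T4 p, u T3 p, u T2 p:] + pderiv (fq p) * X0 p) (\<lambda>p. pderiv (fq p) * X1 p)"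
    unfolding Ux Uy unfolding y_coord_fiber horner_fiber fiber_fun_times fiber_fun_plus
    by (simp add: const quintic_T)
  from fun_cong[OF fiber_fun_inject(1)[OF this], of p]
  have tangent: "[:u T5 p, u T4 p, u T3 p, u T2 p:] + pderiv (fq p) * X0 p = smult 2 (Y1 p * fq p)"
    using smult_add_left[of 1 1 "Y1 p * fq p"] by simp
  have "U y_coord - \<D> (U x_coord) = \<mu> * y_coord" using \<mu>(2)[OF x_coord_in] by (simp only: vertical_x)
  then have "U y_coord = \<mu> * y_coord + \<D> (U x_coord)" by (simp only: diff_eq_eq)
  then have "fiber_fun Y0 Y1 = fiber_fun
      (\<lambda>p. M1 p * fq p + (pderiv (X1 p) * fq p + smult (1/2) (X1 p * pderiv (fq p))))
      (\<lambda>p. M0 p + pderiv (X0 p))"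
    unfolding Ux Uy M unfolding y_coord_fiber vertical_fiber_fun fiber_fun_times fiber_fun_plus by simp
  from fun_cong[OF fiber_fun_inject(2)[OF this], of p]
  have M0: "M0 p = Y1 p - pderiv (X0 p)" by simp
  let ?ss = "[S_entry i 0, S_entry i 1, S_entry i 2, S_entry i 3]"
  have ss: "map (S_entry i) [0..<4] = ?ss" by (simp add: eval_nat_numeral)
  have "set ?ss \<subseteq> O_frame" using S_entry_regular[OF i] by auto
  from derivation_horner[OF U lift this]
  have h: "U (\<kappa> (alpha i)) = horner (map u ?ss) + horner' ?ss * U x_coord"
    unfolding alpha_horner ss .
  obtain P Q where PQ: "c = fiber_fun P Q" by (rule O_curve_cases[OF exact(1)])
  have "horner (map u ?ss) + horner' ?ss * U x_coord = \<D> c + \<mu> * horner ?ss"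
    using exact(2) unfolding h unfolding alpha_horner ss diff_eq_eq .
  then have "fiber_fun (\<lambda>p. Poly (map (\<lambda>r. r p) (map u ?ss)) + pderiv (Poly (map (\<lambda>r. r p) ?ss)) * X0 p)
      (\<lambda>p. pderiv (Poly (map (\<lambda>r. r p) ?ss)) * X1 p) =
    fiber_fun (\<lambda>p. pderiv (Q p) * fq p + smult (1/2) (Q p * pderiv (fq p)) + M0 p * Poly (map (\<lambda>r. r p) ?ss))
      (\<lambda>p. pderiv (P p) + M1 p * Poly (map (\<lambda>r. r p) ?ss))"
    unfolding PQ M Ux horner_fiber vertical_fiber_fun fiber_fun_times fiber_fun_plus by simp
  from fun_cong[OF fiber_fun_inject(1)[OF this], of p]
  have "frame_row (\<lambda>i j. u (S_entry i j) p) i + pderiv (frame_row (\<lambda>i j. S_entry i j p) i) * X0 p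
     = pderiv (Q p) * fq p + smult (1/2) (Q p * pderiv (fq p)) + M0 p * frame_row (\<lambda>i j. S_entry i j p) i"
    unfolding frame_row_def list.map Poly.simps .
  then have "frame_row (\<lambda>i j. u (S_entry i j) p) i
       + pderiv (frame_row (\<lambda>i j. S_entry i j p) i * X0 p) - Y1 p * frame_row (\<lambda>i j. S_entry i j p) i
     = pderiv (Q p) * fq p + smult (1/2) (Q p * pderiv (fq p))"
    unfolding M0 pderiv_mult by (simp add: algebra_simps)
  then have "exact_even (fq p) (frame_row (\<lambda>i j. u (S_entry i j) p) i
       + pderiv (frame_row (\<lambda>i j. S_entry i j p) i * X0 p) - Y1 p * frame_row (\<lambda>i j. S_entry i j p) i)"
    unfolding exact_even_def by blast
  with tangent show ?thesis by (rule that)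
qed

lemma derivation_inverse:
  assumes u: "u \<in> derivations A" and f: "f \<in> A" "(\<lambda>p. 1 / f p) \<in> A" "\<And>p. f p \<noteq> 0"
  shows "u (\<lambda>p. 1 / f p) p = - (u f p / (f p * f p))"
proof -
  have "(\<lambda>p. f p * (1 / f p)) = (\<lambda>_. 1)" using f(3) by auto
  then have "u (\<lambda>p. f p * (1 / f p)) = (\<lambda>_. 0)" using derivationsD(2)[OF u, of 1] by (simp only:)
  then have "f p * u (\<lambda>p. 1 / f p) p + 1 / f p * u f p = 0"
    unfolding derivationsD(4)[OF u f(1,2)] by (rule fun_cong)
  then have "f p * u (\<lambda>p. 1 / f p) p = - (1 / f p * u f p)" by (simp only: eq_neg_iff_add_eq_0)
  then have "u (\<lambda>p. 1 / f p) p = - (1 / f p * u f p) / f p"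
    by (simp only: nonzero_eq_divide_eq[OF f(3)] mult.commute)
  then show ?thesis by simp
qed

text \<open>At \<open>p\<close> the derivation is \<open>-k/2\<close> times the derivative along the curve
  \<open>\<epsilon> \<mapsto> (1 + \<epsilon>) \<cdot> p\<close> in the orbit of \<open>p\<close>: this holds for the coordinates, with the weights \<open>-2i\<close> of
  \<open>t\<^sub>i\<close> and \<open>2j - 3\<close> of the entries in column \<open>j\<close>, and so for all regular functions. Invariant functions
  are constant along this curve.\<close>

lemma euler_kills_invariants:
  assumes u: "u \<in> derivations O_frame"
    and k: "u T2 p = k * 2 * T2 p" "u T3 p = k * 3 * T3 p"
    "u T4 p = k * 4 * T4 p" "u T5 p = k * 5 * T5 p"
    "\<And>i j. i < 4 \<Longrightarrow> j < 4 \<Longrightarrow> u (S_entry i j) p = k * (3/2 - of_nat j) * S_entry i j p"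
    and f: "f \<in> O_T"
  shows "u (f \<circ> abs_moduli_T) p = 0"
proof -
  let ?c = "\<lambda>\<epsilon>. scaled (1 + \<epsilon>) p"
  have near: "1 + \<epsilon> \<noteq> 0" if "dist \<epsilon> 0 < 1" for \<epsilon> :: complex
  proof
    assume "1 + \<epsilon> = 0"
    then have "\<epsilon> = - 1" by (simp add: eq_neg_iff_add_eq_0 add.commute)
    then show False using that by simp
  qed
  have weight: "((\<lambda>\<epsilon>. h (?c \<epsilon>)) has_field_derivative of_int n * h p) (at 0)"
    if h: "\<And>a. a \<noteq> 0 \<Longrightarrow> h (scaled a p) = a powi n * h p" for h and n
  proof (rule has_field_derivative_transform_within[of "\<lambda>\<epsilon>. (1 + \<epsilon>) powi n * h p" _ 0 UNIV 1])
    show "((\<lambda>\<epsilon>. (1 + \<epsilon>) powi n * h p) has_field_derivative of_int n * h p) (at 0)"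
      by (auto intro!: derivative_eq_intros)
    show "(1 + \<epsilon>) powi n * h p = h (?c \<epsilon>)" if "dist \<epsilon> 0 < 1" for \<epsilon>
      using h[OF near[OF that]] by simp
  qed auto
  have conclude: "\<exists>e. ((\<lambda>\<epsilon>. h (?c \<epsilon>)) has_field_derivative e) (at 0) \<and> u h p = - k / 2 * e"
    if "\<And>a. a \<noteq> 0 \<Longrightarrow> h (scaled a p) = a powi n * h p" "u h p = - k / 2 * (of_int n * h p)" for h n
    using weight[of h n, OF that(1)] that(2) by (intro exI conjI)
  have "\<exists>e. ((\<lambda>\<epsilon>. g (?c \<epsilon>)) has_field_derivative e) (at 0) \<and> u g p = - k / 2 * e"
    if "g \<in> O_frame" for g
    using that
  proof (induction rule: O_frame_induct)
    case (const c)
    then show ?case using derivationsD(2)[OF u, of c] by (auto intro!: exI[of _ 0] derivative_eq_intros)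
  next
    case (coordinate h)
    then consider "h = T2" | "h = T3" | "h = T4" | "h = T5" | i j where "i < 4" "j < 4" "h = S_entry i j"
      unfolding coordinates_def by auto
    then show ?case
    proof cases
      case 1
      show ?thesis unfolding 1 by (rule conclude[of T2 "-4"]) (simp_all add: scaled_coordinates k)
    next
      case 2
      show ?thesis unfolding 2 by (rule conclude[of T3 "-6"]) (simp_all add: scaled_coordinates k)
    next
      case 3
      show ?thesis unfolding 3 by (rule conclude[of T4 "-8"]) (simp_all add: scaled_coordinates k)
    next
      case 4
      show ?thesis unfolding 4 by (rule conclude[of T5 "-10"]) (simp_all add: scaled_coordinates k)
    next
      case 5
      show ?thesis unfolding 5
        by (rule conclude[of "S_entry i j" "2 * int j - 3"])
          (simp_all add: scaled_coordinates 5 k(5) field_simps)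
    qed
  next
    case (add f g)
    then obtain e e' where e: "((\<lambda>\<epsilon>. f (?c \<epsilon>)) has_field_derivative e) (at 0)" "u f p = - k / 2 * e"
      "((\<lambda>\<epsilon>. g (?c \<epsilon>)) has_field_derivative e') (at 0)" "u g p = - k / 2 * e'" by auto
    then show ?case using derivationsD(3)[OF u add(1,2)] DERIV_add[OF e(1,3)]
      by (intro exI[of _ "e + e'"]) (simp add: algebra_simps)
  next
    case (mult f g)
    then obtain e e' where e: "((\<lambda>\<epsilon>. f (?c \<epsilon>)) has_field_derivative e) (at 0)" "u f p = - k / 2 * e"
      "((\<lambda>\<epsilon>. g (?c \<epsilon>)) has_field_derivative e') (at 0)" "u g p = - k / 2 * e'" by auto
    then show ?case using derivationsD(4)[OF u mult(1,2)] DERIV_mult[OF e(1,3)]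
      by (intro exI[of _ "e * g p + e' * f p"]) (auto simp: scaled_1 algebra_simps)
  next
    case (inverse f)
    then obtain e where e: "((\<lambda>\<epsilon>. f (?c \<epsilon>)) has_field_derivative e) (at 0)" "u f p = - k / 2 * e" by auto
    have "u (\<lambda>p. 1 / f p) p = - k / 2 * (- (e / (f p * f p)))"
      using derivation_inverse[OF u inverse(1-3)] e(2) by simp
    moreover have "((\<lambda>\<epsilon>. 1 / f (?c \<epsilon>)) has_field_derivative - (e / (f p * f p))) (at 0)"
      using inverse(3) by (auto intro!: derivative_eq_intros e simp: scaled_1 power2_eq_square)
    ultimately show ?case by blast
  qed
  then obtain e where e: "((\<lambda>\<epsilon>. (f \<circ> abs_moduli_T) (?c \<epsilon>)) has_field_derivative e) (at 0)"
    "u (f \<circ> abs_moduli_T) p = - k / 2 * e"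
    using f unfolding O_T_def by blast
  have "((\<lambda>\<epsilon>. (f \<circ> abs_moduli_T) (?c \<epsilon>)) has_field_derivative 0) (at 0)"
  proof (rule has_field_derivative_transform_within[of "\<lambda>\<epsilon>. (f \<circ> abs_moduli_T) p" _ 0 UNIV 1])
    show "(f \<circ> abs_moduli_T) p = (f \<circ> abs_moduli_T) (?c \<epsilon>)" if "dist \<epsilon> 0 < 1" for \<epsilon>
      using abs_scaled[OF near[OF that]] by simp
  qed auto
  from DERIV_unique[OF e(1) this] e(2) show ?thesis by simp
qed

lemma gauss_manin_coefficient:
  assumes "gauss_manin proj O_frame O_curve w \<phi> \<psi>" "w \<in> derivations O_frame"
  shows "\<exists>V \<mu> c. V \<in> derivations O_curve \<and> (\<forall>r\<in>O_frame. V (r \<circ> proj) = w r \<circ> proj) \<and>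
    \<mu> \<in> O_curve \<and> (\<forall>c\<in>O_curve. V (\<D> c) - \<D> (V c) = \<mu> * \<D> c) \<and>
    c \<in> O_curve \<and> V (\<kappa> \<phi>) - \<mu> * \<kappa> \<phi> - \<kappa> \<psi> = \<D> c"
proof -
  obtain V where V: "V \<in> derivations O_curve" "\<And>r. r \<in> O_frame \<Longrightarrow> V (r \<circ> proj) = w r \<circ> proj"
    and \<phi>: "\<phi> \<in> forms" and H: "H1_dR_eq base_ring O_curve (lie_derivative V \<phi>) \<psi>"
    using assms(1) unfolding gauss_manin_def by auto
  obtain \<mu> where \<mu>: "\<mu> \<in> O_curve" "\<And>c. c \<in> O_curve \<Longrightarrow> V (\<D> c) - \<D> (V c) = \<mu> * \<D> c"
    by (rule commutator_multiple[OF V(1) exI[of _ "w _"]]) (use V(2) in auto)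
  obtain c where c: "c \<in> O_curve" "\<kappa> (lie_derivative V \<phi>) - \<kappa> \<psi> = \<D> c"
    using H unfolding H1_dR_eq_iff by auto
  have "\<kappa> (lie_derivative V \<phi>) = V (\<kappa> \<phi>) - \<mu> * \<kappa> \<phi>"
    by (rule lie_derivative_coefficient[OF V(1) \<phi>]) (rule \<mu>(2))
  with c(2) have "V (\<kappa> \<phi>) - \<mu> * \<kappa> \<phi> - \<kappa> \<psi> = \<D> c" by (simp only:)
  with V \<mu> c(1) show ?thesis by (intro exI conjI ballI) assumption+
qed

text \<open>The difference of two lifts lifts the difference of the vector fields, and the coefficient of the
  Lie derivative is additive in the lift.\<close>

lemma equal_connections_fiber:
  assumes w: "w \<in> derivations O_frame" "gauss_manin proj O_frame O_curve w (alpha i) \<psi>"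
    and w': "w' \<in> derivations O_frame" "gauss_manin proj O_frame O_curve w' (alpha i) \<psi>"
    and i: "i < 4"
  defines "u \<equiv> restrict (\<lambda>f. w f - w' f) O_frame"
  shows "\<exists>X Y. [:u T5 p, u T4 p, u T3 p, u T2 p:] + pderiv (fq p) * X = smult 2 (Y * fq p) \<and>
    exact_even (fq p) (frame_row (\<lambda>i j. u (S_entry i j) p) i
       + pderiv (frame_row (\<lambda>i j. S_entry i j p) i * X) - Y * frame_row (\<lambda>i j. S_entry i j p) i)"
proof -
  obtain V \<mu> c where V: "V \<in> derivations O_curve" "\<forall>r\<in>O_frame. V (r \<circ> proj) = w r \<circ> proj"
    "\<mu> \<in> O_curve" "\<forall>c\<in>O_curve. V (\<D> c) - \<D> (V c) = \<mu> * \<D> c"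
    "c \<in> O_curve" "V (\<kappa> (alpha i)) - \<mu> * \<kappa> (alpha i) - \<kappa> \<psi> = \<D> c"
    using gauss_manin_coefficient[OF w(2,1)] by (elim exE conjE) (rule that)
  obtain V' \<mu>' c' where V': "V' \<in> derivations O_curve" "\<forall>r\<in>O_frame. V' (r \<circ> proj) = w' r \<circ> proj"
    "\<mu>' \<in> O_curve" "\<forall>c\<in>O_curve. V' (\<D> c) - \<D> (V' c) = \<mu>' * \<D> c"
    "c' \<in> O_curve" "V' (\<kappa> (alpha i)) - \<mu>' * \<kappa> (alpha i) - \<kappa> \<psi> = \<D> c'"
    using gauss_manin_coefficient[OF w'(2,1)] by (elim exE conjE) (rule that)
  define U where "U = restrict (\<lambda>f. V f - V' f) O_curve"
  have U: "U f = V f - V' f" if "f \<in> O_curve" for f using that by (simp add: U_def)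
  have U_der: "U \<in> derivations O_curve"
    unfolding U_def by (rule restrict_difference_derivation[OF function_algebra_O_curve V(1) V'(1)])
  have u_der: "u \<in> derivations O_frame"
    unfolding u_def by (rule restrict_difference_derivation[OF function_algebra_O_frame w(1) w'(1)])
  have lift: "U (r \<circ> proj) = u r \<circ> proj" if "r \<in> O_frame" for r
    by (rule ext) (simp add: U[OF base_comp_in[OF that]] V(2)[rule_format, OF that] V'(2)[rule_format, OF that] u_def that)
  have comm: "U (\<D> f) - \<D> (U f) = (\<mu> - \<mu>') * \<D> f" if "f \<in> O_curve" for f
  proof -
    have "U (\<D> f) - \<D> (U f) = (V (\<D> f) - V' (\<D> f)) - (\<D> (V f) - \<D> (V' f))"
      unfolding U[OF that] U[OF vertical_in[OF that]]
      by (simp only: vertical_diff derivation_closed[OF V(1) that] derivation_closed[OF V'(1) that])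
    also have "\<dots> = (V (\<D> f) - \<D> (V f)) - (V' (\<D> f) - \<D> (V' f))" by (simp only: algebra_simps)
    also have "\<dots> = (\<mu> - \<mu>') * \<D> f" unfolding V(4)[rule_format, OF that] V'(4)[rule_format, OF that] left_diff_distrib ..
    finally show ?thesis .
  qed
  have alpha_in: "\<kappa> (alpha i) \<in> O_curve" by (rule contract_in[OF alpha_form[OF i] vertical_in])
  have "U (\<kappa> (alpha i)) - (\<mu> - \<mu>') * \<kappa> (alpha i) =
      (V (\<kappa> (alpha i)) - \<mu> * \<kappa> (alpha i) - \<kappa> \<psi>) - (V' (\<kappa> (alpha i)) - \<mu>' * \<kappa> (alpha i) - \<kappa> \<psi>)"
    unfolding U[OF alpha_in] by (simp only: algebra_simps)
  also have "\<dots> = \<D> (c - c')" unfolding V(6) V'(6) vertical_diff[OF V(5) V'(5)] ..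
  finally have exact: "U (\<kappa> (alpha i)) - (\<mu> - \<mu>') * \<kappa> (alpha i) = \<D> (c - c')" .
  show ?thesis
    by (rule lift_restricted_to_fiber[OF u_der U_der _ O_curve_diff[OF V(3) V'(3)] _ i
          O_curve_diff[OF V(5) V'(5)] exact, where p = p])
      (erule lift, erule comm, rule exI, rule exI, rule conjI)
qed

lemma coprime_quintic: "coprime (fq p) (pderiv (fq p))"
  using disc_nonzero_iff[of "Rep_frame_space p"] discriminant_nonzero[of p] by (simp add: discriminant_def)

lemma equal_connections_agree_on_invariants:
  assumes w: "w \<in> derivations O_frame" "\<And>i. i < 4 \<Longrightarrow> gauss_manin proj O_frame O_curve w (alpha i) (\<beta> i)"
    and w': "w' \<in> derivations O_frame" "\<And>i. i < 4 \<Longrightarrow> gauss_manin proj O_frame O_curve w' (alpha i) (\<beta> i)"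
    and f: "f \<in> O_T"
  shows "w (f \<circ> abs_moduli_T) = w' (f \<circ> abs_moduli_T)"
proof
  fix p
  define u where "u = restrict (\<lambda>f. w f - w' f) O_frame"
  have u_der: "u \<in> derivations O_frame"
    unfolding u_def by (rule restrict_difference_derivation[OF function_algebra_O_frame w(1) w'(1)])
  let ?v = "[:u T5 p, u T4 p, u T3 p, u T2 p:]"
  let ?d = "frame_row (\<lambda>i j. u (S_entry i j) p)" and ?s = "frame_row (\<lambda>i j. S_entry i j p)"
  have fiber: "\<exists>X Y. ?v + pderiv (fq p) * X = smult 2 (Y * fq p) \<and>
      exact_even (fq p) (?d i + pderiv (?s i * X) - Y * ?s i)" if "i < 4" for i
    unfolding u_def by (rule equal_connections_fiber[OF w(1) w(2)[OF that] w'(1) w'(2)[OF that] that])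
  obtain X Y where XY: "?v + pderiv (fq p) * X = smult 2 (Y * fq p)" using fiber[of 0] by auto
  have exact: "exact_even (fq p) (?d i + pderiv (?s i * X) - Y * ?s i)" if i: "i < 4" for i
  proof -
    obtain X' Y' where XY': "?v + pderiv (fq p) * X' = smult 2 (Y' * fq p)"
      "exact_even (fq p) (?d i + pderiv (?s i * X') - Y' * ?s i)" using fiber[OF i] by auto
    show ?thesis by (rule exact_even_independent_of_lift[OF coprime_quintic XY'(1) XY XY'(2)])
  qed
  have block: "S_entry i j p = 0 \<and> u (S_entry i j) p = 0" if "i \<in> {0, 1}" "j \<in> {2, 3}" for i j
  proof -
    have "S_entry i j = (\<lambda>_. 0)" using S_entry_block[OF that] by (rule ext)
    then show ?thesis using derivation_constant[OF u_der, of 0] by simp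
  qed
  obtain k where k: "u T2 p = k * 2 * T2 p" "u T3 p = k * 3 * T3 p" "u T4 p = k * 4 * T4 p" "u T5 p = k * 5 * T5 p"
    "\<forall>i<4. \<forall>j<4. u (S_entry i j) p = k * (3/2 - of_nat j) * S_entry i j p"
    by (rule horizontal_direction_is_euler[OF XY[unfolded quintic_T] block holomorphic_block_det
        exact[unfolded quintic_T frame_row_def]])
  have "u (f \<circ> abs_moduli_T) p = 0"
    by (rule euler_kills_invariants[OF u_der k(1-4) _ f]) (use k(5) in simp)
  then show "w (f \<circ> abs_moduli_T) p = w' (f \<circ> abs_moduli_T) p"
    using f by (simp add: u_def O_T_def)
qed

lemma vector_field_unique:
  assumes R: "R \<in> vector_fields_T" "nabla_T R alpha \<beta>"
    and R': "R' \<in> vector_fields_T" "nabla_T R' alpha \<beta>"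
  shows "R = R'"
proof -
  obtain w where w: "w \<in> derivations O_frame"
    "\<forall>f\<in>O_T. w (f \<circ> abs_moduli_T) = R f \<circ> abs_moduli_T"
    "\<forall>i<4. gauss_manin proj O_frame O_curve w (alpha i) (\<beta> i)"
    using R(2) unfolding nabla_T_def by auto
  obtain w' where w': "w' \<in> derivations O_frame"
    "\<forall>f\<in>O_T. w' (f \<circ> abs_moduli_T) = R' f \<circ> abs_moduli_T"
    "\<forall>i<4. gauss_manin proj O_frame O_curve w' (alpha i) (\<beta> i)"
    using R'(2) unfolding nabla_T_def by auto
  have "R f = R' f" if f: "f \<in> O_T" for f
  proof
    fix t
    have "\<exists>p. t = abs_moduli_T p" by (induction t rule: moduli_T.abs_induct) blast
    then obtain p where t: "t = abs_moduli_T p" ..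
    have "w (f \<circ> abs_moduli_T) = w' (f \<circ> abs_moduli_T)"
      by (rule equal_connections_agree_on_invariants[OF w(1) _ w'(1) _ f]) (use w(3) w'(3) in auto)
    then have "R f \<circ> abs_moduli_T = R' f \<circ> abs_moduli_T" using w(2) w'(2) f by simp
    then show "R f t = R' f t" unfolding t by (simp only: fun_eq_iff o_apply)
  qed
  then show ?thesis
    using R(1) R'(1) unfolding vector_fields_T_def derivations_def
    by (intro PiE_ext[of R O_T "\<lambda>_. O_T" R']) auto
qed

section \<open>Tangent vectors to the space of frames\<close>

lemma pairing_swap: "pairing c s r = - pairing c r s"
  by (simp add: pairing_def algebra_simps)

lemma pairing_linear:
  "pairing c (\<lambda>k. x * r k + y * r' k) s = x * pairing c r s + y * pairing c r' s"
  "pairing c s (\<lambda>k. x * r k + y * r' k) = x * pairing c s r + y * pairing c s r'"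
  by (simp_all add: pairing_def algebra_simps)

lemma pairing_holomorphic:
  "r 2 = 0 \<Longrightarrow> r 3 = 0 \<Longrightarrow> s 2 = 0 \<Longrightarrow> s 3 = 0 \<Longrightarrow> pairing c r s = 0"
  by (simp add: pairing_def)

lemma pairing_self: "pairing c r r = 0"
  by (simp add: pairing_def)

text \<open>Gram--Schmidt for the pairing, when the first two rows are already isotropic and the last two rows
  are only close to their duals. The last two rows are multiplied by the inverse transpose of the
  matrix of pairings between the two halves, and a multiple of row 1 is then subtracted from row 2 to
  make rows 2 and 3 orthogonal.\<close>

definition symplectic_rows :: "complex \<Rightarrow> (nat \<Rightarrow> nat \<Rightarrow> complex) \<Rightarrow> nat \<Rightarrow> nat \<Rightarrow> complex" where
  "symplectic_rows c z i = (let
      G = (\<lambda>i j. pairing c (z i) (z j)); \<delta> = G 0 2 * G 1 3 - G 0 3 * G 1 2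
    in if i = 2 then (\<lambda>k. G 1 3 / \<delta> * z 2 k + (- G 1 2 / \<delta> * z 3 k - G 2 3 / \<delta> * z 1 k))
       else if i = 3 then (\<lambda>k. - G 0 3 / \<delta> * z 2 k + G 0 2 / \<delta> * z 3 k)
       else z i)"

lemma symplectic_rows:
  assumes block: "\<And>i k. i \<in> {0, 1} \<Longrightarrow> k \<in> {2, 3} \<Longrightarrow> z i k = 0"
    and \<delta>: "pairing c (z 0) (z 2) * pairing c (z 1) (z 3) \<noteq> pairing c (z 0) (z 3) * pairing c (z 1) (z 2)"
    and ij: "i < 4" "j < 4"
  shows "pairing c (symplectic_rows c z i) (symplectic_rows c z j) = Phi $$ (i, j)"
proof -
  let ?G = "\<lambda>i j. pairing c (z i) (z j)" and ?W = "symplectic_rows c z"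
  define \<delta>' where "\<delta>' = ?G 0 2 * ?G 1 3 - ?G 0 3 * ?G 1 2"
  have d: "\<delta>' \<noteq> 0" using \<delta> by (simp add: \<delta>'_def)
  have W: "?W 0 = z 0" "?W 1 = z 1"
    "?W 2 = (\<lambda>k. ?G 1 3 / \<delta>' * z 2 k + 1 * (- ?G 1 2 / \<delta>' * z 3 k + - ?G 2 3 / \<delta>' * z 1 k))"
    "?W 3 = (\<lambda>k. - ?G 0 3 / \<delta>' * z 2 k + ?G 0 2 / \<delta>' * z 3 k)"
    by (simp_all add: symplectic_rows_def Let_def \<delta>'_def)
  have z01: "?G 0 1 = 0" by (rule pairing_holomorphic) (simp_all add: block)
  have swap: "?G 3 2 = - ?G 2 3" "?G 2 1 = - ?G 1 2" "?G 3 1 = - ?G 1 3" by (rule pairing_swap)+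
  have 02: "pairing c (?W 0) (?W 2) = 1"
    unfolding W pairing_linear z01 using d by (simp add: divide_simps) (simp add: \<delta>'_def algebra_simps)
  have 03: "pairing c (?W 0) (?W 3) = 0"
    unfolding W pairing_linear by (simp add: field_simps)
  have 12: "pairing c (?W 1) (?W 2) = 0"
    unfolding W pairing_linear pairing_self by (simp add: field_simps)
  have 13: "pairing c (?W 1) (?W 3) = 1"
    unfolding W pairing_linear using d by (simp add: divide_simps) (simp add: \<delta>'_def algebra_simps)
  have 23: "pairing c (?W 2) (?W 3) = 0"
  proof -
    have "pairing c (?W 2) (?W 3) = (?G 1 3 * ?G 0 2 - ?G 1 2 * ?G 0 3) * ?G 2 3 / \<delta>' ^ 2
        - ?G 2 3 / \<delta>' * ((?G 0 2 * ?G 1 3 - ?G 0 3 * ?G 1 2) / \<delta>')"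
      unfolding W pairing_linear pairing_self swap using d
      by (simp add: field_simps power2_eq_square)
    also have "\<dots> = 0" using d by (simp add: field_simps power2_eq_square)
    finally show ?thesis .
  qed
  have 01: "pairing c (?W 0) (?W 1) = 0" unfolding W by (rule z01)
  note swaps = pairing_swap[of c "?W 1" "?W 0"] pairing_swap[of c "?W 2" "?W 0"] pairing_swap[of c "?W 3" "?W 0"]
    pairing_swap[of c "?W 2" "?W 1"] pairing_swap[of c "?W 3" "?W 1"] pairing_swap[of c "?W 3" "?W 2"]
  show ?thesis
    using ij unfolding less_4_cases
    by (elim disjE) (simp_all only: pairing_self 01 02 03 12 13 23 swaps[unfolded 01 02 03 12 13 23],
      simp_all add: Phi_entries(2))
qed

text \<open>The straight line with the given velocity satisfies the conditions on \<open>S\<close> up to terms of second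
  order in \<open>\<epsilon>\<close>. The Gram--Schmidt correction repairs this without changing the velocity at \<open>\<epsilon> = 0\<close>, because the
  pairings between the rows have derivative 0 there. Only near \<open>\<epsilon> = 0\<close> does the curve stay away from the
  discriminant; elsewhere \<open>\<gamma>\<close> takes irrelevant values.\<close>

lemma velocity_curve:
  fixes v2 v3 v4 v5 :: complex and \<sigma> :: "nat \<Rightarrow> nat \<Rightarrow> complex"
  assumes block: "\<And>i j. i \<in> {0, 1} \<Longrightarrow> j \<in> {2, 3} \<Longrightarrow> \<sigma> i j = 0"
    and tangent: "\<And>i j. i < 4 \<Longrightarrow> j < 4 \<Longrightarrow>
      pairing (T2 p) (\<sigma> i) (\<lambda>k. S_entry j k p) + pairing (T2 p) (\<lambda>k. S_entry i k p) (\<sigma> j)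
      + 4/3 * v2 * (S_entry i 2 p * S_entry j 3 p - S_entry i 3 p * S_entry j 2 p) = 0"
  shows "\<exists>\<gamma>. \<gamma> 0 = p \<and> ((\<lambda>\<epsilon>. T2 (\<gamma> \<epsilon>)) has_field_derivative v2) (at 0) \<and>
    ((\<lambda>\<epsilon>. T3 (\<gamma> \<epsilon>)) has_field_derivative v3) (at 0) \<and>
    ((\<lambda>\<epsilon>. T4 (\<gamma> \<epsilon>)) has_field_derivative v4) (at 0) \<and>
    ((\<lambda>\<epsilon>. T5 (\<gamma> \<epsilon>)) has_field_derivative v5) (at 0) \<and>
    (\<forall>i<4. \<forall>j<4. ((\<lambda>\<epsilon>. S_entry i j (\<gamma> \<epsilon>)) has_field_derivative \<sigma> i j) (at 0))"
proof -
  define z where "z \<epsilon> i k = S_entry i k p + \<epsilon> * \<sigma> i k" for \<epsilon> i k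
  define c where "c \<epsilon> = T2 p + \<epsilon> * v2" for \<epsilon>
  define G where "G i j \<epsilon> = pairing (c \<epsilon>) (z \<epsilon> i) (z \<epsilon> j)" for i j \<epsilon>
  define \<delta> where "\<delta> \<epsilon> = G 0 2 \<epsilon> * G 1 3 \<epsilon> - G 0 3 \<epsilon> * G 1 2 \<epsilon>" for \<epsilon>
  define data where "data \<epsilon> = \<lparr>t2 = c \<epsilon>, t3 = T3 p + \<epsilon> * v3, t4 = T4 p + \<epsilon> * v4, t5 = T5 p + \<epsilon> * v5,
    S = mat 4 4 (\<lambda>(i, j). symplectic_rows (c \<epsilon>) (z \<epsilon>) i j)\<rparr>" for \<epsilon>
  have G0: "G i j 0 = Phi $$ (i, j)" if "i < 4" "j < 4" for i j
    using frame_pairing[OF that, of p] by (simp add: G_def c_def z_def[abs_def])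
  have dG: "(G i j has_field_derivative 0) (at 0)" if "i < 4" "j < 4" for i j
  proof -
    have "(G i j has_field_derivative (pairing (T2 p) (\<sigma> i) (\<lambda>k. S_entry j k p) + pairing (T2 p) (\<lambda>k. S_entry i k p) (\<sigma> j)
      + 4/3 * v2 * (S_entry i 2 p * S_entry j 3 p - S_entry i 3 p * S_entry j 2 p))) (at 0)"
      unfolding G_def[abs_def] pairing_def c_def z_def
      by (auto intro!: derivative_eq_intros simp: field_simps)
    then show ?thesis unfolding tangent[OF that] .
  qed
  have \<delta>0: "\<delta> 0 = 1" by (simp add: \<delta>_def G0 Phi_entries(2))
  have d\<delta>: "(\<delta> has_field_derivative 0) (at 0)"
    unfolding \<delta>_def[abs_def] by (auto intro!: derivative_eq_intros dG)
  have cont: "isCont (\<lambda>\<epsilon>. disc (data \<epsilon>)) 0"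
  proof -
    let ?A = "{f :: complex \<Rightarrow> complex. isCont f 0}"
    have "(\<lambda>\<epsilon>. disc (data \<epsilon>)) \<in> ?A"
      by (rule disc_alg) (auto simp: function_algebra_def data_def c_def intro!: continuous_intros)
    then show ?thesis by simp
  qed
  have rows0: "symplectic_rows (c 0) (z 0) i k = S_entry i k p" for i k
  proof -
    have G: "pairing (c 0) (z 0 i) (z 0 j) = Phi $$ (i, j)" if "i < 4" "j < 4" for i j
      using G0[OF that] by (simp add: G_def)
    show ?thesis by (simp add: symplectic_rows_def Let_def G Phi_entries(2)) (simp add: z_def)
  qed
  have data0: "data 0 = Rep_frame_space p"
  proof -
    have "S (Rep_frame_space p) \<in> carrier_mat 4 4"
      using frame_conditions_Rep[of p] by (simp add: frame_conditions_iff)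
    then have "mat 4 4 (\<lambda>(i, j). S_entry i j p) = S (Rep_frame_space p)"
      by (intro eq_matI) (auto simp: S_entry_def)
    moreover have "data 0 = \<lparr>t2 = T2 p, t3 = T3 p, t4 = T4 p, t5 = T5 p, S = mat 4 4 (\<lambda>(i, j). S_entry i j p)\<rparr>"
      unfolding data_def rows0 by (simp add: c_def)
    ultimately show ?thesis by (simp add: T2_def T3_def T4_def T5_def)
  qed
  have nonzero: "\<forall>\<^sub>F \<epsilon> in nhds 0. f \<epsilon> \<noteq> 0" if "isCont f 0" "f 0 \<noteq> 0" for f :: "complex \<Rightarrow> complex"
    using that tendsto_imp_eventually_ne[of f "f 0" "nhds 0" 0] by (simp add: tendsto_nhds_iff isCont_def)
  have "\<forall>\<^sub>F \<epsilon> in nhds 0. \<delta> \<epsilon> \<noteq> 0"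
    by (rule nonzero[OF DERIV_isCont[OF d\<delta>]]) (simp add: \<delta>0)
  moreover have "\<forall>\<^sub>F \<epsilon> in nhds 0. disc (data \<epsilon>) \<noteq> 0"
    by (rule nonzero[OF cont]) (use discriminant_nonzero[of p] in \<open>simp add: data0 discriminant_def\<close>)
  moreover have "\<forall>\<^sub>F \<epsilon> in nhds 0. T5 p + \<epsilon> * v5 \<noteq> 0"
    by (rule nonzero) (auto intro!: continuous_intros T5_nonzero)
  ultimately have near: "\<forall>\<^sub>F \<epsilon> in nhds 0. frame_conditions (data \<epsilon>)"
  proof eventually_elim
    case (elim \<epsilon>)
    have zb: "z \<epsilon> i k = 0" if "i \<in> {0, 1}" "k \<in> {2, 3}" for i k
      using block[OF that] S_entry_block[OF that] by (simp add: z_def)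
    have "pairing (c \<epsilon>) (symplectic_rows (c \<epsilon>) (z \<epsilon>) i) (symplectic_rows (c \<epsilon>) (z \<epsilon>) j) = Phi $$ (i, j)"
      if "i < 4" "j < 4" for i j
      by (rule symplectic_rows[OF zb _ that]) (use elim(1) in \<open>simp_all add: \<delta>_def G_def\<close>)
    then have "pairing (c \<epsilon>) (\<lambda>k. S (data \<epsilon>) $$ (i, k)) (\<lambda>k. S (data \<epsilon>) $$ (j, k)) = Phi $$ (i, j)"
      if "i < 4" "j < 4" for i j
      using that by (simp add: data_def pairing_def)
    moreover have "S (data \<epsilon>) $$ (i, k) = 0" if "i \<in> {0, 1}" "k \<in> {2, 3}" for i k
    proof -
      have "i < 4" "k < 4" "i \<noteq> 2" "i \<noteq> 3" using that by auto
      then show ?thesis using zb[OF that] by (simp add: data_def symplectic_rows_def Let_def)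
    qed
    ultimately show ?case using elim by (auto simp: frame_conditions_iff data_def)
  qed
  define \<gamma> where "\<gamma> \<epsilon> = Abs_frame_space (data \<epsilon>)" for \<epsilon>
  have Rep: "Rep_frame_space (\<gamma> \<epsilon>) = data \<epsilon>" if "frame_conditions (data \<epsilon>)" for \<epsilon>
    unfolding \<gamma>_def using that by (intro Abs_frame_space_inverse) simp
  have transfer: "((\<lambda>\<epsilon>. h (\<gamma> \<epsilon>)) has_field_derivative D) (at 0)"
    if "\<And>\<epsilon>. frame_conditions (data \<epsilon>) \<Longrightarrow> h (\<gamma> \<epsilon>) = k \<epsilon>" "(k has_field_derivative D) (at 0)"
    for h :: "frame_space \<Rightarrow> complex" and k D
  proof -
    have "\<forall>\<^sub>F \<epsilon> in nhds 0. h (\<gamma> \<epsilon>) = k \<epsilon>" using near by (rule eventually_mono) (rule that(1))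
    from DERIV_cong_ev[OF refl this refl] that(2) show ?thesis by blast
  qed
  have dS: "((\<lambda>\<epsilon>. symplectic_rows (c \<epsilon>) (z \<epsilon>) i j) has_field_derivative \<sigma> i j) (at 0)" if "i < 4" for i j
  proof -
    have dz: "((\<lambda>\<epsilon>. z \<epsilon> i j) has_field_derivative \<sigma> i j) (at 0)" for i j
      unfolding z_def by (auto intro!: derivative_eq_intros)
    have quotient: "((\<lambda>\<epsilon>. f \<epsilon> / \<delta> \<epsilon>) has_field_derivative 0) (at 0)" if "(f has_field_derivative 0) (at 0)" for f
      using \<delta>0 by (auto intro!: derivative_eq_intros that d\<delta>)
    have product: "((\<lambda>\<epsilon>. G a b \<epsilon> / \<delta> \<epsilon> * z \<epsilon> k j) has_field_derivative Phi $$ (a, b) * \<sigma> k j) (at 0)"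
      if "a < 4" "b < 4" for a b k
      using DERIV_mult[OF quotient[OF dG[OF that]] dz[of k j]] by (simp add: G0[OF that] \<delta>0 mult.commute)
    have row2: "symplectic_rows (c \<epsilon>) (z \<epsilon>) 2 j =
        G 1 3 \<epsilon> / \<delta> \<epsilon> * z \<epsilon> 2 j - G 1 2 \<epsilon> / \<delta> \<epsilon> * z \<epsilon> 3 j - G 2 3 \<epsilon> / \<delta> \<epsilon> * z \<epsilon> 1 j"
      and row3: "symplectic_rows (c \<epsilon>) (z \<epsilon>) 3 j = G 0 2 \<epsilon> / \<delta> \<epsilon> * z \<epsilon> 3 j - G 0 3 \<epsilon> / \<delta> \<epsilon> * z \<epsilon> 2 j"
      for \<epsilon> by (simp_all add: symplectic_rows_def Let_def G_def \<delta>_def)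
    have d2: "((\<lambda>\<epsilon>. symplectic_rows (c \<epsilon>) (z \<epsilon>) 2 j) has_field_derivative \<sigma> 2 j) (at 0)"
      unfolding row2
      using DERIV_diff[OF DERIV_diff[OF product[of 1 3 2] product[of 1 2 3]] product[of 2 3 1]]
      by (simp add: Phi_entries(2))
    have d3: "((\<lambda>\<epsilon>. symplectic_rows (c \<epsilon>) (z \<epsilon>) 3 j) has_field_derivative \<sigma> 3 j) (at 0)"
      unfolding row3 using DERIV_diff[OF product[of 0 2 3] product[of 0 3 2]] by (simp add: Phi_entries(2))
    show ?thesis
    proof (cases "i = 2 \<or> i = 3")
      case True
      then show ?thesis using d2 d3 by auto
    next
      case False
      then have "symplectic_rows (c \<epsilon>) (z \<epsilon>) i j = z \<epsilon> i j" for \<epsilon>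
        by (simp add: symplectic_rows_def)
      then show ?thesis using dz by simp
    qed
  qed
  show ?thesis
  proof (intro exI[of _ \<gamma>] conjI allI impI)
    show "\<gamma> 0 = p" by (simp add: \<gamma>_def data0 Rep_frame_space_inverse)
    show "((\<lambda>\<epsilon>. T2 (\<gamma> \<epsilon>)) has_field_derivative v2) (at 0)"
      by (rule transfer[of T2 "\<lambda>\<epsilon>. T2 p + \<epsilon> * v2"])
        (auto simp: T2_def[of "\<gamma> _"] Rep data_def c_def intro!: derivative_eq_intros)
    show "((\<lambda>\<epsilon>. T3 (\<gamma> \<epsilon>)) has_field_derivative v3) (at 0)"
      by (rule transfer[of T3 "\<lambda>\<epsilon>. T3 p + \<epsilon> * v3"])
        (auto simp: T3_def[of "\<gamma> _"] Rep data_def intro!: derivative_eq_intros)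
    show "((\<lambda>\<epsilon>. T4 (\<gamma> \<epsilon>)) has_field_derivative v4) (at 0)"
      by (rule transfer[of T4 "\<lambda>\<epsilon>. T4 p + \<epsilon> * v4"])
        (auto simp: T4_def[of "\<gamma> _"] Rep data_def intro!: derivative_eq_intros)
    show "((\<lambda>\<epsilon>. T5 (\<gamma> \<epsilon>)) has_field_derivative v5) (at 0)"
      by (rule transfer[of T5 "\<lambda>\<epsilon>. T5 p + \<epsilon> * v5"])
        (auto simp: T5_def[of "\<gamma> _"] Rep data_def intro!: derivative_eq_intros)
    show "((\<lambda>\<epsilon>. S_entry i j (\<gamma> \<epsilon>)) has_field_derivative \<sigma> i j) (at 0)" if "i < 4" "j < 4" for i j
      by (rule transfer[OF _ dS[OF that(1)]]) (simp add: S_entry_def Rep data_def that)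
  qed
qed

text \<open>A vector field along the space of frames with regular components defines a derivation, by
  differentiation along curves. The curves \<open>\<gamma>\<close> are part of the conclusion since they also describe how
  the derivation interacts with the action of \<open>G\<^sub>m\<close>.\<close>

lemma derivation_with_velocity:
  assumes v: "v2 \<in> O_frame" "v3 \<in> O_frame" "v4 \<in> O_frame" "v5 \<in> O_frame"
    and \<sigma>: "\<And>i j. i < 4 \<Longrightarrow> j < 4 \<Longrightarrow> \<sigma> i j \<in> O_frame"
    and block: "\<And>i j p. i \<in> {0, 1} \<Longrightarrow> j \<in> {2, 3} \<Longrightarrow> \<sigma> i j p = 0"
    and tangent: "\<And>i j p. i < 4 \<Longrightarrow> j < 4 \<Longrightarrow>
      pairing (T2 p) (\<lambda>k. \<sigma> i k p) (\<lambda>k. S_entry j k p) + pairing (T2 p) (\<lambda>k. S_entry i k p) (\<lambda>k. \<sigma> j k p)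
      + 4/3 * v2 p * (S_entry i 2 p * S_entry j 3 p - S_entry i 3 p * S_entry j 2 p) = 0"
  obtains w \<gamma> where "w \<in> derivations O_frame" "w T2 = v2" "w T3 = v3" "w T4 = v4" "w T5 = v5"
    "\<forall>i<4. \<forall>j<4. w (S_entry i j) = \<sigma> i j" "\<forall>p. \<gamma> p 0 = p"
    "\<forall>f\<in>O_frame. \<forall>p. ((\<lambda>\<epsilon>. f (\<gamma> p \<epsilon>)) has_field_derivative w f p) (at 0)"
proof -
  have "\<forall>p. \<exists>\<gamma>. \<gamma> 0 = p \<and> ((\<lambda>\<epsilon>. T2 (\<gamma> \<epsilon>)) has_field_derivative v2 p) (at 0) \<and>
    ((\<lambda>\<epsilon>. T3 (\<gamma> \<epsilon>)) has_field_derivative v3 p) (at 0) \<and>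
    ((\<lambda>\<epsilon>. T4 (\<gamma> \<epsilon>)) has_field_derivative v4 p) (at 0) \<and>
    ((\<lambda>\<epsilon>. T5 (\<gamma> \<epsilon>)) has_field_derivative v5 p) (at 0) \<and>
    (\<forall>i<4. \<forall>j<4. ((\<lambda>\<epsilon>. S_entry i j (\<gamma> \<epsilon>)) has_field_derivative \<sigma> i j p) (at 0))"
    by (intro allI velocity_curve block tangent)
  from choice[OF this] obtain \<gamma> where \<gamma>: "\<And>p. \<gamma> p 0 = p"
    "\<And>p. ((\<lambda>\<epsilon>. T2 (\<gamma> p \<epsilon>)) has_field_derivative v2 p) (at 0)"
    "\<And>p. ((\<lambda>\<epsilon>. T3 (\<gamma> p \<epsilon>)) has_field_derivative v3 p) (at 0)"
    "\<And>p. ((\<lambda>\<epsilon>. T4 (\<gamma> p \<epsilon>)) has_field_derivative v4 p) (at 0)"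
    "\<And>p. ((\<lambda>\<epsilon>. T5 (\<gamma> p \<epsilon>)) has_field_derivative v5 p) (at 0)"
    "\<And>p i j. i < 4 \<Longrightarrow> j < 4 \<Longrightarrow> ((\<lambda>\<epsilon>. S_entry i j (\<gamma> p \<epsilon>)) has_field_derivative \<sigma> i j p) (at 0)"
    by auto
  have ex: "\<exists>d\<in>O_frame. \<forall>p. ((\<lambda>\<epsilon>. f (\<gamma> p \<epsilon>)) has_field_derivative d p) (at 0)" if "f \<in> O_frame" for f
  proof (rule derivative_along_curves[OF function_algebra_O_frame _ _ that])
    show "(\<lambda>q. f (\<gamma> q 0)) \<in> O_frame" if "f \<in> O_frame" for f using that by (simp add: \<gamma>(1))
    show "\<exists>d\<in>O_frame. \<forall>q. ((\<lambda>\<epsilon>. h (\<gamma> q \<epsilon>)) has_field_derivative d q) (at 0)" if h: "h \<in> coordinates" for h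
    proof -
      consider "h = T2" | "h = T3" | "h = T4" | "h = T5" | i j where "i < 4" "j < 4" "h = S_entry i j"
        using h unfolding coordinates_def by auto
      then show ?thesis
      proof cases
        case 1 then show ?thesis using \<gamma>(2) v(1) by (intro bexI[of _ v2]) auto
      next
        case 2 then show ?thesis using \<gamma>(3) v(2) by (intro bexI[of _ v3]) auto
      next
        case 3 then show ?thesis using \<gamma>(4) v(3) by (intro bexI[of _ v4]) auto
      next
        case 4 then show ?thesis using \<gamma>(5) v(4) by (intro bexI[of _ v5]) auto
      next
        case 5 then show ?thesis using \<gamma>(6)[OF 5(1,2)] \<sigma>[OF 5(1,2)] by (intro bexI[of _ "\<sigma> i j"]) auto
      qed
    qed
  qed
  \<comment> \<open>Extended by the default value outside the coordinate ring, as derivations are extensional.\<close>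
  define w where "w = restrict (\<lambda>f p. THE d. ((\<lambda>\<epsilon>. f (\<gamma> p \<epsilon>)) has_field_derivative d) (at 0)) O_frame"
  have w_eq: "w f = d" if "f \<in> O_frame" "\<And>p. ((\<lambda>\<epsilon>. f (\<gamma> p \<epsilon>)) has_field_derivative d p) (at 0)" for f d
  proof
    fix p
    have "(THE d. ((\<lambda>\<epsilon>. f (\<gamma> p \<epsilon>)) has_field_derivative d) (at 0)) = d p"
      by (rule the_equality[where P = "\<lambda>d. ((\<lambda>\<epsilon>. f (\<gamma> p \<epsilon>)) has_field_derivative d) (at 0)",
          OF that(2)]) (rule DERIV_unique[OF _ that(2)])
    then show "w f p = d p" using that(1) by (simp add: w_def)
  qed
  have w_deriv: "((\<lambda>\<epsilon>. f (\<gamma> p \<epsilon>)) has_field_derivative w f p) (at 0)" if "f \<in> O_frame" for f p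
    using ex[OF that] w_eq[OF that] by auto
  have w_in: "w f \<in> O_frame" if "f \<in> O_frame" for f
    using ex[OF that] w_eq[OF that] by auto
  have "w \<in> derivations O_frame"
    unfolding derivations_def
  proof (rule CollectI, intro conjI allI ballI)
    show "w \<in> O_frame \<rightarrow>\<^sub>E O_frame" using w_in by (auto simp: w_def)
    show "w (\<lambda>_. c) = 0" for c
      by (rule w_eq) (auto intro: regular_intros(1))
    fix f g assume fg: "f \<in> O_frame" "g \<in> O_frame"
    show "w (f + g) = w f + w g"
      by (rule w_eq) (use regular_intros(2)[OF fg] DERIV_add[OF w_deriv[OF fg(1)] w_deriv[OF fg(2)]]
        in \<open>simp_all add: plus_fun_def\<close>)
    show "w (f * g) = f * w g + g * w f"
    proof (rule w_eq)
      show "f * g \<in> O_frame" using regular_intros(3)[OF fg] by (simp add: times_fun_def)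
      show "((\<lambda>\<epsilon>. (f * g) (\<gamma> p \<epsilon>)) has_field_derivative (f * w g + g * w f) p) (at 0)" for p
        using DERIV_mult[OF w_deriv[OF fg(1)] w_deriv[OF fg(2)], of p] by (simp add: \<gamma>(1) algebra_simps)
    qed
  qed
  then show ?thesis
    by (rule that[of w \<gamma>]) (auto intro!: w_eq w_deriv \<gamma> T_regular S_entry_regular)
qed

section \<open>Lifting vector fields to the family of curves\<close>

context
  fixes w g \<alpha>
  assumes w: "w \<in> derivations O_frame"
    and g: "regular_family g" and \<alpha>: "regular_family \<alpha>"
    and tangent: "\<And>p. [:w T5 p, w T4 p, w T3 p, w T2 p:] + g p * pderiv (fq p) = \<alpha> p * fq p"
begin

text \<open>The derivative of a polynomial \<open>P(x)\<close> along the lift, in which \<open>x\<close> moves with velocity \<open>g\<close>.\<close>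

definition total_derivative :: "(frame_space \<Rightarrow> complex poly) \<Rightarrow> frame_space \<Rightarrow> complex poly" where
  "total_derivative P p = apply_coeffs w P p + g p * pderiv (P p)"

lemma total_derivative_regular: "regular_family P \<Longrightarrow> regular_family (total_derivative P)"
  unfolding total_derivative_def[abs_def]
  by (intro regular_family_intros regular_family_apply_coeffs[OF w] g) auto

lemma total_derivative_add:
  "regular_family P \<Longrightarrow> regular_family Q \<Longrightarrow>
    total_derivative (\<lambda>p. P p + Q p) p = total_derivative P p + total_derivative Q p"
  by (simp add: total_derivative_def apply_coeffs_add[OF w] pderiv_add algebra_simps)

lemma total_derivative_mult:
  "regular_family P \<Longrightarrow> regular_family Q \<Longrightarrow>
    total_derivative (\<lambda>p. P p * Q p) p = P p * total_derivative Q p + Q p * total_derivative P p"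
  by (simp add: total_derivative_def apply_coeffs_mult[OF w] pderiv_mult algebra_simps)

lemma total_derivative_quintic: "total_derivative fq p = \<alpha> p * fq p"
  using tangent[of p] by (simp add: total_derivative_def apply_coeffs_quintic[OF w])

text \<open>The vector field with \<open>x \<mapsto> g\<close> and \<open>y \<mapsto> \<alpha> y / 2\<close>, which respects \<open>y\<^sup>2 = f\<close> by the tangency
  condition. It is written on the parts of a function, where it is visibly well defined.\<close>

definition lifted_derivation :: "(curve_space \<Rightarrow> complex) \<Rightarrow> (curve_space \<Rightarrow> complex)" where
  "lifted_derivation = restrict (\<lambda>c. fiber_fun (total_derivative (even_part c))
     (\<lambda>p. total_derivative (odd_part c) p + smult (1/2) (\<alpha> p * odd_part c p))) O_curve"

lemma lifted_derivation_fiber_fun: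
  "regular_family P \<Longrightarrow> regular_family Q \<Longrightarrow> lifted_derivation (fiber_fun P Q) =
    fiber_fun (total_derivative P) (\<lambda>p. total_derivative Q p + smult (1/2) (\<alpha> p * Q p))"
  by (simp add: lifted_derivation_def fiber_fun_in)

lemma lifted_derivation_base: "r \<in> O_frame \<Longrightarrow> lifted_derivation (r \<circ> proj) = w r \<circ> proj"
proof -
  assume r: "r \<in> O_frame"
  have "lifted_derivation (fiber_fun (\<lambda>p. [:r p:]) (\<lambda>_. 0)) = fiber_fun (\<lambda>p. [:w r p:]) (\<lambda>_. 0)"
    unfolding lifted_derivation_fiber_fun[OF regular_family_const[OF r] regular_family_fixed]
    by (rule fiber_fun_cong)
      (simp_all add: total_derivative_def apply_coeffs_const[OF w r] apply_coeffs_fixed[OF w] pderiv_pCons)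
  then show "lifted_derivation (r \<circ> proj) = w r \<circ> proj" by (simp only: base_fiber[symmetric] o_def)
qed

lemma lifted_derivation_x: "lifted_derivation x_coord = fiber_fun g (\<lambda>_. 0)"
  unfolding x_coord_fiber lifted_derivation_fiber_fun[OF regular_family_fixed regular_family_fixed]
  by (rule fiber_fun_cong) (simp_all add: total_derivative_def apply_coeffs_fixed[OF w] pderiv_pCons)

lemma lifted_derivation_y: "lifted_derivation y_coord = fiber_fun (\<lambda>_. 0) (\<lambda>p. smult (1/2) (\<alpha> p))"
  unfolding y_coord_fiber lifted_derivation_fiber_fun[OF regular_family_fixed regular_family_fixed]
  by (rule fiber_fun_cong) (simp_all add: total_derivative_def apply_coeffs_fixed[OF w])

lemma lifted_derivation_in_derivations: "lifted_derivation \<in> derivations O_curve"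
  unfolding derivations_def
proof (rule CollectI, intro conjI allI ballI)
  have "lifted_derivation c \<in> O_curve" if "c \<in> O_curve" for c
  proof (rule O_curve_cases[OF that])
    fix P Q assume "regular_family P" "regular_family Q" "c = fiber_fun P Q"
    then show "lifted_derivation c \<in> O_curve"
      by (simp only: lifted_derivation_fiber_fun)
        (intro fiber_fun_in total_derivative_regular regular_family_add regular_family_smult_const
          regular_family_mult \<alpha>)
  qed
  then show "lifted_derivation \<in> O_curve \<rightarrow>\<^sub>E O_curve" by (auto simp: lifted_derivation_def)
  show "lifted_derivation (\<lambda>_. k) = 0" for k
    using lifted_derivation_base[OF regular_intros(1)[of k]] derivation_constant[OF w, of k]
    by (simp add: o_def zero_fun_def)
  fix c c' assume "c \<in> O_curve" "c' \<in> O_curve"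
  obtain P Q where c: "regular_family P" "regular_family Q" "c = fiber_fun P Q"
    by (rule O_curve_cases[OF \<open>c \<in> O_curve\<close>])
  obtain P' Q' where c': "regular_family P'" "regular_family Q'" "c' = fiber_fun P' Q'"
    by (rule O_curve_cases[OF \<open>c' \<in> O_curve\<close>])
  note reg = c(1,2) c'(1,2) regular_family_add regular_family_mult regular_family_quintic
  show "lifted_derivation (c + c') = lifted_derivation c + lifted_derivation c'"
    unfolding c(3) c'(3) fiber_fun_plus
    by (simp only: lifted_derivation_fiber_fun reg fiber_fun_plus, rule fiber_fun_cong;
        simp add: total_derivative_add reg algebra_simps smult_add_right)
  have half: "smult (1/2) r + smult (1/2) r = r" for r :: "complex poly"
    by (simp flip: smult_add_left)
  show "lifted_derivation (c * c') = c * lifted_derivation c' + c' * lifted_derivation c"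
    unfolding c(3) c'(3) fiber_fun_times
    unfolding lifted_derivation_fiber_fun[OF c(1,2)] lifted_derivation_fiber_fun[OF c'(1,2)]
      lifted_derivation_fiber_fun[OF regular_family_add[OF regular_family_mult[OF c(1) c'(1)]
          regular_family_mult[OF regular_family_mult[OF c(2) c'(2)] regular_family_quintic]]
        regular_family_add[OF regular_family_mult[OF c(1) c'(2)] regular_family_mult[OF c(2) c'(1)]]]
      fiber_fun_times fiber_fun_plus
  proof (rule fiber_fun_cong)
    fix p
    show "total_derivative (\<lambda>p. P p * P' p + Q p * Q' p * fq p) p =
        (P p * total_derivative P' p + Q p * (total_derivative Q' p + smult (1/2) (\<alpha> p * Q' p)) * fq p) +
        (P' p * total_derivative P p + Q' p * (total_derivative Q p + smult (1/2) (\<alpha> p * Q p)) * fq p)"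
      using half[of "\<alpha> p * Q p * Q' p * fq p"]
      by (simp add: total_derivative_add total_derivative_mult reg total_derivative_quintic algebra_simps)
    show "total_derivative (\<lambda>p. P p * Q' p + Q p * P' p) p + smult (1/2) (\<alpha> p * (P p * Q' p + Q p * P' p)) =
        (P p * (total_derivative Q' p + smult (1/2) (\<alpha> p * Q' p)) + Q p * total_derivative P' p) +
        (P' p * (total_derivative Q p + smult (1/2) (\<alpha> p * Q p)) + Q' p * total_derivative P p)"
      by (simp add: total_derivative_add total_derivative_mult reg algebra_simps smult_add_right)
  qed
qed

text \<open>Here \<open>[V, D]\<close> is \<open>\<alpha>/2 - g'\<close> times \<open>D\<close>, which is seen by applying it to \<open>x\<close>; so \<open>\<nabla>\<^sub>w\<close> sends the class of
  \<open>P(x)\<close> to that of \<open>P\<^sub>w + (P g)' - \<alpha> P / 2\<close>.\<close>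

lemma gauss_manin_lift:
  assumes \<phi>: "\<phi> \<in> forms" "\<kappa> \<phi> = horner rs" "set rs \<subseteq> O_frame"
    and \<psi>: "\<psi> \<in> forms" "\<kappa> \<psi> = fiber_fun N (\<lambda>_. 0)"
    and Q: "regular_family Q"
    and eq: "\<And>p. Poly (map (\<lambda>r. w r p) rs) + pderiv (Poly (map (\<lambda>r. r p) rs) * g p)
        - smult (1/2) (\<alpha> p * Poly (map (\<lambda>r. r p) rs))
      = N p + (pderiv (Q p) * fq p + smult (1/2) (Q p * pderiv (fq p)))"
  shows "gauss_manin proj O_frame O_curve w \<phi> \<psi>"
proof -
  obtain \<mu> where \<mu>: "\<mu> \<in> O_curve" "\<And>c. c \<in> O_curve \<Longrightarrow> lifted_derivation (\<D> c) - \<D> (lifted_derivation c) = \<mu> * \<D> c"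
    by (rule commutator_multiple[OF lifted_derivation_in_derivations exI[of _ "w _"]]) (auto simp: lifted_derivation_base)
  obtain M0 M1 where M: "\<mu> = fiber_fun M0 M1" by (rule O_curve_cases[OF \<mu>(1)])
  have "lifted_derivation y_coord - \<D> (lifted_derivation x_coord) = \<mu> * y_coord" using \<mu>(2)[OF x_coord_in] by (simp only: vertical_x)
  then have "lifted_derivation y_coord = \<mu> * y_coord + \<D> (lifted_derivation x_coord)" by (simp only: diff_eq_eq)
  then have "fiber_fun (\<lambda>_. 0) (\<lambda>p. smult (1/2) (\<alpha> p)) = fiber_fun (\<lambda>p. M1 p * fq p) (\<lambda>p. M0 p + pderiv (g p))"
    unfolding lifted_derivation_x lifted_derivation_y M unfolding y_coord_fiber vertical_fiber_fun fiber_fun_times fiber_fun_plus by simp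
  note parts = fiber_fun_inject[OF this]
  have M1: "M1 p = 0" for p
    using fun_cong[OF parts(1), of p] degree_quintic[of "Rep_frame_space p"] by auto
  have M0: "M0 p = smult (1/2) (\<alpha> p) - pderiv (g p)" for p
    using fun_cong[OF parts(2), of p] by simp
  have "lifted_derivation (\<kappa> \<phi>) = horner (map w rs) + horner' rs * lifted_derivation x_coord"
    unfolding \<phi>(2) by (rule derivation_horner[OF lifted_derivation_in_derivations _ \<phi>(3)]) (rule lifted_derivation_base)
  then have "lifted_derivation (\<kappa> \<phi>) - \<mu> * \<kappa> \<phi> =
     fiber_fun (\<lambda>p. Poly (map (\<lambda>r. r p) (map w rs)) + pderiv (Poly (map (\<lambda>r. r p) rs)) * g p
       - M0 p * Poly (map (\<lambda>r. r p) rs)) (\<lambda>_. 0)"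
    unfolding \<phi>(2) lifted_derivation_x M horner_fiber fiber_fun_times fiber_fun_plus
    by (simp add: fun_eq_iff fiber_fun_def M1)
  also have "\<dots> = fiber_fun N (\<lambda>_. 0) + \<D> (fiber_fun (\<lambda>_. 0) Q)"
    unfolding vertical_fiber_fun fiber_fun_plus
  proof (rule fiber_fun_cong)
    fix p
    show "Poly (map (\<lambda>r. r p) (map w rs)) + pderiv (Poly (map (\<lambda>r. r p) rs)) * g p
       - M0 p * Poly (map (\<lambda>r. r p) rs) = N p + (pderiv (Q p) * fq p + smult (1/2) (Q p * pderiv (fq p)))"
      unfolding eq[of p, symmetric] M0 by (simp add: pderiv_mult o_def algebra_simps)
  qed simp
  finally have e: "lifted_derivation (\<kappa> \<phi>) - \<mu> * \<kappa> \<phi> - \<kappa> \<psi> = \<D> (fiber_fun (\<lambda>_. 0) Q)"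
    unfolding \<psi>(2) by simp
  have "\<kappa> (lie_derivative lifted_derivation \<phi>) - \<kappa> \<psi> = \<D> (fiber_fun (\<lambda>_. 0) Q)"
    using lie_derivative_coefficient[OF lifted_derivation_in_derivations \<phi>(1) \<mu>(2)] e by simp
  then have "H1_dR_eq base_ring O_curve (lie_derivative lifted_derivation \<phi>) \<psi>"
    unfolding H1_dR_eq_iff
    by (intro conjI bexI[of _ "fiber_fun (\<lambda>_. 0) Q"] lie_derivative_form[OF lifted_derivation_in_derivations] \<phi>(1) \<psi>(1)
        fiber_fun_in regular_family_fixed Q)
  then show ?thesis
    unfolding gauss_manin_def using \<phi>(1) lifted_derivation_in_derivations lifted_derivation_base by (intro conjI bexI[of _ lifted_derivation] ballI) auto
qed

end

section \<open>The connection matrix\<close>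

text \<open>In this part the letters \<open>u\<^sub>i\<close> stand for the values of \<open>t\<^sub>i\<close>, and
  \<open>g = g\<^sub>0 + g\<^sub>2x\<^sup>2 + g\<^sub>3x\<^sup>3 + g\<^sub>4x\<^sup>4\<close>, \<open>\<alpha> = a\<^sub>0 + a\<^sub>1x + 5g\<^sub>3x\<^sup>2 + 5g\<^sub>4x\<^sup>3\<close>. The coefficients
  \<open>a\<^sub>0\<close>, \<open>a\<^sub>1\<close> and \<open>g\<^sub>0\<close> are determined by the requirement that \<open>\<alpha> f - g f'\<close> has degree at most 3.\<close>

definition gm_a0 :: "complex \<Rightarrow> complex \<Rightarrow> complex \<Rightarrow> complex \<Rightarrow> complex" where
  "gm_a0 u2 u3 g3 g4 = - 2 * u2 * g3 - 3 * u3 * g4"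

definition gm_a1 :: "complex \<Rightarrow> complex \<Rightarrow> complex \<Rightarrow> complex" where
  "gm_a1 u2 g2 g4 = 5 * g2 - 2 * u2 * g4"

definition gm_g0 :: "complex \<Rightarrow> complex \<Rightarrow> complex \<Rightarrow> complex \<Rightarrow> complex \<Rightarrow> complex \<Rightarrow> complex" where
  "gm_g0 u2 u3 u4 g2 g3 g4 = (2 * u2 * g2 - 2 * u2 ^ 2 * g4 + 3 * u3 * g3 + 4 * u4 * g4) / 5"

text \<open>The velocity of \<open>t\<^sub>n\<close>: the coefficient of \<open>x\<^sup>5\<^sup>-\<^sup>n\<close> in \<open>\<alpha> f - g f'\<close>.\<close>

definition velocity :: "complex \<Rightarrow> complex \<Rightarrow> complex \<Rightarrow> complex \<Rightarrow> complex \<Rightarrow> complex \<Rightarrow> complex \<Rightarrow> nat \<Rightarrow> complex" where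
  "velocity u2 u3 u4 u5 g2 g3 g4 n = (let a0 = gm_a0 u2 u3 g3 g4; a1 = gm_a1 u2 g2 g4;
      g0 = gm_g0 u2 u3 u4 g2 g3 g4 in
     if n = 2 then a0 * u2 + a1 * u3 + 5 * g3 * u4 + 5 * g4 * u5 - g3 * u4 - 2 * u3 * g2
     else if n = 3 then a0 * u3 + a1 * u4 + 5 * g3 * u5 - g2 * u4 - 3 * u2 * g0
     else if n = 4 then a0 * u4 + a1 * u5 - 2 * u3 * g0
     else a0 * u5 - g0 * u4)"

text \<open>The matrix \<open>A\<close> with \<open>\<nabla> \<omega>\<^sub>j = \<Sum>k. A\<^sub>j\<^sub>k \<omega>\<^sub>k\<close>, obtained by reducing \<open>(x\<^sup>j g)' - \<alpha> x\<^sup>j / 2\<close> to degree 3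
  with the exact forms \<open>d(x\<^sup>m y)\<close>, \<open>m = 0, 1, 2\<close>.\<close>

definition gm_matrix :: "complex \<Rightarrow> complex \<Rightarrow> complex \<Rightarrow> complex \<Rightarrow> complex \<Rightarrow> complex \<Rightarrow> complex \<Rightarrow> nat \<Rightarrow> nat \<Rightarrow> complex" where
  "gm_matrix u2 u3 u4 u5 g2 g3 g4 j k = (let a0 = gm_a0 u2 u3 g3 g4; a1 = gm_a1 u2 g2 g4;
      g0 = gm_g0 u2 u3 u4 g2 g3 g4; h = g2 - u2 * g4 in
     [[- a0 / 2, 2 * g2 - a1 / 2, 1/2 * g3, 3/2 * g4],
      [g0 - 1/2 * (g4 * u4), - a0 / 2 - g4 * u3, 3 * g2 - a1 / 2 - 3/2 * (g4 * u2), 3/2 * g3],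
      [- (g4 * u5) - 1/2 * (g3 * u4), 2 * g0 - 3/2 * (g4 * u4) - g3 * u3,
        - a0 / 2 - 2 * (g4 * u3) - 3/2 * (g3 * u2), 4 * g2 - a1 / 2 - 5/2 * (g4 * u2)],
      [- (g3 * u5) - 1/2 * (h * u4), - 2 * (g4 * u5) - 3/2 * (g3 * u4) - h * u3,
        3 * g0 - 5/2 * (g4 * u4) - 2 * (g3 * u3) - 3/2 * (h * u2),
        - a0 / 2 - 3 * (g4 * u3) - 5/2 * (g3 * u2)]] ! j ! k)"

lemma tangent_lift:
  "[:velocity u2 u3 u4 u5 g2 g3 g4 5, velocity u2 u3 u4 u5 g2 g3 g4 4,
     velocity u2 u3 u4 u5 g2 g3 g4 3, velocity u2 u3 u4 u5 g2 g3 g4 2:]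
   + [:gm_g0 u2 u3 u4 g2 g3 g4, 0, g2, g3, g4:] * pderiv [:u5, u4, u3, u2, 0, 1:] =
   [:gm_a0 u2 u3 g3 g4, gm_a1 u2 g2 g4, 5 * g3, 5 * g4:] * [:u5, u4, u3, u2, 0, 1:]"
  unfolding pderiv_monic_quintic
  by (simp add: velocity_def Let_def gm_a0_def gm_a1_def gm_g0_def field_simps power2_eq_square)

text \<open>The reduction of \<open>x\<^sup>j\<close> subtracts \<open>d(q\<^sub>j y)\<close>, where \<open>q\<^sub>j\<close> is the polynomial part of
  \<open>g\<^sub>4x\<^sup>j\<^sup>-\<^sup>1 + g\<^sub>3x\<^sup>j\<^sup>-\<^sup>2 + (g\<^sub>2 - t\<^sub>2g\<^sub>4)x\<^sup>j\<^sup>-\<^sup>3\<close>; \<open>q\<close> is the linear combination of these with the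
  coefficients \<open>s\<^sub>j\<close>.\<close>

lemma gauss_manin_reduction:
  fixes u2 u3 u4 u5 g2 g3 g4 s0 s1 s2 s3 :: complex
  defines "A \<equiv> gm_matrix u2 u3 u4 u5 g2 g3 g4" and "f \<equiv> [:u5, u4, u3, u2, 0, 1:]"
  defines "\<alpha> \<equiv> [:gm_a0 u2 u3 g3 g4, gm_a1 u2 g2 g4, 5 * g3, 5 * g4:]"
  defines "g \<equiv> [:gm_g0 u2 u3 u4 g2 g3 g4, 0, g2, g3, g4:]"
  defines "q \<equiv> [:s1 * g4 + s2 * g3 + s3 * (g2 - u2 * g4), s2 * g4 + s3 * g3, s3 * g4:]"
  shows "pderiv ([:s0, s1, s2, s3:] * g) - smult (1/2) (\<alpha> * [:s0, s1, s2, s3:]) =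
    [:s0 * A 0 0 + s1 * A 1 0 + s2 * A 2 0 + s3 * A 3 0, s0 * A 0 1 + s1 * A 1 1 + s2 * A 2 1 + s3 * A 3 1,
      s0 * A 0 2 + s1 * A 1 2 + s2 * A 2 2 + s3 * A 3 2, s0 * A 0 3 + s1 * A 1 3 + s2 * A 2 3 + s3 * A 3 3:]
    + (pderiv q * f + smult (1/2) (q * pderiv f))"
  unfolding f_def pderiv_monic_quintic
  by (simp add: A_def \<alpha>_def g_def q_def gm_matrix_def Let_def gm_a0_def gm_a1_def pderiv_pCons field_simps)

text \<open>The row vector \<open>x \<Omega>\<close>.\<close>

definition pairing_covector :: "complex \<Rightarrow> (nat \<Rightarrow> complex) \<Rightarrow> nat \<Rightarrow> complex" where
  "pairing_covector c x k = [- (4/3 * x 3), - (4 * x 2), 4 * x 1 - 4/3 * c * x 3, 4/3 * x 0 + 4/3 * c * x 2] ! k"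

lemma pairing_connection:
  fixes A :: "nat \<Rightarrow> nat \<Rightarrow> complex" and c :: complex
  defines "P \<equiv> \<lambda>i k. pairing_covector c (A i) k - pairing_covector c (A k) i"
  shows "pairing c (\<lambda>k. r 0 * A 0 k + r 1 * A 1 k + r 2 * A 2 k + r 3 * A 3 k) s
    + pairing c r (\<lambda>k. s 0 * A 0 k + s 1 * A 1 k + s 2 * A 2 k + s 3 * A 3 k) =
    (r 0 * s 1 - r 1 * s 0) * P 0 1 + (r 0 * s 2 - r 2 * s 0) * P 0 2 + (r 0 * s 3 - r 3 * s 0) * P 0 3
    + (r 1 * s 2 - r 2 * s 1) * P 1 2 + (r 1 * s 3 - r 3 * s 1) * P 1 3 + (r 2 * s 3 - r 3 * s 2) * P 2 3"
proof -
  define t :: complex where "t = 4/3"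
  show ?thesis
    unfolding P_def pairing_covector_def pairing_def t_def[symmetric] by (simp add: algebra_simps)
qed

text \<open>Compatibility of the connection with the pairing, \<open>A \<Omega> + \<Omega> A\<^sup>t\<^sup>r = d\<Omega>\<close>. Both sides are antisymmetric, so
  this amounts to six identities.\<close>

lemma gm_matrix_pairing:
  fixes u2 u3 u4 u5 g2 g3 g4 :: complex
  defines "A \<equiv> gm_matrix u2 u3 u4 u5 g2 g3 g4"
  shows "pairing u2 (\<lambda>k. r 0 * A 0 k + r 1 * A 1 k + r 2 * A 2 k + r 3 * A 3 k) s
    + pairing u2 r (\<lambda>k. s 0 * A 0 k + s 1 * A 1 k + s 2 * A 2 k + s 3 * A 3 k)
    = 4/3 * velocity u2 u3 u4 u5 g2 g3 g4 2 * (r 2 * s 3 - r 3 * s 2)"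
proof -
  let ?P = "\<lambda>i k. pairing_covector u2 (A i) k - pairing_covector u2 (A k) i"
  have "?P 0 1 = 0" "?P 0 2 = 0" "?P 0 3 = 0" "?P 1 2 = 0" "?P 1 3 = 0"
    "?P 2 3 = 4/3 * velocity u2 u3 u4 u5 g2 g3 g4 2"
    by (simp_all add: A_def pairing_covector_def velocity_def gm_matrix_def Let_def
        gm_a0_def gm_a1_def gm_g0_def field_simps power2_eq_square)
  then show ?thesis unfolding pairing_connection by simp
qed

context
  fixes a :: complex
  assumes a: "a \<noteq> 0"
begin

text \<open>Here \<open>t\<^sub>i\<close> has weight \<open>-2i\<close> and \<open>g\<^sub>n\<close> has weight \<open>2n - 2\<close>.\<close>

lemma gm_coefficients_homogeneous:
  "gm_a0 (u2 / a ^ 4) (u3 / a ^ 6) (a ^ 4 * g3) (a ^ 6 * g4) = gm_a0 u2 u3 g3 g4"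
  "gm_a1 (u2 / a ^ 4) (a ^ 2 * g2) (a ^ 6 * g4) = a ^ 2 * gm_a1 u2 g2 g4"
  "gm_g0 (u2 / a ^ 4) (u3 / a ^ 6) (u4 / a ^ 8) (a ^ 2 * g2) (a ^ 4 * g3) (a ^ 6 * g4) =
    gm_g0 u2 u3 u4 g2 g3 g4 / a ^ 2"
  "a ^ 2 * g2 - u2 / a ^ 4 * (a ^ 6 * g4) = a ^ 2 * (g2 - u2 * g4)"
  using a by (simp_all add: gm_a0_def gm_a1_def gm_g0_def field_simps eval_nat_numeral)

lemma velocity_homogeneous:
  assumes "n \<in> {2, 3, 4, 5}"
  shows "velocity (u2 / a ^ 4) (u3 / a ^ 6) (u4 / a ^ 8) (u5 / a ^ 10) (a ^ 2 * g2) (a ^ 4 * g3) (a ^ 6 * g4) n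
    = velocity u2 u3 u4 u5 g2 g3 g4 n / a ^ (2 * n)"
  using assms unfolding velocity_def Let_def gm_coefficients_homogeneous
  by (elim insertE emptyE) (use a in \<open>simp_all add: field_simps eval_nat_numeral\<close>)

lemma gm_monomials_homogeneous:
  "a ^ 6 * g4 * (u5 / a ^ 10) = g4 * u5 / a ^ 4" "a ^ 6 * g4 * (u4 / a ^ 8) = g4 * u4 / a ^ 2"
  "a ^ 6 * g4 * (u3 / a ^ 6) = g4 * u3" "a ^ 6 * g4 * (u2 / a ^ 4) = a ^ 2 * (g4 * u2)"
  "a ^ 4 * g3 * (u5 / a ^ 10) = g3 * u5 / a ^ 6" "a ^ 4 * g3 * (u4 / a ^ 8) = g3 * u4 / a ^ 4"
  "a ^ 4 * g3 * (u3 / a ^ 6) = g3 * u3 / a ^ 2" "a ^ 4 * g3 * (u2 / a ^ 4) = g3 * u2"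
  "a ^ 2 * h * (u4 / a ^ 8) = h * u4 / a ^ 6" "a ^ 2 * h * (u3 / a ^ 6) = h * u3 / a ^ 4"
  "a ^ 2 * h * (u2 / a ^ 4) = h * u2 / a ^ 2"
  using a by (simp_all add: field_simps eval_nat_numeral)

lemma gm_matrix_homogeneous:
  assumes "j < 4" "k < 4"
  shows "gm_matrix (u2 / a ^ 4) (u3 / a ^ 6) (u4 / a ^ 8) (u5 / a ^ 10) (a ^ 2 * g2) (a ^ 4 * g3) (a ^ 6 * g4) j k
    = gm_matrix u2 u3 u4 u5 g2 g3 g4 j k * a ^ (2 * k) / a ^ (2 * j)"
  using assms
  unfolding less_4_cases gm_matrix_def Let_def gm_coefficients_homogeneous gm_monomials_homogeneous
  by (elim disjE) (use a in \<open>simp_all add: field_simps eval_nat_numeral\<close>)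

end

section \<open>The vector fields on the space of frames\<close>

context
  fixes e1 e2 e3 :: complex
begin

text \<open>The symmetric matrix \<open>S\<^sub>2\<^sub>2\<^sup>t\<^sup>r C S\<^sub>2\<^sub>2\<close>, where \<open>S\<^sub>2\<^sub>2\<close> is the lower right block of \<open>S\<close>
  and \<open>C\<close> has diagonal \<open>e\<^sub>1, e\<^sub>2\<close> and off-diagonal entry \<open>e\<^sub>3\<close>. Indices are those of the columns of \<open>S\<close>,
  2 and 3.\<close>

definition gram :: "nat \<Rightarrow> nat \<Rightarrow> frame_space \<Rightarrow> complex" where
  "gram j k p = e1 * S_entry 2 j p * S_entry 2 k p
     + e3 * (S_entry 2 j p * S_entry 3 k p + S_entry 3 j p * S_entry 2 k p)
     + e2 * S_entry 3 j p * S_entry 3 k p"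

text \<open>The coefficients of \<open>g\<close>, found by solving \<open>S\<^sub>1\<^sub>1 A\<^sub>1\<^sub>2 = C S\<^sub>2\<^sub>2\<close> for the upper right block \<open>A\<^sub>1\<^sub>2\<close> of the
  connection matrix.\<close>

definition G4 :: "frame_space \<Rightarrow> complex" where "G4 p = 8/9 * gram 3 3 p"
definition G3 :: "frame_space \<Rightarrow> complex" where "G3 p = 8/3 * gram 2 3 p"
definition G2 :: "frame_space \<Rightarrow> complex" where "G2 p = 8 * gram 2 2 p + T2 p * G4 p"

definition base_velocity :: "nat \<Rightarrow> frame_space \<Rightarrow> complex" where
  "base_velocity n p = velocity (T2 p) (T3 p) (T4 p) (T5 p) (G2 p) (G3 p) (G4 p) n"

definition connection_entry :: "nat \<Rightarrow> nat \<Rightarrow> frame_space \<Rightarrow> complex" where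
  "connection_entry j k p = gm_matrix (T2 p) (T3 p) (T4 p) (T5 p) (G2 p) (G3 p) (G4 p) j k"

text \<open>The rows of \<open>M S\<close>, where \<open>M\<close> has upper right block \<open>C\<close> and is zero elsewhere.\<close>

definition target_row :: "nat \<Rightarrow> nat \<Rightarrow> frame_space \<Rightarrow> complex" where
  "target_row i k p = (if i = 0 then e1 * S_entry 2 k p + e3 * S_entry 3 k p
     else if i = 1 then e3 * S_entry 2 k p + e2 * S_entry 3 k p else 0)"

text \<open>The velocity \<open>M S - S A\<close>, forced by \<open>\<nabla>(S \<omega>) = M S \<omega>\<close>.\<close>

definition frame_velocity :: "nat \<Rightarrow> nat \<Rightarrow> frame_space \<Rightarrow> complex" where
  "frame_velocity i k p = target_row i k p
     - (S_entry i 0 p * connection_entry 0 k p + S_entry i 1 p * connection_entry 1 k p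
        + S_entry i 2 p * connection_entry 2 k p + S_entry i 3 p * connection_entry 3 k p)"

lemma gram_regular: "j < 4 \<Longrightarrow> k < 4 \<Longrightarrow> gram j k \<in> O_frame"
  unfolding gram_def[abs_def] by (intro regular_intros S_entry_regular) auto

lemma G_regular: "G2 \<in> O_frame" "G3 \<in> O_frame" "G4 \<in> O_frame"
proof -
  show "G4 \<in> O_frame" unfolding G4_def[abs_def] by (intro regular_intros gram_regular) auto
  then show "G2 \<in> O_frame" unfolding G2_def[abs_def] by (intro regular_intros gram_regular T_regular) auto
  show "G3 \<in> O_frame" unfolding G3_def[abs_def] by (intro regular_intros gram_regular) auto
qed

lemma gm_coefficients_regular:
  "(\<lambda>p. gm_a0 (T2 p) (T3 p) (G3 p) (G4 p)) \<in> O_frame"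
  "(\<lambda>p. gm_a1 (T2 p) (G2 p) (G4 p)) \<in> O_frame"
  "(\<lambda>p. gm_g0 (T2 p) (T3 p) (T4 p) (G2 p) (G3 p) (G4 p)) \<in> O_frame"
  unfolding gm_a0_def gm_a1_def gm_g0_def by (intro regular_intros T_regular G_regular)+

lemma base_velocity_regular: "base_velocity n \<in> O_frame"
  unfolding base_velocity_def[abs_def] velocity_def Let_def
  by (intro function_algebra_if[OF function_algebra_O_frame] regular_intros T_regular G_regular
      gm_coefficients_regular)

lemma connection_entry_regular: "j < 4 \<Longrightarrow> k < 4 \<Longrightarrow> connection_entry j k \<in> O_frame"
  unfolding connection_entry_def[abs_def] gm_matrix_def Let_def less_4_cases
  by (elim disjE; simp; intro regular_intros T_regular G_regular gm_coefficients_regular)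

lemma target_row_regular: "k < 4 \<Longrightarrow> target_row i k \<in> O_frame"
  unfolding target_row_def[abs_def] 
  by (intro function_algebra_if[OF function_algebra_O_frame] regular_intros S_entry_regular) auto

lemma frame_velocity_regular: "i < 4 \<Longrightarrow> k < 4 \<Longrightarrow> frame_velocity i k \<in> O_frame"
  unfolding frame_velocity_def[abs_def]
  by (intro regular_intros S_entry_regular connection_entry_regular target_row_regular) auto

lemma holomorphic_connection_entries:
  "connection_entry 0 2 p = 4/3 * gram 2 3 p" "connection_entry 1 2 p = 4 * gram 2 2 p"
  "connection_entry 0 3 p = 4/3 * gram 3 3 p" "connection_entry 1 3 p = 4 * gram 2 3 p"
  by (simp_all add: connection_entry_def gm_matrix_def Let_def G2_def G3_def G4_def gm_a1_def field_simps)

text \<open>By the equations between the blocks of \<open>S\<close>, the product \<open>S\<^sub>1\<^sub>1 A\<^sub>1\<^sub>2\<close> collapses to \<open>C S\<^sub>2\<^sub>2\<close>.\<close>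

lemma frame_velocity_block:
  assumes "i \<in> {0, 1}" "k \<in> {2, 3}"
  shows "frame_velocity i k p = 0"
proof -
  let ?m = "\<lambda>k. e1 * S_entry 2 k p + e3 * S_entry 3 k p" and ?n = "\<lambda>k. e3 * S_entry 2 k p + e2 * S_entry 3 k p"
  have row2: "S_entry i 0 p * (4/3 * gram 2 3 p) + S_entry i 1 p * (4 * gram 2 2 p) =
     ?m 2 * (4/3 * (S_entry i 0 p * S_entry 2 3 p) + 4 * (S_entry i 1 p * S_entry 2 2 p))
     + ?n 2 * (4/3 * (S_entry i 0 p * S_entry 3 3 p) + 4 * (S_entry i 1 p * S_entry 3 2 p))" for i
    by (simp add: gram_def field_simps)
  have row3: "S_entry i 0 p * (4/3 * gram 3 3 p) + S_entry i 1 p * (4 * gram 2 3 p) =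
     ?m 3 * (4/3 * (S_entry i 0 p * S_entry 2 3 p) + 4 * (S_entry i 1 p * S_entry 2 2 p))
     + ?n 3 * (4/3 * (S_entry i 0 p * S_entry 3 3 p) + 4 * (S_entry i 1 p * S_entry 3 2 p))" for i
    by (simp add: gram_def field_simps)
  have zero: "S_entry i 2 p = 0" "S_entry i 3 p = 0" using S_entry_block[OF assms(1)] by auto
  have "frame_velocity i k p = target_row i k p - (S_entry i 0 p * connection_entry 0 k p + S_entry i 1 p * connection_entry 1 k p)"
    by (simp add: frame_velocity_def zero)
  also have "\<dots> = 0"
    using assms
    by (elim insertE emptyE; simp only: holomorphic_connection_entries row2 row3 block_equations;
        simp add: target_row_def)
  finally show ?thesis .
qed

lemma pairing_difference:
  "pairing c (\<lambda>k. r k - r' k) s = pairing c r s - pairing c r' s"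
  "pairing c s (\<lambda>k. r k - r' k) = pairing c s r - pairing c s r'"
  by (simp_all add: pairing_def algebra_simps)

lemma target_row_pairing:
  assumes "i < 4" "j < 4"
  shows "pairing (T2 p) (\<lambda>k. target_row i k p) (\<lambda>k. S_entry j k p)
    + pairing (T2 p) (\<lambda>k. S_entry i k p) (\<lambda>k. target_row j k p) = 0"
proof -
  have zero: "pairing c (\<lambda>k. 0) r = 0" "pairing c r (\<lambda>k. 0) = 0" for c r by (simp_all add: pairing_def)
  show ?thesis
    using assms unfolding less_4_cases
    by (elim disjE; simp only: target_row_def;
        simp add: pairing_linear frame_pairing Phi_entries(2) zero)
qed

text \<open>The contribution of \<open>M S\<close> vanishes as \<open>M\<close> lies in the symplectic Lie algebra, \<open>C\<close> being symmetric;
  that of \<open>S A\<close> cancels against the derivative of \<open>\<Omega>\<close> because the connection respects the pairing.\<close>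

lemma velocity_tangent:
  assumes ij: "i < 4" "j < 4"
  shows "pairing (T2 p) (\<lambda>k. frame_velocity i k p) (\<lambda>k. S_entry j k p)
      + pairing (T2 p) (\<lambda>k. S_entry i k p) (\<lambda>k. frame_velocity j k p)
      + 4/3 * base_velocity 2 p * (S_entry i 2 p * S_entry j 3 p - S_entry i 3 p * S_entry j 2 p) = 0"
  using target_row_pairing[OF ij, of p]
    gm_matrix_pairing[of "T2 p" "\<lambda>k. S_entry i k p" "T3 p" "T4 p" "T5 p" "G2 p" "G3 p" "G4 p" "\<lambda>k. S_entry j k p"]
  unfolding frame_velocity_def pairing_difference base_velocity_def connection_entry_def
  by (simp add: algebra_simps)

lemma powi_odd_weight: "a \<noteq> 0 \<Longrightarrow> a powi (2 * int j - 3) = a ^ (2 * j) / a ^ 3" for a :: complex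
proof -
  assume "a \<noteq> 0"
  have "2 * int j = int (2 * j)" by simp
  then have "a powi (2 * int j) = a ^ (2 * j)" by (simp only: power_int_of_nat)
  then show ?thesis using power_int_diff[of a "2 * int j" 3] \<open>a \<noteq> 0\<close> by simp
qed

context
  fixes a :: complex assumes a: "a \<noteq> 0"
begin

lemma scaled_T:
  "T2 (scaled a p) = T2 p / a ^ 4" "T3 (scaled a p) = T3 p / a ^ 6"
  "T4 (scaled a p) = T4 p / a ^ 8" "T5 (scaled a p) = T5 p / a ^ 10"
  by (simp_all add: scaled_coordinates[OF a] powi_weights)

lemma scaled_S: "i < 4 \<Longrightarrow> j < 4 \<Longrightarrow> S_entry i j (scaled a p) = a ^ (2 * j) / a ^ 3 * S_entry i j p"
  by (simp add: scaled_coordinates(5)[OF a] powi_odd_weight[OF a])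

lemma gram_scaled:
  "gram 2 2 (scaled a p) = a ^ 2 * gram 2 2 p" "gram 2 3 (scaled a p) = a ^ 4 * gram 2 3 p"
  "gram 3 3 (scaled a p) = a ^ 6 * gram 3 3 p"
proof -
  have S: "S_entry i 2 (scaled a p) = a * S_entry i 2 p" "S_entry i 3 (scaled a p) = a ^ 3 * S_entry i 3 p"
    if "i < 4" for i
    using scaled_S[OF that, of 2 p] scaled_S[OF that, of 3 p] a by (simp_all add: field_simps eval_nat_numeral)
  show "gram 2 2 (scaled a p) = a ^ 2 * gram 2 2 p" "gram 2 3 (scaled a p) = a ^ 4 * gram 2 3 p"
    "gram 3 3 (scaled a p) = a ^ 6 * gram 3 3 p"
    unfolding gram_def S[of 2, simplified] S[of 3, simplified]
    by (simp_all add: algebra_simps eval_nat_numeral)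
qed

lemma G_scaled:
  "G4 (scaled a p) = a ^ 6 * G4 p" "G3 (scaled a p) = a ^ 4 * G3 p" "G2 (scaled a p) = a ^ 2 * G2 p"
proof -
  show 4: "G4 (scaled a p) = a ^ 6 * G4 p" and "G3 (scaled a p) = a ^ 4 * G3 p"
    by (simp_all add: G4_def G3_def gram_scaled)
  show "G2 (scaled a p) = a ^ 2 * G2 p"
    unfolding G2_def gram_scaled 4 scaled_T using a by (simp add: field_simps eval_nat_numeral)
qed

lemma base_velocity_scaled:
  "n \<in> {2, 3, 4, 5} \<Longrightarrow> base_velocity n (scaled a p) = base_velocity n p / a ^ (2 * n)"
  unfolding base_velocity_def scaled_T G_scaled by (rule velocity_homogeneous[OF a])

lemma connection_entry_scaled:
  "j < 4 \<Longrightarrow> k < 4 \<Longrightarrow>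
    connection_entry j k (scaled a p) = connection_entry j k p * a ^ (2 * k) / a ^ (2 * j)"
  unfolding connection_entry_def scaled_T G_scaled by (rule gm_matrix_homogeneous[OF a])

lemma frame_velocity_scaled:
  assumes "i < 4" "k < 4"
  shows "frame_velocity i k (scaled a p) = a ^ (2 * k) / a ^ 3 * frame_velocity i k p"
proof -
  have summand: "S_entry i j (scaled a p) * connection_entry j k (scaled a p) =
      a ^ (2 * k) / a ^ 3 * (S_entry i j p * connection_entry j k p)" if "j < 4" for j
    using a by (simp add: scaled_S[OF assms(1) that] connection_entry_scaled[OF that assms(2)])
  have "target_row i k (scaled a p) = a ^ (2 * k) / a ^ 3 * target_row i k p"
    using assms by (simp add: target_row_def scaled_S algebra_simps add_divide_distrib)
  then show ?thesis by (simp add: frame_velocity_def summand algebra_simps)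
qed

end

end

section \<open>Descent to the moduli space\<close>

text \<open>Homogeneity on the coordinates means that \<open>w\<close> is mapped to itself by the action of \<open>a\<close>. Expressing this
  by transported curves avoids composing regular functions with the action, for which one would have to
  know the weight of the discriminant.\<close>

lemma scaled_along_curves:
  assumes w: "w \<in> derivations O_frame" and a: "a \<noteq> 0"
    and \<gamma>: "\<forall>p. \<gamma> p 0 = p"
    "\<forall>f\<in>O_frame. \<forall>p. ((\<lambda>\<epsilon>. f (\<gamma> p \<epsilon>)) has_field_derivative w f p) (at 0)"
    and T: "\<And>p. w T2 (scaled a p) = w T2 p / a ^ 4" "\<And>p. w T3 (scaled a p) = w T3 p / a ^ 6"
    "\<And>p. w T4 (scaled a p) = w T4 p / a ^ 8" "\<And>p. w T5 (scaled a p) = w T5 p / a ^ 10"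
    and S: "\<And>i j p. i < 4 \<Longrightarrow> j < 4 \<Longrightarrow> w (S_entry i j) (scaled a p) = a ^ (2 * j) / a ^ 3 * w (S_entry i j) p"
    and "f \<in> O_frame"
  shows "((\<lambda>\<epsilon>. f (scaled a (\<gamma> p \<epsilon>))) has_field_derivative w f (scaled a p)) (at 0)"
  using \<open>f \<in> O_frame\<close>
proof (induction rule: O_frame_induct)
  case (const c)
  then show ?case by (simp add: derivationsD(2)[OF w])
next
  case (coordinate h)
  have homogeneous: "((\<lambda>\<epsilon>. h (scaled a (\<gamma> p \<epsilon>))) has_field_derivative w h (scaled a p)) (at 0)"
    if "\<And>p. h (scaled a p) = k * h p" "\<And>p. w h (scaled a p) = k * w h p" for k
  proof -
    have "h \<in> O_frame" using coordinate coordinates_regular by auto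
    then have "((\<lambda>\<epsilon>. h (\<gamma> p \<epsilon>)) has_field_derivative w h p) (at 0)" using \<gamma>(2) by simp
    from DERIV_cmult[OF this, of k] show ?thesis unfolding that .
  qed
  consider "h = T2" | "h = T3" | "h = T4" | "h = T5" | i j where "i < 4" "j < 4" "h = S_entry i j"
    using coordinate unfolding coordinates_def by auto
  then show ?case
  proof cases
    case 1
    then show ?thesis using homogeneous[of "1 / a ^ 4"] by (simp add: scaled_T[OF a] T)
  next
    case 2
    then show ?thesis using homogeneous[of "1 / a ^ 6"] by (simp add: scaled_T[OF a] T)
  next
    case 3
    then show ?thesis using homogeneous[of "1 / a ^ 8"] by (simp add: scaled_T[OF a] T)
  next
    case 4
    then show ?thesis using homogeneous[of "1 / a ^ 10"] by (simp add: scaled_T[OF a] T)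
  next
    case 5
    then show ?thesis using homogeneous[of "a ^ (2 * j) / a ^ 3"] by (simp only: scaled_S[OF a] S)
  qed
next
  case (add f g)
  show ?case unfolding derivationsD(3)[OF w add(1,2)] by (rule DERIV_add[OF add(3,4)])
next
  case (mult f g)
  show ?case unfolding derivationsD(4)[OF w mult(1,2)]
    using DERIV_mult[OF mult(3,4)] by (simp add: \<gamma>(1) algebra_simps)
next
  case (inverse f)
  show ?case unfolding derivation_inverse[OF w inverse(1-3)]
    by (auto intro!: derivative_eq_intros inverse(4) simp: inverse(3) \<gamma>(1) power2_eq_square)
qed

lemma abs_eq_imp_scaled: "abs_moduli_T p = abs_moduli_T q \<Longrightarrow> \<exists>a. a \<noteq> 0 \<and> q = scaled a p"
  using moduli_T.abs_eq_iff same_orbit_scaled by blast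

lemma function_algebra_O_T: "function_algebra O_T"
  unfolding function_algebra_def O_T_def by (auto simp: o_def intro: regular_intros)

lemma moduli_fun_eqI: "(\<And>p. F (abs_moduli_T p) = G (abs_moduli_T p)) \<Longrightarrow> F = G"
proof
  fix t assume eq: "\<And>p. F (abs_moduli_T p) = G (abs_moduli_T p)"
  show "F t = G t" by (induction t rule: moduli_T.abs_induct) (rule eq)
qed

text \<open>The derivative of a function on \<open>T\<close>, evaluated at any representative of an orbit.\<close>

lemma derivation_descends:
  assumes w: "w \<in> derivations O_frame"
    and invariant: "\<And>f a p. f \<in> O_T \<Longrightarrow> a \<noteq> 0 \<Longrightarrow> w (f \<circ> abs_moduli_T) (scaled a p) = w (f \<circ> abs_moduli_T) p"
  obtains R where "R \<in> vector_fields_T" "\<forall>f\<in>O_T. w (f \<circ> abs_moduli_T) = R f \<circ> abs_moduli_T"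
proof -
  define R where "R = restrict (\<lambda>f t. w (f \<circ> abs_moduli_T) (rep_moduli_T t)) O_T"
  have up: "f \<circ> abs_moduli_T \<in> O_frame" if "f \<in> O_T" for f using that by (simp add: O_T_def)
  have R: "w (f \<circ> abs_moduli_T) p = R f (abs_moduli_T p)" if f: "f \<in> O_T" for f p
  proof -
    have "abs_moduli_T (rep_moduli_T (abs_moduli_T p)) = abs_moduli_T p"
      by (rule Quotient_abs_rep[OF Quotient_moduli_T])
    then obtain a where a: "a \<noteq> 0" "rep_moduli_T (abs_moduli_T p) = scaled a p"
      using abs_eq_imp_scaled[of p "rep_moduli_T (abs_moduli_T p)"] by auto
    then show ?thesis using invariant[OF f a(1)] f by (simp add: R_def)
  qed
  have R_comp: "w (f \<circ> abs_moduli_T) = R f \<circ> abs_moduli_T" if "f \<in> O_T" for f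
    using R[OF that] by (simp add: fun_eq_iff)
  have plus: "f + g \<in> O_T" "f * g \<in> O_T" if "f \<in> O_T" "g \<in> O_T" for f g
    using function_algebra_add[OF function_algebra_O_T that] function_algebra_mult[OF function_algebra_O_T that]
    by (simp_all add: plus_fun_def times_fun_def)
  have const: "(\<lambda>_. c) \<in> O_T" for c by (rule function_algebra_const[OF function_algebra_O_T])
  have comp: "(f + g) \<circ> abs_moduli_T = (f \<circ> abs_moduli_T) + (g \<circ> abs_moduli_T)"
    "(f * g) \<circ> abs_moduli_T = (f \<circ> abs_moduli_T) * (g \<circ> abs_moduli_T)" for f g :: "moduli_T \<Rightarrow> complex"
    by (simp_all add: fun_eq_iff)
  have "R \<in> vector_fields_T"
    unfolding vector_fields_T_def derivations_def
  proof (rule CollectI, intro conjI allI ballI)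
    have "R f \<in> O_T" if "f \<in> O_T" for f
      using derivation_closed[OF w up[OF that]] R_comp[OF that] by (simp add: O_T_def)
    then show "R \<in> O_T \<rightarrow>\<^sub>E O_T" by (auto simp: R_def)
    show "R (\<lambda>_. c) = 0" for c
      by (rule moduli_fun_eqI) (simp add: R[OF const, symmetric] o_def derivationsD(2)[OF w])
    fix f g assume fg: "f \<in> O_T" "g \<in> O_T"
    show "R (f + g) = R f + R g"
      by (rule moduli_fun_eqI)
        (simp only: R[OF plus(1)[OF fg], symmetric] comp derivation_plus[OF w up[OF fg(1)] up[OF fg(2)]]
          plus_fun_apply R[OF fg(1)] R[OF fg(2)])
    show "R (f * g) = f * R g + g * R f"
      by (rule moduli_fun_eqI)
        (simp only: R[OF plus(2)[OF fg], symmetric] comp derivation_times[OF w up[OF fg(1)] up[OF fg(2)]]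
          plus_fun_apply times_fun_apply o_apply R[OF fg(1)] R[OF fg(2)])
  qed
  then show ?thesis using R_comp by (intro that) auto
qed

text \<open>The entries of the block matrix with \<open>C\<close> in the upper right corner, for symmetric \<open>C\<close>. All three
  vector fields are special cases of one construction for \<open>C = e\<^sub>1C\<^sub>1 + e\<^sub>2C\<^sub>2 + e\<^sub>3C\<^sub>3\<close>.\<close>

definition connection_block :: "complex \<Rightarrow> complex \<Rightarrow> complex \<Rightarrow> nat \<Rightarrow> nat \<Rightarrow> complex" where
  "connection_block e1 e2 e3 i j = (if (i, j) = (0, 2) then e1 else if (i, j) = (1, 3) then e2
     else if (i, j) \<in> {(0, 3), (1, 2)} then e3 else 0)"

lemma vector_field_exists:
  assumes M: "\<And>i j. i < 4 \<Longrightarrow> j < 4 \<Longrightarrow> M $$ (i, j) = connection_block e1 e2 e3 i j"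
  shows "\<exists>R. R \<in> vector_fields_T \<and> nabla_T R alpha (mat_apply M alpha)"
proof -
  obtain w \<gamma> where w: "w \<in> derivations O_frame"
    "w T2 = base_velocity e1 e2 e3 2" "w T3 = base_velocity e1 e2 e3 3"
    "w T4 = base_velocity e1 e2 e3 4" "w T5 = base_velocity e1 e2 e3 5"
    "\<forall>i<4. \<forall>j<4. w (S_entry i j) = frame_velocity e1 e2 e3 i j" and \<gamma>: "\<forall>p. \<gamma> p 0 = p"
    "\<forall>f\<in>O_frame. \<forall>p. ((\<lambda>\<epsilon>. f (\<gamma> p \<epsilon>)) has_field_derivative w f p) (at 0)"
    by (rule derivation_with_velocity[OF base_velocity_regular base_velocity_regular
        base_velocity_regular base_velocity_regular frame_velocity_regular frame_velocity_block velocity_tangent])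
  have invariant: "w (f \<circ> abs_moduli_T) (scaled a p) = w (f \<circ> abs_moduli_T) p"
    if f: "f \<in> O_T" and a: "a \<noteq> 0" for f a p
  proof -
    have F: "f \<circ> abs_moduli_T \<in> O_frame" using f by (simp add: O_T_def)
    have "((\<lambda>\<epsilon>. (f \<circ> abs_moduli_T) (scaled a (\<gamma> p \<epsilon>))) has_field_derivative w (f \<circ> abs_moduli_T) (scaled a p)) (at 0)"
      by (rule scaled_along_curves[OF w(1) a \<gamma> _ _ _ _ _ F])
        (simp_all add: w base_velocity_scaled[OF a] frame_velocity_scaled[OF a])
    moreover have "((\<lambda>\<epsilon>. (f \<circ> abs_moduli_T) (\<gamma> p \<epsilon>)) has_field_derivative w (f \<circ> abs_moduli_T) p) (at 0)"
      using \<gamma>(2) F by blast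
    ultimately show ?thesis by (simp add: abs_scaled[OF a] DERIV_unique)
  qed
  obtain R where R: "R \<in> vector_fields_T" "\<forall>f\<in>O_T. w (f \<circ> abs_moduli_T) = R f \<circ> abs_moduli_T"
    by (rule derivation_descends[OF w(1) invariant])
  let ?G2 = "G2 e1 e2 e3" and ?G3 = "G3 e1 e2 e3" and ?G4 = "G4 e1 e2 e3"
  define g where "g p = [:gm_g0 (T2 p) (T3 p) (T4 p) (?G2 p) (?G3 p) (?G4 p), 0, ?G2 p, ?G3 p, ?G4 p:]" for p
  define \<alpha> where "\<alpha> p = [:gm_a0 (T2 p) (T3 p) (?G3 p) (?G4 p), gm_a1 (T2 p) (?G2 p) (?G4 p),
    5 * ?G3 p, 5 * ?G4 p:]" for p
  have g: "regular_family g"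
    unfolding g_def[abs_def]
    by (intro regular_family_pCons regular_family_fixed gm_coefficients_regular G_regular regular_intros(1))
  have \<alpha>: "regular_family \<alpha>"
    unfolding \<alpha>_def[abs_def]
    by (intro regular_family_pCons regular_family_fixed gm_coefficients_regular
        regular_intros(1,3) G_regular)
  have tangent: "[:w T5 p, w T4 p, w T3 p, w T2 p:] + g p * pderiv (fq p) = \<alpha> p * fq p" for p
    unfolding w g_def \<alpha>_def quintic_T base_velocity_def by (rule tangent_lift)
  have "gauss_manin proj O_frame O_curve w (alpha i) (mat_apply M alpha i)" if i: "i < 4" for i
  proof -
    let ?rs = "[S_entry i 0, S_entry i 1, S_entry i 2, S_entry i 3]"
    let ?s = "\<lambda>j p. S_entry i j p"
    define N where "N p = [:target_row e1 e2 e3 i 0 p, target_row e1 e2 e3 i 1 p,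
      target_row e1 e2 e3 i 2 p, target_row e1 e2 e3 i 3 p:]" for p
    define Q where "Q p = [:?s 1 p * ?G4 p + ?s 2 p * ?G3 p + ?s 3 p * (?G2 p - T2 p * ?G4 p),
      ?s 2 p * ?G4 p + ?s 3 p * ?G3 p, ?s 3 p * ?G4 p:]" for p
    have Q: "regular_family Q"
      unfolding Q_def[abs_def]
      by (intro regular_family_pCons regular_family_fixed regular_intros(2,3,5) S_entry_regular i
          G_regular T_regular) auto
    have rs: "map (S_entry i) [0..<4] = ?rs" by (simp add: eval_nat_numeral)
    have row: "\<kappa> (alpha i) z = S_entry i 0 (proj z) + S_entry i 1 (proj z) * x_coord z
        + S_entry i 2 (proj z) * x_coord z ^ 2 + S_entry i 3 (proj z) * x_coord z ^ 3" for i z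
      by (simp add: alpha_coefficient sum_less_4 eval_nat_numeral)
    have target: "\<kappa> (mat_apply M alpha i) = fiber_fun N (\<lambda>_. 0)"
    proof
      fix z
      have "\<kappa> (mat_apply M alpha i) z = (\<Sum>j<4. M $$ (i, j) * \<kappa> (alpha j) z)"
        by (simp add: mat_apply_coefficient sum_less_4)
      also have "\<dots> = (\<Sum>j<4. connection_block e1 e2 e3 i j * \<kappa> (alpha j) z)"
        using M[OF i] by (intro sum.cong) auto
      also have "\<dots> = fiber_fun N (\<lambda>_. 0) z"
        using i unfolding less_4_cases sum_less_4 row
        by (elim disjE; simp add: connection_block_def fiber_fun_def N_def target_row_def;
            simp add: algebra_simps eval_nat_numeral)
      finally show "\<kappa> (mat_apply M alpha i) z = fiber_fun N (\<lambda>_. 0) z" .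
    qed
    show ?thesis
    proof (rule gauss_manin_lift[OF w(1) g \<alpha> tangent alpha_form[OF i] _ _ mat_apply_form target Q])
      show "\<kappa> (alpha i) = horner ?rs" unfolding alpha_horner rs ..
      show "set ?rs \<subseteq> O_frame" using S_entry_regular[OF i] by auto
      fix p
      let ?A = "\<lambda>j k. connection_entry e1 e2 e3 j k p"
      let ?SA = "[:?s 0 p * ?A 0 0 + ?s 1 p * ?A 1 0 + ?s 2 p * ?A 2 0 + ?s 3 p * ?A 3 0,
        ?s 0 p * ?A 0 1 + ?s 1 p * ?A 1 1 + ?s 2 p * ?A 2 1 + ?s 3 p * ?A 3 1,
        ?s 0 p * ?A 0 2 + ?s 1 p * ?A 1 2 + ?s 2 p * ?A 2 2 + ?s 3 p * ?A 3 2,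
        ?s 0 p * ?A 0 3 + ?s 1 p * ?A 1 3 + ?s 2 p * ?A 2 3 + ?s 3 p * ?A 3 3:]"
      have reduction: "pderiv (Poly (map (\<lambda>r. r p) ?rs) * g p) - smult (1/2) (\<alpha> p * Poly (map (\<lambda>r. r p) ?rs)) =
          ?SA + (pderiv (Q p) * fq p + smult (1/2) (Q p * pderiv (fq p)))"
        unfolding list.map Poly.simps g_def \<alpha>_def Q_def quintic_T connection_entry_def
        by (rule gauss_manin_reduction)
      have "Poly (map (\<lambda>r. w r p) ?rs) + ?SA = N p"
        using w(6) i by (simp add: N_def frame_velocity_def)
      then show "Poly (map (\<lambda>r. w r p) ?rs) + pderiv (Poly (map (\<lambda>r. r p) ?rs) * g p)
          - smult (1/2) (\<alpha> p * Poly (map (\<lambda>r. r p) ?rs))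
        = N p + (pderiv (Q p) * fq p + smult (1/2) (Q p * pderiv (fq p)))"
        using reduction by (simp only: add_diff_eq[symmetric] add.assoc[symmetric])
    qed
  qed
  then show ?thesis
    using R w(1) unfolding nabla_T_def by blast
qed

lemma connection_matrix_entries:
  assumes "1 \<le> k" "k \<le> 3" "i < 4" "j < 4"
  shows "four_block_mat (0\<^sub>m 2 2) (C_mat k) (0\<^sub>m 2 2) (0\<^sub>m 2 2) $$ (i, j) =
    connection_block (if k = 1 then 1 else 0) (if k = 2 then 1 else 0) (if k = 3 then 1 else 0) i j"
proof -
  have "k \<in> {1, 2, 3}" using assms by auto
  moreover have "dim_row (C_mat k) = 2" "dim_col (C_mat k) = 2"
    by (simp_all add: C_mat_def mat_of_rows_list_def)
  ultimately show ?thesis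
    using assms(3,4) unfolding less_4_cases
    by (elim disjE insertE emptyE; simp add: connection_block_def; simp add: C_mat_def mat_of_rows_list_def)
qed

theorem theorem5p1:
  fixes k :: nat
  assumes "1 \<le> k" and "k \<le> 3"
  shows "\<exists>!R. R \<in> vector_fields_T \<and>
    nabla_T R alpha
      (mat_apply (four_block_mat (0\<^sub>m 2 2) (C_mat k) (0\<^sub>m 2 2) (0\<^sub>m 2 2)) alpha)"
  using vector_field_exists[OF connection_matrix_entries[OF assms]] vector_field_unique by blast

end
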